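(* Let $\mathbb{G}$ be a homogeneous group with a homogeneous distance $d$, and let $\Sigma\subset\mathbb{G}$ be an $n$-dimensional submanifold of class $C^1$ and of degree $N$. Let $\mathcal{S}^N$ be the $N$-dimensional spherical measure constructed with $d$. Assume: (I) for every $x\in\Sigma$ of maximum degree $N$ (i.e. $d_\Sigma(x)=N$) one has $\theta^N(\mu_\Sigma,x)=\beta_d(A_x\Sigma)$; (II) the set of points of $\Sigma$ having degree less than $N$ is $\mathcal{S}^N$-negligible. Then for every Borel set $B\subset\Sigma$, $$\int_B \beta_d(A_x\Sigma)\, d\mathcal{S}^N(x)=\int_B \|\tau^{\tilde g}_{\Sigma,N}(x)\|_g\, d\sigma_{\tilde g}(x).$$
   Context: **Homogeneous groups.** A graded group of step $\iota$ is a connected, simply connected, nilpotent Lie group whose Lie algebra is a direct sum $H_1\oplus\cdots\oplus H_\iota$ with $[H_i,H_j]\subset H_{i+j}$ ($H_k=\{0\}$ for $k>\iota$) and $H_\iota\neq\{0\}$. Through the exponential map it is identified with its Lie algebra, so $\mathbb{G}=H_1\oplus\cdots\oplus H_\iota$ is a finite-dimensional real vector space with the group product given by the Baker–Campbell–Hausdorff formula; the unit is $0$. Dilations $\delta_r$, $r>0$, are the linear maps acting as multiplication by $r^i$ on $H_i$; with them $\mathbb{G}$ is a homogeneous group. A homogeneous distance $d$ is a distance with $d(zx,zy)=d(x,y)$ and $d(\delta_rx,\delta_ry)=r\,d(x,y)$ for all $x,y,z\in\mathbb{G}$, $r>0$. $\mathbb{B}(x,r)=\{y: d(x,y)\le r\}$.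 A scalar product on $\mathbb{G}$ making the layers $H_i$ mutually orthogonal is fixed, with norm $|\cdot|$; $\mathcal{H}^k_{|\cdot|}$ is the $k$-dimensional Euclidean Hausdorff measure (normalized to agree with Lebesgue measure on $k$-planes), and $g$ is the left invariant Riemannian metric extending the scalar product from $T_0\mathbb{G}\cong\mathbb{G}$. **Spherical factor.** For a linear subspace $V\subset\mathbb{G}$ of dimension $n$, $\beta_d(V)=\max_{z\in\mathbb{B}(0,1)}\mathcal{H}^n_{|\cdot|}(V\cap\mathbb{B}(z,1))$. **Spherical measure.** $\mathcal{S}^\alpha(A)=\sup_{\delta>0}\inf\{\sum_j(\operatorname{diam}(B_j)/2)^\alpha: A\subset\bigcup_jB_j,\ B_j\text{ closed metric balls of positive radius},\ \operatorname{diam}(B_j)\le\delta\}$ (countable coverings, diameters with respect to $d$). **Degree.** Fix a basis $e_1,\dots,e_{\mathrm q}$ of $\mathbb{G}$ that is the union of bases of the layers; let $d_i=j$ if $e_i\in H_j$, and let $X_i$ be the left invariant vector field with $X_i(0)=e_i$. For $I=(i_1<\dots<i_n)$ put $X_I=X_{i_1}\wedge\cdots\wedge X_{i_n}$ and $d(I)=d_{i_1}+\cdots+d_{i_n}$. For $p\in\mathbb{G}$ and $M\in\mathbb{N}$, $\pi_{p,M}$ is the linear projection of $\Lambda_n(T_p\mathbb{G})$ onto $\operatorname{span}\{X_I(p):d(I)=M\}$ that kills $X_I(p)$ for $d(I)\ne M$. If $\Sigma$ is an (embedded) $C^1$ submanifold of dimension $n$ and $\tau_\Sigma(p)$ is a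 nonzero simple $n$-vector orienting $T_p\Sigma$, the degree of $\Sigma$ at $p$ is $d_\Sigma(p)=\max\{M:\pi_{p,M}(\tau_\Sigma(p))\neq0\}$, and the degree of $\Sigma$ is $N=\max_{p\in\Sigma}d_\Sigma(p)$. Points with $d_\Sigma(p)=N$ are points of maximum degree. **Homogeneous tangent space.** If $d_\Sigma(p)=N$, let $\xi\in\Lambda_n\mathbb{G}$ be the $n$-vector at $0$ whose left invariant extension takes the value $\pi_{p,N}(\tau_\Sigma(p))$ at $p$. Then $A_p\Sigma=\{v\in\mathbb{G}: v\wedge\xi=0\}$, a homogeneous (i.e. dilation invariant linear) subspace of dimension $n$. **Intrinsic measure.** $\tilde g$ is any fixed Riemannian metric on $\mathbb{G}$, $\sigma_{\tilde g}$ is the $n$-dimensional Riemannian surface measure induced by $\tilde g$ on $\Sigma$, $\tau^{\tilde g}_\Sigma(p)$ is a simple tangent $n$-vector to $\Sigma$ at $p$ of unit length with respect to $\tilde g$, $\tau^{\tilde g}_{\Sigma,N}(p)=\pi_{p,N}(\tau^{\tilde g}_\Sigma(p))$, and $\|\cdot\|_g$ is the norm on $n$-vectors induced by $g$. Define $\mu_\Sigma(B)=\int_{B\cap\Sigma}\|\tau^{\tilde g}_{\Sigma,N}\|_g\,d\sigma_{\tilde g}$ for Borel $B\subset\mathbb{G}$ (this does not depend on $\tilde g$). **Federer density.** $\theta^N(\mu,x)=\inf_{\varepsilon>0}\sup\{\mu(B)/(\operatorname{diam}(B)/2)^N: B\text{ a closed ball of positive radius},\ x\in B,\ \operatorname{diam}(B)<\varepsilon\}$.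 *)

theory Defs
  imports "HOL-Analysis.Analysis" "Jordan_Normal_Form.Determinant"
begin

text \<open>
  The homogeneous group is modelled on a type of class \<^class>\<open>euclidean_space\<close>: the type is the
  Lie algebra, identified with the group through the exponential map, and its inner product is
  the fixed scalar product. All tangent spaces are identified with the type itself.
\<close>

section \<open>Homogeneous groups\<close>

fun nested_bracket :: "('a \<Rightarrow> 'a \<Rightarrow> 'a) \<Rightarrow> 'a list \<Rightarrow> 'a::zero" where
  "nested_bracket br [] = 0"
| "nested_bracket br [x] = x"
| "nested_bracket br (x # y # zs) = br x (nested_bracket br (y # zs))"

text \<open>
  Dynkin's form of the Baker--Campbell--Hausdorff series of a Lie algebra of step \<open>m\<close>,
  \[ \sum_{k \ge 1} \frac{(-1)^{k-1}}{k} \sum_{r_i + s_i > 0}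
     \frac{[x^{r_1} y^{s_1} \cdots x^{r_k} y^{s_k}]}{\sum_i (r_i + s_i) \prod_i r_i! \, s_i!} , \]
  with right-nested brackets. Brackets of more than \<open>m\<close> entries vanish, so only
  \<open>\<Sum>\<^sub>i (r\<^sub>i + s\<^sub>i) \<le> m\<close> is kept and the sum is finite.
\<close>

definition bch :: "('a \<Rightarrow> 'a \<Rightarrow> 'a) \<Rightarrow> nat \<Rightarrow> 'a \<Rightarrow> 'a \<Rightarrow> 'a::real_vector" where
  "bch br m x y =
    (\<Sum>ps | (\<forall>(r, s)\<in>set ps. 0 < r + s) \<and> sum_list (map (\<lambda>(r, s). r + s) ps) \<in> {1..m}.
      ((-1) ^ (length ps - 1) /
        (real (length ps) * real (sum_list (map (\<lambda>(r, s). r + s) ps))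
          * prod_list (map (\<lambda>(r, s). fact r * fact s) ps)))
      *\<^sub>R nested_bracket br (concat (map (\<lambda>(r, s). replicate r x @ replicate s y) ps)))"

text \<open>
  \<open>H i\<close> is the layer of degree \<open>i\<close>, with the convention \<open>H 0 = {0}\<close>; since the layers are
  mutually orthogonal, spanning the space means that it is their direct sum.
\<close>

locale homogeneous_group =
  fixes H :: "nat \<Rightarrow> 'a::euclidean_space set" and \<iota> :: nat
    and br :: "'a \<Rightarrow> 'a \<Rightarrow> 'a" and mul :: "'a \<Rightarrow> 'a \<Rightarrow> 'a"
  assumes bracket_bilinear: "bilinear br"
    and bracket_self: "br x x = 0"
    and jacobi: "br x (br y z) + br y (br z x) + br z (br x y) = 0"
    and layer_subspace: "subspace (H i)"
    and layers_orthogonal: "\<lbrakk>i \<noteq> j; x \<in> H i; y \<in> H j\<rbrakk> \<Longrightarrow> inner x y = 0"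
    and layers_span: "span (\<Union>i\<in>{1..\<iota>}. H i) = UNIV"
    and layer_zero: "H 0 = {0}"
    and layer_above: "\<iota> < k \<Longrightarrow> H k = {0}"
    and layer_top: "H \<iota> \<noteq> {0}"
    and bracket_layers: "\<lbrakk>x \<in> H i; y \<in> H j\<rbrakk> \<Longrightarrow> br x y \<in> H (i + j)"
    and group: "Groups.group mul 0 uminus"
    and mul_bch: "mul x y = bch br \<iota> x y"

definition dilation :: "(nat \<Rightarrow> 'a::euclidean_space set) \<Rightarrow> real \<Rightarrow> 'a \<Rightarrow> 'a" where
  "dilation H r = (THE f. linear f \<and> (\<forall>i. \<forall>v\<in>H i. f v = r ^ i *\<^sub>R v))"

definition homogeneous_distance ::
  "(nat \<Rightarrow> 'a::euclidean_space set) \<Rightarrow> ('a \<Rightarrow> 'a \<Rightarrow> 'a) \<Rightarrow> ('a \<Rightarrow> 'a \<Rightarrow> real) \<Rightarrow> bool" where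
  "homogeneous_distance H mul d \<longleftrightarrow>
     Metric_space UNIV d \<and>
     (\<forall>x y z. d (mul z x) (mul z y) = d x y) \<and>
     (\<forall>x y r. 0 < r \<longrightarrow> d (dilation H r x) (dilation H r y) = r * d x y)"

definition adapted_basis :: "(nat \<Rightarrow> 'a::euclidean_space set) \<Rightarrow> nat \<Rightarrow> 'a list \<Rightarrow> bool" where
  "adapted_basis H \<iota> es \<longleftrightarrow>
     distinct es \<and> set es \<subseteq> (\<Union>j\<in>{1..\<iota>}. H j) \<and>
     (\<forall>j\<in>{1..\<iota>}. independent (set es \<inter> H j) \<and> span (set es \<inter> H j) = H j)"

text \<open>The differential at \<open>0\<close> of the left translation by \<open>p\<close>; thus \<open>left_diff mul p v\<close> is the
  value at \<open>p\<close> of the left invariant vector field equal to \<open>v\<close> at \<open>0\<close>.\<close>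

definition left_diff :: "('a \<Rightarrow> 'a \<Rightarrow> 'a) \<Rightarrow> 'a \<Rightarrow> 'a \<Rightarrow> 'a::euclidean_space" where
  "left_diff mul p = frechet_derivative (mul p) (at 0)"


section \<open>Measures and densities of metric balls\<close>

text \<open>Caratheodory's construction from the family \<open>F\<close> of covering sets, with size \<open>dm\<close> and
  gauge \<open>\<zeta>\<close>. Coverings are countable sets of sets, so that an empty covering of the empty set is
  available, also for the gauge \<open>diam\<^sup>0 = 1\<close>.\<close>

definition caratheodory_construction ::
  "'a set set \<Rightarrow> ('a set \<Rightarrow> real) \<Rightarrow> ('a set \<Rightarrow> real) \<Rightarrow> 'a set \<Rightarrow> ennreal" where
  "caratheodory_construction F dm \<zeta> A =
     (SUP \<delta>\<in>{0<..}.
        INF \<C>\<in>{\<C>. countable \<C> \<and> \<C> \<subseteq> F \<and> A \<subseteq> \<Union>\<C> \<and> (\<forall>C\<in>\<C>. dm C \<le> \<delta>)}.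
          \<Sum>\<^sub>\<infinity>C\<in>\<C>. ennreal (\<zeta> C))"

text \<open>Only bounded covering sets are allowed, as \<^const>\<open>diameter\<close> is meaningless on unbounded
  ones. The constant \<^const>\<open>unit_ball_vol\<close> is the normalization by Lebesgue measure.\<close>

definition hausdorff_measure :: "nat \<Rightarrow> 'a::euclidean_space set \<Rightarrow> ennreal" where
  "hausdorff_measure k =
     caratheodory_construction {C. bounded C} diameter
       (\<lambda>C. unit_ball_vol (real k) * (diameter C / 2) ^ k)"

definition hausdorff_borel :: "nat \<Rightarrow> 'a::euclidean_space measure" where
  "hausdorff_borel k = measure_of UNIV (sets borel) (hausdorff_measure k)"

definition closed_balls :: "('a \<Rightarrow> 'a \<Rightarrow> real) \<Rightarrow> 'a set set" where
  "closed_balls d = {Metric_space.mcball UNIV d x r | x r. 0 < r}"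

text \<open>Used for (bounded, nonempty) balls only.\<close>

definition dist_diameter :: "('a \<Rightarrow> 'a \<Rightarrow> real) \<Rightarrow> 'a set \<Rightarrow> real" where
  "dist_diameter d C = (SUP (x, y)\<in>C \<times> C. d x y)"

definition spherical_measure :: "('a \<Rightarrow> 'a \<Rightarrow> real) \<Rightarrow> nat \<Rightarrow> 'a set \<Rightarrow> ennreal" where
  "spherical_measure d N =
     caratheodory_construction (closed_balls d) (dist_diameter d)
       (\<lambda>C. (dist_diameter d C / 2) ^ N)"

text \<open>The restriction to the Borel sets; the topology of a homogeneous distance is the
  Euclidean one.\<close>

definition spherical_borel ::
  "('a::euclidean_space \<Rightarrow> 'a \<Rightarrow> real) \<Rightarrow> nat \<Rightarrow> 'a measure" where
  "spherical_borel d N = measure_of UNIV (sets borel) (spherical_measure d N)"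

definition federer_density ::
  "('a \<Rightarrow> 'a \<Rightarrow> real) \<Rightarrow> nat \<Rightarrow> 'a measure \<Rightarrow> 'a \<Rightarrow> ennreal" where
  "federer_density d N \<mu> x =
     (INF \<epsilon>\<in>{0<..}.
        SUP C\<in>{C \<in> closed_balls d. x \<in> C \<and> dist_diameter d C < \<epsilon>}.
          emeasure \<mu> C / ennreal ((dist_diameter d C / 2) ^ N))"

definition spherical_factor ::
  "('a::euclidean_space \<Rightarrow> 'a \<Rightarrow> real) \<Rightarrow> nat \<Rightarrow> 'a set \<Rightarrow> ennreal" where
  "spherical_factor d n V =
     (SUP z\<in>Metric_space.mcball UNIV d 0 1.
        hausdorff_measure n (V \<inter> Metric_space.mcball UNIV d z 1))"


section \<open>Multivectors\<close>

text \<open>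
  An \<open>n\<close>-vector \<open>\<xi>\<close> is encoded by the alternating \<open>n\<close>-linear function
  \<open>[w\<^sub>1, \<dots>, w\<^sub>n] \<mapsto> \<langle>\<xi>, w\<^sub>1 \<and> \<dots> \<and> w\<^sub>n\<rangle>\<close>, where the pairing is the one induced by the inner product
  of the type (so this is the canonical isomorphism of the exterior power with the alternating
  forms on the dual space); it is zero on lists of other lengths.
\<close>

type_synonym 'a multivector = "'a list \<Rightarrow> real"

definition gram_det :: "('a \<Rightarrow> 'a \<Rightarrow> real) \<Rightarrow> 'a list \<Rightarrow> 'a list \<Rightarrow> real" where
  "gram_det b vs ws =
     Determinant.det (Matrix.mat (length vs) (length vs) (\<lambda>(i, j). b (vs ! i) (ws ! j)))"

text \<open>The simple multivector \<open>v\<^sub>1 \<and> \<dots> \<and> v\<^sub>n\<close>.\<close>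

definition wedge_list :: "'a::euclidean_space list \<Rightarrow> 'a multivector" where
  "wedge_list vs = (\<lambda>ws. if length ws = length vs then gram_det inner vs ws else 0)"

text \<open>The product \<open>v \<and> \<xi>\<close>; on simple multivectors this is the expansion of the Gram determinant
  of \<open>v \<and> v\<^sub>1 \<and> \<dots> \<and> v\<^sub>n\<close> along its first row.\<close>

definition wedge :: "'a::euclidean_space \<Rightarrow> 'a multivector \<Rightarrow> 'a multivector" where
  "wedge v \<xi> = (\<lambda>ws. \<Sum>i<length ws. (-1) ^ i * inner v (ws ! i) * \<xi> (take i ws @ drop (Suc i) ws))"

definition mv_span :: "'a multivector set \<Rightarrow> 'a multivector set" where
  "mv_span A = {\<eta>. \<exists>c. \<eta> = (\<lambda>ws. \<Sum>\<xi>\<in>A. c \<xi> * \<xi> ws)}"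

text \<open>The map induced on multivectors by a linear map \<open>T\<close>: it sends
  \<open>v\<^sub>1 \<and> \<dots> \<and> v\<^sub>n\<close> to \<open>T v\<^sub>1 \<and> \<dots> \<and> T v\<^sub>n\<close>.\<close>

definition mv_map :: "('a::euclidean_space \<Rightarrow> 'a) \<Rightarrow> 'a multivector \<Rightarrow> 'a multivector" where
  "mv_map T \<xi> = (\<lambda>ws. \<xi> (map (adjoint T) ws))"

text \<open>The norm of an \<open>n\<close>-vector induced by the inner product of the type. Each orthonormal basis
  element \<open>b\<^sub>1 \<and> \<dots> \<and> b\<^sub>n\<close> is counted \<open>n!\<close> times, once for each ordering.\<close>

definition mv_norm :: "nat \<Rightarrow> 'a::euclidean_space multivector \<Rightarrow> real" where
  "mv_norm n \<xi> = sqrt ((\<Sum>bs | set bs \<subseteq> Basis \<and> length bs = n. (\<xi> bs)\<^sup>2) / fact n)"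

text \<open>The \<open>n\<close>-vector at \<open>0\<close> whose left invariant extension has the value \<open>\<eta>\<close> at \<open>p\<close>.\<close>

definition left_translate_to_0 ::
  "('a \<Rightarrow> 'a \<Rightarrow> 'a) \<Rightarrow> 'a \<Rightarrow> 'a multivector \<Rightarrow> 'a::euclidean_space multivector" where
  "left_translate_to_0 mul p = mv_map (inv_into UNIV (left_diff mul p))"

text \<open>The norm on \<open>n\<close>-vectors at \<open>p\<close> induced by the left invariant Riemannian metric that extends
  the inner product: for this metric, left translations are isometries.\<close>

definition left_invariant_norm ::
  "('a \<Rightarrow> 'a \<Rightarrow> 'a) \<Rightarrow> nat \<Rightarrow> 'a \<Rightarrow> 'a::euclidean_space multivector \<Rightarrow> real" where
  "left_invariant_norm mul n p \<eta> = mv_norm n (left_translate_to_0 mul p \<eta>)"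

text \<open>A multi-index \<open>i\<^sub>1 < \<dots> < i\<^sub>n\<close> is the set of its entries; basis elements are numbered from \<open>0\<close>.\<close>

definition multi_indices :: "'a list \<Rightarrow> nat \<Rightarrow> nat set set" where
  "multi_indices es n = {I. I \<subseteq> {..<length es} \<and> card I = n}"

definition index_degree :: "(nat \<Rightarrow> 'a set) \<Rightarrow> 'a list \<Rightarrow> nat set \<Rightarrow> nat" where
  "index_degree H es I = (\<Sum>i\<in>I. THE j. es ! i \<in> H j)"

definition left_invariant_mv ::
  "('a \<Rightarrow> 'a \<Rightarrow> 'a) \<Rightarrow> 'a list \<Rightarrow> nat set \<Rightarrow> 'a \<Rightarrow> 'a::euclidean_space multivector" where
  "left_invariant_mv mul es I p =
     wedge_list (map (\<lambda>i. left_diff mul p (es ! i)) (sorted_list_of_set I))"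

definition degree_proj ::
  "(nat \<Rightarrow> 'a::euclidean_space set) \<Rightarrow> ('a \<Rightarrow> 'a \<Rightarrow> 'a) \<Rightarrow> 'a list \<Rightarrow> nat \<Rightarrow> 'a \<Rightarrow> nat \<Rightarrow>
    'a multivector \<Rightarrow> 'a multivector" where
  "degree_proj H mul es n p M \<tau> =
     (THE \<eta>.
        \<eta> \<in> mv_span {left_invariant_mv mul es I p | I.
                       I \<in> multi_indices es n \<and> index_degree H es I = M} \<and>
        (\<lambda>ws. \<tau> ws - \<eta> ws) \<in>
            mv_span {left_invariant_mv mul es I p | I.
                       I \<in> multi_indices es n \<and> index_degree H es I \<noteq> M})"


section \<open>Submanifolds and Riemannian metrics\<close>

primrec Ck_on ::
  "nat \<Rightarrow> 'a::euclidean_space set \<Rightarrow> ('a \<Rightarrow> 'b::real_normed_vector) \<Rightarrow> bool" where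
  "Ck_on 0 U f \<longleftrightarrow> continuous_on U f"
| "Ck_on (Suc k) U f \<longleftrightarrow>
     (\<forall>x\<in>U. f differentiable (at x)) \<and>
     (\<forall>v. Ck_on k U (\<lambda>x. frechet_derivative f (at x) v))"

text \<open>
  Local parametrizations of \<open>S\<close>. The parameter domain is the relatively open subset
  \<open>U \<inter> span (set ls)\<close> of the \<open>n\<close>-dimensional subspace with orthonormal basis \<open>ls\<close>, which stands in
  for an open subset of \<open>\<real>\<^sup>n\<close>; the map is defined and of class \<open>C\<^sup>1\<close> on the open set \<open>U\<close>, which is no
  restriction since it may be extended to be constant in the orthogonal directions.
\<close>

definition local_parametrization ::
  "nat \<Rightarrow> 'a::euclidean_space set \<Rightarrow> 'a list \<Rightarrow> 'a set \<Rightarrow> ('a \<Rightarrow> 'a) \<Rightarrow> bool" where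
  "local_parametrization n S ls U \<phi> \<longleftrightarrow>
     length ls = n \<and>
     (\<forall>i<n. \<forall>j<n. inner (ls ! i) (ls ! j) = (if i = j then 1 else 0)) \<and>
     open U \<and> Ck_on 1 U \<phi> \<and>
     (\<forall>x\<in>U \<inter> span (set ls). inj_on (frechet_derivative \<phi> (at x)) (span (set ls))) \<and>
     openin (top_of_set S) (\<phi> ` (U \<inter> span (set ls))) \<and>
     (\<exists>\<psi>. homeomorphism (U \<inter> span (set ls)) (\<phi> ` (U \<inter> span (set ls))) \<phi> \<psi>)"

definition C1_submanifold :: "nat \<Rightarrow> 'a::euclidean_space set \<Rightarrow> bool" where
  "C1_submanifold n S \<longleftrightarrow>
     (\<forall>p\<in>S. \<exists>ls U \<phi>. local_parametrization n S ls U \<phi> \<and> p \<in> \<phi> ` (U \<inter> span (set ls)))"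

definition tangent_space :: "'a::euclidean_space set \<Rightarrow> 'a \<Rightarrow> 'a set" where
  "tangent_space S p =
     {v. \<exists>\<gamma> \<epsilon>. 0 < \<epsilon> \<and> (\<forall>t\<in>{-\<epsilon><..<\<epsilon>}. \<gamma> t \<in> S) \<and> \<gamma> 0 = p \<and>
           (\<gamma> has_vector_derivative v) (at (0::real))}"

definition tangent_frame :: "'a::euclidean_space set \<Rightarrow> 'a \<Rightarrow> 'a list \<Rightarrow> bool" where
  "tangent_frame S p ts \<longleftrightarrow>
     distinct ts \<and> independent (set ts) \<and> span (set ts) = tangent_space S p"

definition riemannian_metric :: "('a::euclidean_space \<Rightarrow> 'a \<Rightarrow> 'a \<Rightarrow> real) \<Rightarrow> bool" where
  "riemannian_metric gt \<longleftrightarrow>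
     (\<forall>p. bilinear (gt p) \<and> (\<forall>v w. gt p v w = gt p w v) \<and> (\<forall>v. v \<noteq> 0 \<longrightarrow> 0 < gt p v v)) \<and>
     (\<forall>v w k. Ck_on k UNIV (\<lambda>p. gt p v w))"

definition param_volume_density ::
  "('a::euclidean_space \<Rightarrow> 'a \<Rightarrow> 'a \<Rightarrow> real) \<Rightarrow> 'a list \<Rightarrow> ('a \<Rightarrow> 'a) \<Rightarrow> 'a \<Rightarrow> real" where
  "param_volume_density gt ls \<phi> x =
     sqrt (gram_det (gt (\<phi> x)) (map (frechet_derivative \<phi> (at x)) ls)
                               (map (frechet_derivative \<phi> (at x)) ls))"

text \<open>
  The Riemannian surface measure is the one given in local coordinates by the density
  \<^const>\<open>param_volume_density\<close>. To glue the local expressions, \<open>B\<close> is exhausted by finitely many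
  disjoint pieces \<open>\<phi> ` E\<close>, each of them contained in the image of one parametrization.
\<close>

definition surface_measure ::
  "('a::euclidean_space \<Rightarrow> 'a \<Rightarrow> 'a \<Rightarrow> real) \<Rightarrow> nat \<Rightarrow> 'a set \<Rightarrow> 'a measure" where
  "surface_measure gt n S = measure_of UNIV (sets borel) (\<lambda>B.
     SUP F\<in>{F. finite F \<and>
               (\<forall>(ls, U, \<phi>, E)\<in>F. local_parametrization n S ls U \<phi> \<and>
                   E \<in> sets borel \<and> E \<subseteq> U \<inter> span (set ls) \<and> \<phi> ` E \<subseteq> B) \<and>
               disjoint_family_on (\<lambda>(ls, U, \<phi>, E). \<phi> ` E) F}.
       \<Sum>(ls, U, \<phi>, E)\<in>F.
         \<integral>\<^sup>+x\<in>E. ennreal (param_volume_density gt ls \<phi> x) \<partial>hausdorff_borel n)"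


section \<open>Degree, homogeneous tangent space and intrinsic measure of a submanifold\<close>

definition tangent_mv :: "'a::euclidean_space set \<Rightarrow> 'a \<Rightarrow> 'a multivector" where
  "tangent_mv S p = wedge_list (SOME ts. tangent_frame S p ts)"

definition point_degree ::
  "(nat \<Rightarrow> 'a::euclidean_space set) \<Rightarrow> ('a \<Rightarrow> 'a \<Rightarrow> 'a) \<Rightarrow> 'a list \<Rightarrow> nat \<Rightarrow> 'a set \<Rightarrow> 'a \<Rightarrow> nat"
  where
  "point_degree H mul es n S p =
     Max {M. degree_proj H mul es n p M (tangent_mv S p) \<noteq> (\<lambda>_. 0)}"

definition submanifold_degree ::
  "(nat \<Rightarrow> 'a::euclidean_space set) \<Rightarrow> ('a \<Rightarrow> 'a \<Rightarrow> 'a) \<Rightarrow> 'a list \<Rightarrow> nat \<Rightarrow> 'a set \<Rightarrow> nat" where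
  "submanifold_degree H mul es n S = Max (point_degree H mul es n S ` S)"

text \<open>Meaningful at the points of degree \<open>N\<close> only.\<close>

definition homogeneous_tangent_space ::
  "(nat \<Rightarrow> 'a::euclidean_space set) \<Rightarrow> ('a \<Rightarrow> 'a \<Rightarrow> 'a) \<Rightarrow> 'a list \<Rightarrow> nat \<Rightarrow> nat \<Rightarrow> 'a set \<Rightarrow> 'a \<Rightarrow>
    'a set" where
  "homogeneous_tangent_space H mul es n N S p =
     {v. wedge v (left_translate_to_0 mul p (degree_proj H mul es n p N (tangent_mv S p)))
         = (\<lambda>_. 0)}"

definition unit_tangent_mv ::
  "('a::euclidean_space \<Rightarrow> 'a \<Rightarrow> 'a \<Rightarrow> real) \<Rightarrow> 'a set \<Rightarrow> 'a \<Rightarrow> 'a multivector" where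
  "unit_tangent_mv gt S p =
     wedge_list (SOME ts. tangent_frame S p ts \<and> sqrt (gram_det (gt p) ts ts) = 1)"

definition intrinsic_density ::
  "(nat \<Rightarrow> 'a::euclidean_space set) \<Rightarrow> ('a \<Rightarrow> 'a \<Rightarrow> 'a) \<Rightarrow> 'a list \<Rightarrow>
    ('a \<Rightarrow> 'a \<Rightarrow> 'a \<Rightarrow> real) \<Rightarrow> nat \<Rightarrow> nat \<Rightarrow> 'a set \<Rightarrow> 'a \<Rightarrow> real" where
  "intrinsic_density H mul es gt n N S p =
     left_invariant_norm mul n p (degree_proj H mul es n p N (unit_tangent_mv gt S p))"

definition intrinsic_measure ::
  "(nat \<Rightarrow> 'a::euclidean_space set) \<Rightarrow> ('a \<Rightarrow> 'a \<Rightarrow> 'a) \<Rightarrow> 'a list \<Rightarrow>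
    ('a \<Rightarrow> 'a \<Rightarrow> 'a \<Rightarrow> real) \<Rightarrow> nat \<Rightarrow> nat \<Rightarrow> 'a set \<Rightarrow> 'a measure" where
  "intrinsic_measure H mul es gt n N S =
     measure_of UNIV (sets borel) (\<lambda>B.
       \<integral>\<^sup>+p\<in>B \<inter> S. ennreal (intrinsic_density H mul es gt n N S p) \<partial>surface_measure gt n S)"

end

theory Submission
  imports Defs
begin

text \<open>
  Since (I) identifies \<open>\<beta>\<close> with the Federer density \<open>\<theta>\<close> of \<open>\<nu> = \<mu>\<^sub>\<Sigma>\<close>, the formula says that
  \<open>\<nu>(A) = \<integral>\<^sub>A \<theta> dS\<^sup>N\<close> for Borel sets \<open>A\<close> on which \<open>0 < \<theta> < \<infinity>\<close>. This holds for every Borel measure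
  \<open>\<nu>\<close>: the definition of \<open>S\<^sup>N\<close> by coverings gives \<open>\<nu> \<le> t S\<^sup>N\<close> on \<open>{\<theta> < t}\<close>, a Vitali covering by balls
  \<open>C\<close> with \<open>\<nu>(C) > t (diam C / 2)\<^sup>N\<close> gives \<open>t S\<^sup>N \<le> \<nu>\<close> on \<open>{\<theta> > t}\<close>, and \<open>A\<close> is cut into the level
  sets of \<open>\<theta>\<close> along a geometric progression of ratio close to \<open>1\<close>. Of the distance this uses only
  that it induces the Euclidean topology and that the diameter of a ball is a fixed multiple of its
  radius.

  At points of maximum degree \<open>\<beta>\<close> is positive and finite because \<open>A\<^sub>x\<Sigma>\<close> is a subspace of dimension
  \<open>n\<close>. By (II) the other points lie in an \<open>S\<^sup>N\<close>-null Borel set \<open>Z\<close>, and \<open>\<nu>(Z) = 0\<close>: where \<open>\<theta> < \<infinity>\<close> by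
  the first inequality, and where \<open>\<theta> = \<infinity>\<close> because such points of \<open>\<Sigma>\<close> have degree less than \<open>N\<close>, so
  that the intrinsic density vanishes there.
\<close>

section \<open>Sums of extended nonnegative reals\<close>

text \<open>Two obstacles shape the proof. First, \<open>\<nu>\<close> may be infinite on bounded
  sets, and neither the intrinsic density nor \<beta> nor the degree is shown to be measurable. So
  \<open>\<nu>\<close> is handled as a lower integral, which is still a measure in its domain; the
  points of lower degree are enclosed in a Borel null set; and \<beta> is exchanged almost
  everywhere for \<theta>, whose superlevel sets at a fixed scale are open. Where \<theta> <
  \<infinity>, some ball about the point has finite measure, which is the finiteness that outer
  regularity asks for. Second, no doubling property of \<open>\<nu>\<close> is at hand. Enlarging
  all balls of a Vitali family would cost a factor 5^N and spoil the constant, so finitely many of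
  them keep their size and only a tail of small total gauge is enlarged. That \<open>d\<close>
  induces the Euclidean topology is not part of the definition of a homogeneous distance; it is
  derived from left invariance and homogeneity. That the homogeneous tangent space has dimension
  \<open>n\<close> comes from dilating the translated tangent space and passing to the
  limit.\<close>

lemma sum_le_infsum_ennreal:
  fixes f :: "'b \<Rightarrow> ennreal"
  assumes "finite F" "F \<subseteq> A"
  shows "sum f F \<le> infsum f A"
  by (subst nonneg_infsum_complete) (use assms in \<open>auto intro!: SUP_upper\<close>)

lemma infsum_ennreal_leI:
  fixes f :: "'b \<Rightarrow> ennreal"
  assumes "\<And>F. finite F \<Longrightarrow> F \<subseteq> A \<Longrightarrow> sum f F \<le> b"
  shows "infsum f A \<le> b"
  by (subst nonneg_infsum_complete) (use assms in \<open>auto intro!: SUP_least\<close>)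

lemma infsum_ennreal_mono_set:
  fixes f :: "'b \<Rightarrow> ennreal"
  assumes "A \<subseteq> A'"
  shows "infsum f A \<le> infsum f A'"
  using assms by (auto intro!: infsum_ennreal_leI sum_le_infsum_ennreal)

lemma infsum_ennreal_UN_le:
  fixes f :: "'b \<Rightarrow> ennreal" and A :: "nat \<Rightarrow> 'b set"
  shows "infsum f (\<Union>k. A k) \<le> (\<Sum>k. infsum f (A k))"
proof (rule infsum_ennreal_leI)
  fix F assume F: "finite F" "F \<subseteq> (\<Union>k. A k)"
  have "sum f F \<le> (\<Sum>x\<in>F. \<Sum>k. f x * indicator (A k) x)"
  proof (rule sum_mono)
    fix x assume "x \<in> F"
    then obtain k where k: "x \<in> A k" using F by auto
    have "f x = sum (\<lambda>k. f x * indicator (A k) x) {k}" using k by simp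
    also have "\<dots> \<le> (\<Sum>k. f x * indicator (A k) x)" by (rule sum_le_suminf) auto
    finally show "f x \<le> (\<Sum>k. f x * indicator (A k) x)" .
  qed
  also have "\<dots> = (\<Sum>k. \<Sum>x\<in>F. f x * indicator (A k) x)"
    by (rule suminf_sum[symmetric]) simp
  also have "\<dots> \<le> (\<Sum>k. infsum f (A k))"
  proof (rule suminf_le)
    fix k
    have "(\<Sum>x\<in>F. f x * indicator (A k) x) = sum f (F \<inter> A k)"
      using F by (simp add: indicator_def if_distrib sum.inter_restrict cong: if_cong)
    also have "\<dots> \<le> infsum f (A k)" using F by (intro sum_le_infsum_ennreal) auto
    finally show "(\<Sum>x\<in>F. f x * indicator (A k) x) \<le> infsum f (A k)" .
  qed auto
  finally show "sum f F \<le> (\<Sum>k. infsum f (A k))" .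
qed

lemma infsum_ennreal_Un_le:
  fixes f :: "'b \<Rightarrow> ennreal"
  shows "infsum f (A \<union> A') \<le> infsum f A + infsum f A'"
proof (rule infsum_ennreal_leI)
  fix F assume F: "finite F" "F \<subseteq> A \<union> A'"
  then have "sum f F = sum f (F \<inter> A) + sum f (F - A)"
    by (metis sum.Int_Diff)
  also have "\<dots> \<le> infsum f A + infsum f A'"
    using F by (intro add_mono sum_le_infsum_ennreal) auto
  finally show "sum f F \<le> infsum f A + infsum f A'" .
qed

lemma infsum_ennreal_disjoint_ge:
  fixes f :: "'b \<Rightarrow> ennreal"
  assumes "A \<inter> A' = {}" "A \<union> A' \<subseteq> C"
  shows "infsum f A + infsum f A' \<le> infsum f C"
proof -
  have "infsum f A + infsum f A' = infsum f (A \<union> A')"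
    by (rule infsum_Un_disjoint[symmetric]) (use assms in \<open>auto intro: nonneg_summable_on_complete\<close>)
  also have "\<dots> \<le> infsum f C" by (rule infsum_ennreal_mono_set[OF assms(2)])
  finally show ?thesis .
qed

text \<open>Covers are sets of sets: members of an indexed family that coincide are counted once, so
  only an inequality survives the change of index.\<close>

lemma infsum_ennreal_image_le:
  fixes f :: "'c \<Rightarrow> ennreal"
  shows "infsum f (h ` A) \<le> infsum (f \<circ> h) A"
proof (rule infsum_ennreal_leI)
  fix F assume F: "finite F" "F \<subseteq> h ` A"
  then obtain G where G: "G \<subseteq> A" "inj_on h G" "F = h ` G" by (meson subset_image_inj)
  then have "finite G" using F finite_image_iff by blast
  have "sum f F = sum (f \<circ> h) G" using G by (simp add: sum.reindex)
  also have "\<dots> \<le> infsum (f \<circ> h) A" using G \<open>finite G\<close> by (intro sum_le_infsum_ennreal) auto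
  finally show "sum f F \<le> infsum (f \<circ> h) A" .
qed

text \<open>In the Vitali argument this splits off finitely many balls; the remaining ones are cheap
  enough to be enlarged.\<close>

lemma infsum_ennreal_tail:
  fixes f :: "'b \<Rightarrow> ennreal"
  assumes "infsum f A < \<infinity>" "0 < e"
  obtains F where "finite F" "F \<subseteq> A" "infsum f (A - F) \<le> e"
proof (cases "infsum f A = 0")
  case True
  have "infsum f (A - {}) \<le> e" using True by simp
  then show ?thesis using that by blast
next
  case False
  define s where "s = infsum f A"
  have "s - e < s" using False assms unfolding s_def
    by (intro ennreal_between) (auto simp: zero_less_iff_neq_zero)
  then obtain F where F: "finite F" "F \<subseteq> A" "s - e < sum f F"
    unfolding s_def nonneg_infsum_complete[of A f, simplified] less_SUP_iff by auto
  have eq: "s = sum f F + infsum f (A - F)"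
    using infsum_Un_disjoint[of f F "A - F"] F
    by (simp add: s_def nonneg_summable_on_complete Un_absorb1)
  have "sum f F < \<infinity>" using eq assms(1) s_def by (metis add_top ennreal_add_eq_top infinity_ennreal_def top.not_eq_extremum)
  have "s \<le> sum f F + e"
    using F(3) by (metis add.commute ennreal_minus_le_iff less_le)
  then have "infsum f (A - F) \<le> e"
    using eq \<open>sum f F < \<infinity>\<close> by (metis ennreal_add_left_cancel_le infinity_ennreal_def less_irrefl)
  then show ?thesis using that F by blast
qed

lemma infsum_ennreal_cmult:
  fixes f :: "'b \<Rightarrow> ennreal"
  shows "infsum (\<lambda>x. c * f x) A = c * infsum f A"
proof -
  have "infsum (\<lambda>x. c * f x) A = (SUP F\<in>{F. finite F \<and> F\<subseteq>A}. c * sum f F)"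
    by (subst nonneg_infsum_complete) (auto simp: sum_distrib_left)
  also have "\<dots> = c * infsum f A"
    by (subst nonneg_infsum_complete) (auto simp: SUP_mult_left_ennreal)
  finally show ?thesis .
qed

lemma emeasure_le_infsum:
  assumes "countable \<C>" "\<C> \<subseteq> sets M" "A \<subseteq> \<Union>\<C>"
  shows "emeasure M A \<le> infsum (emeasure M) \<C>"
proof (cases "\<C> = {}")
  case True then show ?thesis using assms by auto
next
  case False
  \<comment> \<open>The enumeration may repeat members of \<open>\<C>\<close>; the sum over the
    image set counts each of them once and so stays below the unordered sum.\<close>
  define U where "U m = \<Union>(from_nat_into \<C> ` {..<m})" for m
  have in_C: "from_nat_into \<C> i \<in> \<C>" for i by (simp add: False from_nat_into)
  have U: "U m \<in> sets M" for m using in_C assms by (auto simp: U_def)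
  have "\<Union>\<C> = (\<Union>m. U m)"
  proof -
    have "\<C> = range (from_nat_into \<C>)" using False assms by simp
    moreover have "(\<Union>m. U m) = \<Union>(range (from_nat_into \<C>))" unfolding U_def by blast
    ultimately show ?thesis by metis
  qed
  moreover have "incseq U" unfolding U_def incseq_def by fastforce
  ultimately have "emeasure M (\<Union>\<C>) = (SUP m. emeasure M (U m))"
    using U by (simp add: SUP_emeasure_incseq image_subsetI)
  also have "\<dots> \<le> infsum (emeasure M) \<C>"
  proof (rule SUP_least)
    fix m
    have "emeasure M (U m) \<le> sum (emeasure M) (from_nat_into \<C> ` {..<m})"
      unfolding U_def using in_C assms(2)
      using emeasure_subadditive_finite[of "from_nat_into \<C> ` {..<m}" "\<lambda>x. x" M] by auto
    also have "\<dots> \<le> infsum (emeasure M) \<C>" using in_C by (intro sum_le_infsum_ennreal) auto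
    finally show "emeasure M (U m) \<le> infsum (emeasure M) \<C>" .
  qed
  finally have "emeasure M (\<Union>\<C>) \<le> infsum (emeasure M) \<C>" .
  moreover have "emeasure M A \<le> emeasure M (\<Union>\<C>)"
    using assms by (intro emeasure_mono sets.countable_Union) auto
  ultimately show ?thesis by simp
qed

lemma infsum_disjoint_le_emeasure:
  assumes "disjoint \<C>" "\<C> \<subseteq> sets M" "\<Union>\<C> \<subseteq> V" "V \<in> sets M"
  shows "infsum (emeasure M) \<C> \<le> emeasure M V"
proof (rule infsum_ennreal_leI)
  fix F assume F: "finite F" "F \<subseteq> \<C>"
  have "sum (emeasure M) F = emeasure M (\<Union>C\<in>F. C)"
    using F assms
    by (intro sum_emeasure) (auto simp del: disjoint_iff simp: disjoint_family_on_def dest: disjointD)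
  also have "\<dots> \<le> emeasure M V" using F assms by (intro emeasure_mono) auto
  finally show "sum (emeasure M) F \<le> emeasure M V" .
qed

section \<open>Caratheodory's construction\<close>

text \<open>The approximating outer measure at scale \<delta>. It grows as \<delta> decreases, so
  the supremum in the construction is a limit.\<close>

definition cover_content ::
  "'a set set \<Rightarrow> ('a set \<Rightarrow> real) \<Rightarrow> ('a set \<Rightarrow> real) \<Rightarrow> real \<Rightarrow> 'a set \<Rightarrow> ennreal" where
  "cover_content F dm \<zeta> \<delta> A =
    (INF \<C>\<in>{\<C>. countable \<C> \<and> \<C> \<subseteq> F \<and> A \<subseteq> \<Union>\<C> \<and> (\<forall>C\<in>\<C>. dm C \<le> \<delta>)}.
       \<Sum>\<^sub>\<infinity>C\<in>\<C>. ennreal (\<zeta> C))"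

lemma caratheodory_construction_eq:
  "caratheodory_construction F dm \<zeta> A = (SUP \<delta>\<in>{0<..}. cover_content F dm \<zeta> \<delta> A)"
  by (simp add: caratheodory_construction_def cover_content_def)

lemma cover_content_le_caratheodory:
  "0 < \<delta> \<Longrightarrow> cover_content F dm \<zeta> \<delta> A \<le> caratheodory_construction F dm \<zeta> A"
  unfolding caratheodory_construction_eq by (rule SUP_upper) simp

lemma cover_content_leI:
  assumes "countable \<C>" "\<C> \<subseteq> F" "A \<subseteq> \<Union>\<C>" "\<And>C. C \<in> \<C> \<Longrightarrow> dm C \<le> \<delta>"
  shows "cover_content F dm \<zeta> \<delta> A \<le> (\<Sum>\<^sub>\<infinity>C\<in>\<C>. ennreal (\<zeta> C))"
  unfolding cover_content_def by (rule INF_lower) (use assms in auto)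

lemma cover_content_geI:
  assumes "\<And>\<C>. countable \<C> \<Longrightarrow> \<C> \<subseteq> F \<Longrightarrow> A \<subseteq> \<Union>\<C> \<Longrightarrow> (\<forall>C\<in>\<C>. dm C \<le> \<delta>)
     \<Longrightarrow> b \<le> (\<Sum>\<^sub>\<infinity>C\<in>\<C>. ennreal (\<zeta> C))"
  shows "b \<le> cover_content F dm \<zeta> \<delta> A"
  unfolding cover_content_def by (rule INF_greatest) (use assms in auto)

lemma cover_content_lessE:
  assumes "cover_content F dm \<zeta> \<delta> A < b"
  obtains \<C> where "countable \<C>" "\<C> \<subseteq> F" "A \<subseteq> \<Union>\<C>" "\<And>C. C \<in> \<C> \<Longrightarrow> dm C \<le> \<delta>"
    "(\<Sum>\<^sub>\<infinity>C\<in>\<C>. ennreal (\<zeta> C)) < b"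
  using assms unfolding cover_content_def INF_less_iff by auto

lemma cover_content_antimono:
  assumes "\<delta> \<le> \<delta>'"
  shows "cover_content F dm \<zeta> \<delta>' A \<le> cover_content F dm \<zeta> \<delta> A"
  using assms by (intro cover_content_geI cover_content_leI) force+

lemma cover_content_mono:
  assumes "A \<subseteq> A'"
  shows "cover_content F dm \<zeta> \<delta> A \<le> cover_content F dm \<zeta> \<delta> A'"
  using assms by (intro cover_content_geI cover_content_leI) auto

lemma cover_content_UN_le:
  fixes A :: "nat \<Rightarrow> 'a set"
  shows "cover_content F dm \<zeta> \<delta> (\<Union>k. A k) \<le> (\<Sum>k. cover_content F dm \<zeta> \<delta> (A k))"
proof (rule ennreal_le_epsilon)
  fix e :: real assume fin: "(\<Sum>k. cover_content F dm \<zeta> \<delta> (A k)) < Orderings.top" and "0 < e"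
  let ?e = "\<lambda>k. ennreal (e * (1/2) ^ Suc k)"
  have e_sum: "(\<Sum>k. ?e k) = ennreal e"
  proof -
    have "(\<lambda>k. e * (1/2) ^ Suc k) sums (e * 1)" by (intro sums_mult power_half_series)
    then show ?thesis using \<open>0 < e\<close> by (intro suminf_ennreal_eq) auto
  qed
  have "\<forall>k. \<exists>\<C>. countable \<C> \<and> \<C> \<subseteq> F \<and> A k \<subseteq> \<Union>\<C> \<and> (\<forall>C\<in>\<C>. dm C \<le> \<delta>)
      \<and> (\<Sum>\<^sub>\<infinity>C\<in>\<C>. ennreal (\<zeta> C)) \<le> cover_content F dm \<zeta> \<delta> (A k) + ?e k"
  proof
    fix k
    have "cover_content F dm \<zeta> \<delta> (A k) < Orderings.top"
      by (rule ennreal_suminf_lessD[OF fin])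
    moreover have "0 < ?e k" using \<open>0 < e\<close> by simp
    ultimately have "cover_content F dm \<zeta> \<delta> (A k) + 0 < cover_content F dm \<zeta> \<delta> (A k) + ?e k"
      by (subst ennreal_add_left_cancel_less) (simp add: less_top)
    then have "cover_content F dm \<zeta> \<delta> (A k) < cover_content F dm \<zeta> \<delta> (A k) + ?e k" by simp
    then show "\<exists>\<C>. countable \<C> \<and> \<C> \<subseteq> F \<and> A k \<subseteq> \<Union>\<C> \<and> (\<forall>C\<in>\<C>. dm C \<le> \<delta>)
      \<and> (\<Sum>\<^sub>\<infinity>C\<in>\<C>. ennreal (\<zeta> C)) \<le> cover_content F dm \<zeta> \<delta> (A k) + ?e k"
      by (rule cover_content_lessE) (metis less_imp_le)
  qed
  then obtain \<C> where \<C>: "\<And>k. countable (\<C> k)" "\<And>k. \<C> k \<subseteq> F" "\<And>k. A k \<subseteq> \<Union>(\<C> k)"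
    "\<And>k C. C \<in> \<C> k \<Longrightarrow> dm C \<le> \<delta>"
    "\<And>k. (\<Sum>\<^sub>\<infinity>C\<in>\<C> k. ennreal (\<zeta> C)) \<le> cover_content F dm \<zeta> \<delta> (A k) + ?e k"
    by metis
  have "cover_content F dm \<zeta> \<delta> (\<Union>k. A k) \<le> (\<Sum>\<^sub>\<infinity>C\<in>(\<Union>k. \<C> k). ennreal (\<zeta> C))"
  proof (rule cover_content_leI)
    show "countable (\<Union>k. \<C> k)" using \<C>(1) by simp
    show "(\<Union>k. \<C> k) \<subseteq> F" using \<C>(2) by blast
    show "(\<Union>k. A k) \<subseteq> \<Union>(\<Union>k. \<C> k)" using \<C>(3) by blast
    show "dm C \<le> \<delta>" if "C \<in> (\<Union>k. \<C> k)" for C using \<C>(4) that by blast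
  qed
  also have "\<dots> \<le> (\<Sum>k. \<Sum>\<^sub>\<infinity>C\<in>\<C> k. ennreal (\<zeta> C))" by (rule infsum_ennreal_UN_le)
  also have "\<dots> \<le> (\<Sum>k. cover_content F dm \<zeta> \<delta> (A k) + ?e k)"
    by (rule suminf_le[OF \<C>(5)]) simp_all
  also have "\<dots> = (\<Sum>k. cover_content F dm \<zeta> \<delta> (A k)) + (\<Sum>k. ?e k)"
    by (rule suminf_add[symmetric]) auto
  also have "\<dots> = (\<Sum>k. cover_content F dm \<zeta> \<delta> (A k)) + ennreal e" unfolding e_sum ..
  finally show "cover_content F dm \<zeta> \<delta> (\<Union>k. A k) \<le> (\<Sum>k. cover_content F dm \<zeta> \<delta> (A k)) + ennreal e" .
qed

lemma cover_content_empty [simp]: "cover_content F dm \<zeta> \<delta> {} = 0"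
  using cover_content_leI[of "{}" F "{}" dm \<delta> \<zeta>] by simp

lemma caratheodory_construction_empty [simp]: "caratheodory_construction F dm \<zeta> {} = 0"
  by (simp add: caratheodory_construction_eq)

lemma caratheodory_construction_mono:
  "A \<subseteq> A' \<Longrightarrow> caratheodory_construction F dm \<zeta> A \<le> caratheodory_construction F dm \<zeta> A'"
  unfolding caratheodory_construction_eq by (intro SUP_mono') (rule cover_content_mono)

lemma caratheodory_construction_UN_le:
  fixes A :: "nat \<Rightarrow> 'a set"
  shows "caratheodory_construction F dm \<zeta> (\<Union>k. A k) \<le> (\<Sum>k. caratheodory_construction F dm \<zeta> (A k))"
  unfolding caratheodory_construction_eq[of _ _ _ "\<Union>k. A k"]
proof (rule SUP_least)
  fix \<delta> :: real assume "\<delta> \<in> {0<..}"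
  have "cover_content F dm \<zeta> \<delta> (\<Union>k. A k) \<le> (\<Sum>k. cover_content F dm \<zeta> \<delta> (A k))"
    by (rule cover_content_UN_le)
  also have "\<dots> \<le> (\<Sum>k. caratheodory_construction F dm \<zeta> (A k))"
  proof (rule suminf_le)
    show "cover_content F dm \<zeta> \<delta> (A k) \<le> caratheodory_construction F dm \<zeta> (A k)" for k
      using \<open>\<delta> \<in> _\<close> by (intro cover_content_le_caratheodory) simp
  qed simp_all
  finally show "cover_content F dm \<zeta> \<delta> (\<Union>k. A k) \<le> \<dots>" .
qed

lemma caratheodory_construction_Un_le:
  "caratheodory_construction F dm \<zeta> (A \<union> A')
    \<le> caratheodory_construction F dm \<zeta> A + caratheodory_construction F dm \<zeta> A'"
proof -
  define f where "f k = (if k = 0 then A else if k = 1 then A' else {})" for k :: nat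
  have "A = f 0" "A' = f 1" by (simp_all add: f_def)
  then have "A \<union> A' \<subseteq> (\<Union>k. f k)" by blast
  then have "caratheodory_construction F dm \<zeta> (A \<union> A') \<le> caratheodory_construction F dm \<zeta> (\<Union>k. f k)"
    by (rule caratheodory_construction_mono)
  also have "\<dots> \<le> (\<Sum>k. caratheodory_construction F dm \<zeta> (f k))"
    by (rule caratheodory_construction_UN_le)
  also have "\<dots> = (\<Sum>k\<in>{0, 1}. caratheodory_construction F dm \<zeta> (f k))"
    by (rule suminf_finite) (simp_all add: f_def)
  also have "\<dots> = caratheodory_construction F dm \<zeta> A + caratheodory_construction F dm \<zeta> A'"
    by (simp add: f_def)
  finally show ?thesis .
qed

lemma outer_measure_space_caratheodory:
  "outer_measure_space (Pow UNIV) (caratheodory_construction F dm \<zeta>)"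
  by (auto simp: outer_measure_space_def positive_def increasing_def countably_subadditive_def
      intro: caratheodory_construction_mono caratheodory_construction_UN_le)

text \<open>A covering set of size at most \<delta> meets at most one of the two sets, so a fine
  cover of the union contains two disjoint families covering one set each. The suprema over the
  scales add up because both contents grow towards smaller scales.\<close>

lemma caratheodory_construction_separated:
  assumes \<delta>: "0 < \<delta>" and sep: "\<And>C. C \<in> F \<Longrightarrow> dm C \<le> \<delta> \<Longrightarrow> C \<inter> A = {} \<or> C \<inter> A' = {}"
  shows "caratheodory_construction F dm \<zeta> A + caratheodory_construction F dm \<zeta> A'
    \<le> caratheodory_construction F dm \<zeta> (A \<union> A')"
proof -
  let ?c = "cover_content F dm \<zeta>"
  have small: "?c \<eta> A + ?c \<eta> A' \<le> caratheodory_construction F dm \<zeta> (A \<union> A')"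
    if "0 < \<eta>" "\<eta> \<le> \<delta>" for \<eta>
  proof -
    have "?c \<eta> A + ?c \<eta> A' \<le> ?c \<eta> (A \<union> A')"
    proof (rule cover_content_geI)
      fix \<C> assume \<C>: "countable \<C>" "\<C> \<subseteq> F" "A \<union> A' \<subseteq> \<Union>\<C>" "\<forall>C\<in>\<C>. dm C \<le> \<eta>"
      let ?A = "{C\<in>\<C>. C \<inter> A \<noteq> {}}" and ?A' = "{C\<in>\<C>. C \<inter> A' \<noteq> {}}"
      have "?c \<eta> A \<le> (\<Sum>\<^sub>\<infinity>C\<in>?A. ennreal (\<zeta> C))"
        by (rule cover_content_leI) (use \<C> in \<open>blast intro: countable_subset[OF _ \<C>(1)]\<close>)+
      moreover have "?c \<eta> A' \<le> (\<Sum>\<^sub>\<infinity>C\<in>?A'. ennreal (\<zeta> C))"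
        by (rule cover_content_leI) (use \<C> in \<open>blast intro: countable_subset[OF _ \<C>(1)]\<close>)+
      moreover have "(\<Sum>\<^sub>\<infinity>C\<in>?A. ennreal (\<zeta> C)) + (\<Sum>\<^sub>\<infinity>C\<in>?A'. ennreal (\<zeta> C))
          \<le> (\<Sum>\<^sub>\<infinity>C\<in>\<C>. ennreal (\<zeta> C))"
      proof (rule infsum_ennreal_disjoint_ge)
        have "C \<inter> A = {} \<or> C \<inter> A' = {}" if "C \<in> \<C>" for C
          using \<C>(2,4) that \<open>\<eta> \<le> \<delta>\<close> by (intro sep) force+
        then show "?A \<inter> ?A' = {}" by blast
      qed auto
      ultimately show "?c \<eta> A + ?c \<eta> A' \<le> (\<Sum>\<^sub>\<infinity>C\<in>\<C>. ennreal (\<zeta> C))"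
        by (meson add_mono order_trans)
    qed
    also have "\<dots> \<le> caratheodory_construction F dm \<zeta> (A \<union> A')"
      by (rule cover_content_le_caratheodory[OF that(1)])
    finally show ?thesis .
  qed
  have "(SUP \<delta>\<in>{0<..}. ?c \<delta> A) + (SUP \<delta>\<in>{0<..}. ?c \<delta> A') = (SUP \<delta>\<in>{0<..}. ?c \<delta> A + ?c \<delta> A')"
  proof (rule SUP_add_directed_ennreal[symmetric])
    fix i j :: real assume "i \<in> {0<..}" "j \<in> {0<..}"
    then show "\<exists>k\<in>{0<..}. ?c i A + ?c j A' \<le> ?c k A + ?c k A'"
      by (intro bexI[of _ "min i j"] add_mono cover_content_antimono) auto
  qed
  also have "\<dots> \<le> caratheodory_construction F dm \<zeta> (A \<union> A')"
  proof (rule SUP_least)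
    fix \<eta> :: real assume "\<eta> \<in> {0<..}"
    then have "?c \<eta> A + ?c \<eta> A' \<le> ?c (min \<eta> \<delta>) A + ?c (min \<eta> \<delta>) A'"
      by (intro add_mono cover_content_antimono) auto
    also have "\<dots> \<le> caratheodory_construction F dm \<zeta> (A \<union> A')"
      using \<open>\<eta> \<in> _\<close> \<delta> by (intro small) auto
    finally show "?c \<eta> A + ?c \<eta> A' \<le> \<dots>" .
  qed
  finally show ?thesis by (simp add: caratheodory_construction_eq)
qed

lemma ennreal_suminf_tail:
  fixes f :: "nat \<Rightarrow> ennreal"
  assumes "(\<Sum>i. f i) < \<infinity>" "0 < e"
  obtains k where "(\<Sum>i. f (i + k)) \<le> e"
proof (cases "(\<Sum>i. f i) = 0")
  case True
  have "(\<Sum>i. f (i + 0)) \<le> e" using True by simp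
  then show ?thesis using that by blast
next
  case False
  define s where "s = (\<Sum>i. f i)"
  have "s - e < s" using False assms unfolding s_def
    by (intro ennreal_between) (auto simp: zero_less_iff_neq_zero)
  then obtain k where k: "s - e < (\<Sum>i<k. f i)"
    unfolding s_def suminf_eq_SUP less_SUP_iff by auto
  have eq: "s = (\<Sum>i. f (i + k)) + (\<Sum>i<k. f i)"
    unfolding s_def by (rule suminf_offset) simp
  have fin: "(\<Sum>i<k. f i) < \<infinity>"
    using assms(1) unfolding eq[unfolded s_def] by (simp add: less_top[symmetric])
  have "s \<le> (\<Sum>i<k. f i) + e"
    using k by (metis add.commute ennreal_minus_le_iff less_le)
  then have "(\<Sum>i. f (i + k)) \<le> e"
    using fin unfolding eq by (simp add: add.commute[of _ e] add.commute[of "\<Sum>i<k. f i"] less_top[symmetric])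
  then show ?thesis using that by blast
qed

text \<open>The layers \<open>R k\<close> of \<open>X - K\<close> at distance about \<open>1 / k\<close> from \<open>K\<close>
  are separated from each other as soon as their indices differ by at least two.\<close>

lemma caratheodory_criterion:
  fixes \<mu> :: "'a set \<Rightarrow> ennreal" and d :: "'a \<Rightarrow> 'a \<Rightarrow> real"
  assumes oms: "outer_measure_space (Pow UNIV) \<mu>" and met: "Metric_space UNIV d"
    and sep: "\<And>A A' e. 0 < e \<Longrightarrow> (\<And>x y. x \<in> A \<Longrightarrow> y \<in> A' \<Longrightarrow> e \<le> d x y) \<Longrightarrow> \<mu> A + \<mu> A' \<le> \<mu> (A \<union> A')"
    and closed: "\<And>x. x \<notin> K \<Longrightarrow> \<exists>r>0. \<forall>y\<in>K. r \<le> d x y"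
  shows "\<mu> (X \<inter> K) + \<mu> (X - K) \<le> \<mu> X"
proof (cases "\<mu> X = \<infinity>")
  case True then show ?thesis by simp
next
  case False
  interpret Metric_space UNIV d by fact
  have mono: "A \<subseteq> A' \<Longrightarrow> \<mu> A \<le> \<mu> A'" for A A'
    using oms by (auto simp: outer_measure_space_def increasing_def)
  have empty: "\<mu> {} = 0" using oms by (auto simp: outer_measure_space_def positive_def)
  have subadd: "\<mu> (\<Union>i. A i) \<le> (\<Sum>i. \<mu> (A i))" for A :: "nat \<Rightarrow> 'a set"
    using oms unfolding outer_measure_space_def countably_subadditive_def
  proof -
    assume *: "positive (Pow UNIV) \<mu> \<and> increasing (Pow UNIV) \<mu> \<and>
      (\<forall>A::nat \<Rightarrow> 'a set. range A \<subseteq> Pow UNIV \<longrightarrow> disjoint_family A \<longrightarrow> \<Union> (range A) \<in> Pow UNIV \<longrightarrow> \<mu> (\<Union> (range A)) \<le> (\<Sum>i. \<mu> (A i)))"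
    \<comment> \<open>\<open>countably_subadditive\<close> speaks of disjoint families only, hence
      the detour through \<open>disjointed\<close>.\<close>
    have "\<mu> (\<Union>i. A i) = \<mu> (\<Union>i. disjointed A i)" by (simp add: UN_disjointed_eq)
    also have "\<dots> \<le> (\<Sum>i. \<mu> (disjointed A i))"
      using * disjoint_family_disjointed[of A] by auto
    also have "\<dots> \<le> (\<Sum>i. \<mu> (A i))"
      by (rule suminf_le[OF mono[OF disjointed_subset]]) simp_all
    finally show ?thesis .
  qed
  define T where "T k = {x\<in>X. \<forall>y\<in>K. 1 / real (Suc k) \<le> d x y}" for k
  define R where "R k = T (Suc k) - T k" for k
  have T_mono: "T k \<subseteq> T l" if "k \<le> l" for k l
  proof
    fix x assume "x \<in> T k"
    moreover have "1 / real (Suc l) \<le> 1 / real (Suc k)" using that by (intro divide_left_mono) auto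
    ultimately show "x \<in> T l" unfolding T_def using order_trans by blast
  qed
  \<comment> \<open>A point of \<open>X\<close> outside \<open>T (Suc k)\<close> has a point of
    \<open>K\<close> closer than 1/(k+2), whereas the points of \<open>T k\<close> keep distance at
    least 1/(k+1) from \<open>K\<close>; the difference separates them.\<close>
  have sepT: "\<mu> A + \<mu> A' \<le> \<mu> (A \<union> A')" if A: "A \<subseteq> T k" "A' \<subseteq> X" "A' \<inter> T (Suc k) = {}" for A A' k
  proof (rule sep)
    have "1 / real (Suc (Suc k)) < 1 / real (Suc k)" by (rule divide_strict_left_mono) auto
    then show "0 < 1 / real (Suc k) - 1 / real (Suc (Suc k))" by simp
    fix x y assume x: "x \<in> A" and y: "y \<in> A'"
    have "y \<in> X" "y \<notin> T (Suc k)" using A y by auto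
    then obtain z where z: "z \<in> K" "d y z < 1 / real (Suc (Suc k))"
      unfolding T_def by (auto simp: not_le simp del: of_nat_Suc)
    have "1 / real (Suc k) \<le> d x z" using x A(1) z unfolding T_def by blast
    also have "\<dots> \<le> d x y + d y z" by (rule triangle) auto
    finally show "1 / real (Suc k) - 1 / real (Suc (Suc k)) \<le> d x y" using z by linarith
  qed
  \<comment> \<open>Shells whose indices have the same parity are separated from each other, so
    their measures add up to at most \<open>\<mu> X\<close>. Even and odd indices together give a
    convergent series.\<close>
  have half: "(\<Sum>j. \<mu> (R (2 * j + p))) \<le> \<mu> X" for p
  proof (rule suminf_le_const)
    fix m
    have "(\<Sum>j<m. \<mu> (R (2 * j + p))) \<le> \<mu> (\<Union>j<m. R (2 * j + p))"
    proof (induction m)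
      case 0 then show ?case by (simp add: empty)
    next
      case (Suc m)
      have "(\<Sum>j<Suc m. \<mu> (R (2 * j + p))) \<le> \<mu> (\<Union>j<m. R (2 * j + p)) + \<mu> (R (2 * m + p))"
        using Suc by (simp add: add_mono)
      also have "\<dots> \<le> \<mu> ((\<Union>j<m. R (2 * j + p)) \<union> R (2 * m + p))"
      proof (cases m)
        case 0 then show ?thesis by (simp add: empty)
      next
        case (Suc m')
        show ?thesis
        proof (rule sepT[of _ "2 * m' + p + 1"])
          show "(\<Union>j<m. R (2 * j + p)) \<subseteq> T (2 * m' + p + 1)"
          proof (rule UN_least)
            fix j assume "j \<in> {..<m}"
            then have "T (Suc (2 * j + p)) \<subseteq> T (2 * m' + p + 1)" using Suc by (intro T_mono) auto
            then show "R (2 * j + p) \<subseteq> T (2 * m' + p + 1)" unfolding R_def by auto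
          qed
          show "R (2 * m + p) \<subseteq> X" by (auto simp: R_def T_def)
          have "Suc (2 * m' + p + 1) = 2 * m + p" using Suc by simp
          then show "R (2 * m + p) \<inter> T (Suc (2 * m' + p + 1)) = {}" by (simp only: R_def) blast
        qed
      qed
      also have "(\<Union>j<m. R (2 * j + p)) \<union> R (2 * m + p) = (\<Union>j<Suc m. R (2 * j + p))"
        by (auto simp: lessThan_Suc)
      finally show ?case .
    qed
    also have "\<dots> \<le> \<mu> X" by (rule mono) (auto simp: R_def T_def)
    finally show "(\<Sum>j<m. \<mu> (R (2 * j + p))) \<le> \<mu> X" .
  qed simp
  have "(\<Sum>k. \<mu> (R k)) \<le> \<mu> X + \<mu> X"
  proof (rule suminf_le_const)
    fix m
    have "(\<Sum>k<m. \<mu> (R k)) \<le> (\<Sum>k<2*m. \<mu> (R k))" by (intro sum_mono2) auto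
    also have "\<dots> = (\<Sum>j<m. \<mu> (R (2 * j + 0))) + (\<Sum>j<m. \<mu> (R (2 * j + 1)))"
      by (induction m) (auto simp: algebra_simps)
    also have "\<dots> \<le> (\<Sum>j. \<mu> (R (2 * j + 0))) + (\<Sum>j. \<mu> (R (2 * j + 1)))"
      by (intro add_mono sum_le_suminf) simp_all
    also have "\<dots> \<le> \<mu> X + \<mu> X" by (intro add_mono half)
    finally show "(\<Sum>k<m. \<mu> (R k)) \<le> \<mu> X + \<mu> X" .
  qed simp
  then have fin: "(\<Sum>k. \<mu> (R k)) < \<infinity>"
  proof (rule order_le_less_trans)
    show "\<mu> X + \<mu> X < \<infinity>" using False by (simp add: less_top[symmetric])
  qed
  show ?thesis
  proof (rule ennreal_le_epsilon)
    fix e :: real assume "0 < e"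
    obtain k where k: "(\<Sum>i. \<mu> (R (i + k))) \<le> ennreal e"
      by (rule ennreal_suminf_tail[OF fin, of "ennreal e"]) (use \<open>0 < e\<close> in auto)
    \<comment> \<open>Off \<open>T k\<close>, a point lies in the shell \<open>R (l - 1)\<close> for
      the least \<open>l\<close> such that \<open>T l\<close> contains it; the shells of index at
      least \<open>k\<close> have total measure at most \<open>e\<close>.\<close>
    have "X - K \<subseteq> T k \<union> (\<Union>i. R (i + k))"
    proof
      fix x assume x: "x \<in> X - K"
      then obtain r where r: "0 < r" "\<forall>y\<in>K. r \<le> d x y" using closed by auto
      obtain l where "1 / real (Suc l) < r" using nat_approx_posE[OF r(1)] by blast
      then have "\<forall>y\<in>K. 1 / real (Suc l) \<le> d x y" using r(2) by (meson less_le_trans less_imp_le)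
      then have "x \<in> T l" using x unfolding T_def by blast
      then have ex: "\<exists>l. x \<in> T l" ..
      define l where "l = (LEAST l. x \<in> T l)"
      have l: "x \<in> T l" unfolding l_def by (rule LeastI_ex[OF ex])
      show "x \<in> T k \<union> (\<Union>i. R (i + k))"
      proof (cases "l \<le> k")
        case True then show ?thesis using l T_mono[OF True] by blast
      next
        case False
        define i where "i = l - Suc k"
        have i: "l = Suc (i + k)" using False by (simp add: i_def)
        have "i + k < (LEAST l. x \<in> T l)" using i by (fold l_def) simp
        then have "x \<notin> T (i + k)" by (rule not_less_Least)
        then have "x \<in> R (i + k)" using l unfolding R_def i by blast
        then show ?thesis by blast
      qed
    qed
    also have "T k \<union> (\<Union>i. R (i + k)) = (\<Union>i. case i of 0 \<Rightarrow> T k | Suc i \<Rightarrow> R (i + k))"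
    proof (intro equalityI subsetI)
      fix x assume "x \<in> T k \<union> (\<Union>i. R (i + k))"
      then show "x \<in> (\<Union>i. case i of 0 \<Rightarrow> T k | Suc i \<Rightarrow> R (i + k))"
      proof
        assume "x \<in> T k" then show ?thesis by (intro UN_I[of 0]) auto
      next
        assume "x \<in> (\<Union>i. R (i + k))"
        then obtain i where "x \<in> R (i + k)" by blast
        then show ?thesis by (intro UN_I[of "Suc i"]) auto
      qed
    next
      fix x assume "x \<in> (\<Union>i. case i of 0 \<Rightarrow> T k | Suc i \<Rightarrow> R (i + k))"
      then obtain i where "x \<in> (case i of 0 \<Rightarrow> T k | Suc i \<Rightarrow> R (i + k))" by blast
      then show "x \<in> T k \<union> (\<Union>i. R (i + k))" by (cases i) auto
    qed
    finally have "\<mu> (X - K) \<le> (\<Sum>i. \<mu> (case i of 0 \<Rightarrow> T k | Suc i \<Rightarrow> R (i + k)))"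
      using order_trans[OF mono subadd] by simp
    also have "\<dots> = \<mu> (T k) + (\<Sum>i. \<mu> (R (i + k)))"
      by (subst suminf_offset[of _ 1]) (auto simp: add.commute)
    also have "\<dots> \<le> \<mu> (T k) + ennreal e" using k by (intro add_left_mono)
    finally have "\<mu> (X \<inter> K) + \<mu> (X - K) \<le> (\<mu> (T k) + \<mu> (X \<inter> K)) + ennreal e"
      by (metis add.assoc add.commute add_left_mono)
    also have "\<mu> (T k) + \<mu> (X \<inter> K) \<le> \<mu> (T k \<union> (X \<inter> K))"
    proof (rule sep)
      show "0 < 1 / real (Suc k)" by simp
    qed (auto simp: T_def)
    also have "\<dots> \<le> \<mu> X" by (rule mono) (auto simp: T_def)
    finally show "\<mu> (X \<inter> K) + \<mu> (X - K) \<le> \<mu> X + ennreal e" by (simp add: add_right_mono)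
  qed
qed

section \<open>Differentiation of measures\<close>

lemma ennreal_divide_times_cancel:
  "0 < t \<Longrightarrow> a / ennreal t * ennreal t = a"
  by (simp add: ennreal_divide_times)

section \<open>Vitali's covering lemma\<close>

text \<open>Zorn's lemma is applied to the disjoint subfamilies that dominate, up to the factor 2 in
  the radius, every ball they meet. A maximal one meets every ball: otherwise a missed ball whose
  radius exceeds half the supremum \<open>s\<close> of the missed radii could be added, since it
  dominates all missed balls. Balls are pairs of centre and radius because a set need not determine
  either.\<close>

lemma vitali_covering_pairs:
  fixes P :: "('a \<times> real) set"
  assumes met: "Metric_space UNIV d"
    and rad: "\<And>x r. (x, r) \<in> P \<Longrightarrow> 0 < r \<and> r \<le> R"
  defines "B \<equiv> \<lambda>p. Metric_space.mcball UNIV d (fst p) (snd p)"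
  shows "\<exists>Q\<subseteq>P. (\<forall>p\<in>Q. \<forall>q\<in>Q. p \<noteq> q \<longrightarrow> B p \<inter> B q = {}) \<and>
    (\<forall>p\<in>P. \<exists>q\<in>Q. B p \<inter> B q \<noteq> {} \<and> snd p \<le> 2 * snd q)"
proof -
  interpret Metric_space UNIV d by fact
  have mem: "x \<in> B p \<longleftrightarrow> d (fst p) x \<le> snd p" for x p by (simp add: B_def)
  have centre: "fst p \<in> B p" if "p \<in> P" for p
    using rad[of "fst p" "snd p"] that by (auto simp: mem)
  define \<Omega> where "\<Omega> = {Q. Q \<subseteq> P \<and> (\<forall>p\<in>Q. \<forall>q\<in>Q. p \<noteq> q \<longrightarrow> B p \<inter> B q = {}) \<and>
    (\<forall>p\<in>P. (\<exists>q\<in>Q. B p \<inter> B q \<noteq> {}) \<longrightarrow> (\<exists>q\<in>Q. B p \<inter> B q \<noteq> {} \<and> snd p \<le> 2 * snd q))}"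
  have "\<exists>M\<in>\<Omega>. \<forall>X\<in>\<Omega>. M \<subseteq> X \<longrightarrow> X = M"
  proof (rule subset_Zorn)
    fix C assume C: "subset.chain \<Omega> C"
    then have sub: "C \<subseteq> \<Omega>" and chain: "\<And>X Y. X \<in> C \<Longrightarrow> Y \<in> C \<Longrightarrow> X \<subseteq> Y \<or> Y \<subseteq> X"
      by (auto simp: subset_chain_def)
    have "\<Union>C \<in> \<Omega>" unfolding \<Omega>_def mem_Collect_eq
    proof (intro conjI ballI impI)
      show "\<Union>C \<subseteq> P" using sub unfolding \<Omega>_def by blast
    next
      fix p q assume "p \<in> \<Union>C" "q \<in> \<Union>C" "p \<noteq> q"
      then obtain X Y where XY: "X \<in> C" "p \<in> X" "Y \<in> C" "q \<in> Y" by blast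
      then obtain Z where "Z \<in> C" "p \<in> Z" "q \<in> Z" using chain by blast
      then show "B p \<inter> B q = {}" using \<open>p \<noteq> q\<close> sub unfolding \<Omega>_def by blast
    next
      fix p assume "p \<in> P" "\<exists>q\<in>\<Union>C. B p \<inter> B q \<noteq> {}"
      then obtain X q where X: "X \<in> C" "q \<in> X" "B p \<inter> B q \<noteq> {}" by blast
      then have "X \<in> \<Omega>" using sub by blast
      then have "\<exists>q\<in>X. B p \<inter> B q \<noteq> {} \<and> snd p \<le> 2 * snd q"
        using X \<open>p \<in> P\<close> unfolding \<Omega>_def by blast
      then show "\<exists>q\<in>\<Union>C. B p \<inter> B q \<noteq> {} \<and> snd p \<le> 2 * snd q" using X by blast
    qed
    then show "\<exists>U\<in>\<Omega>. \<forall>X\<in>C. X \<subseteq> U" by blast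
  qed
  then obtain Q where Q: "Q \<in> \<Omega>" and max: "\<And>X. X \<in> \<Omega> \<Longrightarrow> Q \<subseteq> X \<Longrightarrow> X = Q" by blast
  have meets: "\<exists>q\<in>Q. B p \<inter> B q \<noteq> {}" if "p \<in> P" for p
  proof (rule ccontr)
    assume "\<not> (\<exists>q\<in>Q. B p \<inter> B q \<noteq> {})"
    define W where "W = {p\<in>P. \<forall>q\<in>Q. B p \<inter> B q = {}}"
    have "p \<in> W" using that \<open>\<not> _\<close> by (auto simp: W_def)
    define s where "s = (SUP p\<in>W. snd p)"
    have bdd: "bdd_above (snd ` W)"
      by (rule bdd_aboveI[of _ R]) (use rad in \<open>auto simp: W_def\<close>)
    have le_s: "snd w \<le> s" if "w \<in> W" for w unfolding s_def using bdd that by (intro cSUP_upper)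
    have "0 < snd p" using rad[of "fst p" "snd p"] \<open>p \<in> P\<close> by simp
    then have "0 < s" using le_s[OF \<open>p \<in> W\<close>] by simp
    have "\<exists>w\<in>W. s / 2 < snd w"
    proof (rule ccontr)
      assume "\<not> ?thesis"
      then have "s \<le> s / 2"
        unfolding s_def using \<open>p \<in> W\<close> by (intro cSUP_least) (auto simp: not_less)
      then show False using \<open>0 < s\<close> by simp
    qed
    then obtain w where w: "w \<in> W" "s / 2 < snd w" by blast
    have big: "snd q \<le> 2 * snd w" if "q \<in> W" for q using le_s[OF that] w(2) by simp
    have Q_sub: "Q \<subseteq> P" and Q_disj: "\<forall>p\<in>Q. \<forall>q\<in>Q. p \<noteq> q \<longrightarrow> B p \<inter> B q = {}"
      and Q_meet: "\<forall>p\<in>P. (\<exists>q\<in>Q. B p \<inter> B q \<noteq> {}) \<longrightarrow> (\<exists>q\<in>Q. B p \<inter> B q \<noteq> {} \<and> snd p \<le> 2 * snd q)"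
      using Q unfolding \<Omega>_def by simp_all
    have w_P: "w \<in> P" and w_disj: "\<forall>q\<in>Q. B w \<inter> B q = {}" using w(1) unfolding W_def by simp_all
    have "insert w Q \<in> \<Omega>" unfolding \<Omega>_def mem_Collect_eq
    proof (intro conjI ballI impI)
      show "insert w Q \<subseteq> P" using Q_sub w_P by simp
    next
      fix p q assume "p \<in> insert w Q" "q \<in> insert w Q" "p \<noteq> q"
      then show "B p \<inter> B q = {}" using Q_disj w_disj by (metis Int_commute insertE)
    next
      fix p assume p: "p \<in> P" "\<exists>q\<in>insert w Q. B p \<inter> B q \<noteq> {}"
      show "\<exists>q\<in>insert w Q. B p \<inter> B q \<noteq> {} \<and> snd p \<le> 2 * snd q"
      proof (cases "\<exists>q\<in>Q. B p \<inter> B q \<noteq> {}")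
        case True
        then have "\<exists>q\<in>Q. B p \<inter> B q \<noteq> {} \<and> snd p \<le> 2 * snd q"
          using Q_meet p(1) by blast
        then show ?thesis by blast
      next
        case False
        then have "p \<in> W" "B p \<inter> B w \<noteq> {}" using p by (auto simp: W_def)
        then show ?thesis using big[of p] by blast
      qed
    qed
    then have "w \<in> Q" using max[of "insert w Q"] by blast
    moreover have "fst w \<in> B w" by (rule centre[OF w_P])
    ultimately show False using w_disj by blast
  qed
  show ?thesis
  proof (intro exI[of _ Q] conjI ballI impI)
    show "Q \<subseteq> P" using Q unfolding \<Omega>_def by simp
    show "B p \<inter> B q = {}" if "p \<in> Q" "q \<in> Q" "p \<noteq> q" for p q
      using that Q unfolding \<Omega>_def by simp
    show "\<exists>q\<in>Q. B p \<inter> B q \<noteq> {} \<and> snd p \<le> 2 * snd q" if "p \<in> P" for p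
      using that Q meets[OF that] unfolding \<Omega>_def by simp
  qed
qed

text \<open>The only features of a homogeneous distance that matter for differentiation.\<close>

locale diameter_metric =
  fixes d :: "'a::euclidean_space \<Rightarrow> 'a \<Rightarrow> real" and \<kappa> :: real
  assumes met: "Metric_space UNIV d"
    and open_iff: "open U \<longleftrightarrow> (\<forall>x\<in>U. \<exists>r>0. \<forall>y. d x y < r \<longrightarrow> y \<in> U)"
    and diam_ball: "0 < r \<Longrightarrow> dist_diameter d (Metric_space.mcball UNIV d x r) = \<kappa> * r"
    and \<kappa>_pos: "0 < \<kappa>"
begin

sublocale Metric_space UNIV d by (rule met)

lemma open_contains:
  assumes "open U" "x \<in> U"
  obtains r where "0 < r" "\<And>y. d x y < r \<Longrightarrow> y \<in> U"
  using open_iff[THEN iffD1, OF assms(1), THEN bspec, OF assms(2)] by (elim exE conjE) (rule that, auto)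

lemma open_mball: "open (mball x r)"
  unfolding open_iff
proof
  fix y assume "y \<in> mball x r"
  then have "0 < r - d x y" by simp
  moreover have "z \<in> mball x r" if "d y z < r - d x y" for z
    using triangle[of x y z] that by simp
  ultimately show "\<exists>e>0. \<forall>z. d y z < e \<longrightarrow> z \<in> mball x r" by blast
qed

lemma closed_mcball: "closed (mcball x r)"
  unfolding closed_def open_iff
proof
  fix y assume "y \<in> - mcball x r"
  then have "0 < d x y - r" by simp
  moreover have "z \<in> - mcball x r" if "d y z < d x y - r" for z
    using triangle[of x z y] that by (simp add: commute)
  ultimately show "\<exists>e>0. \<forall>z. d y z < e \<longrightarrow> z \<in> - mcball x r" by blast
qed

lemma closed_ball_borel: "C \<in> closed_balls d \<Longrightarrow> C \<in> sets borel"
  using closed_mcball by (auto simp: closed_balls_def)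

text \<open>\<open>measure_of\<close> yields the zero measure when the given set function is not a
  measure, so this is what gives \<open>spherical_borel\<close> its intended values. Closed sets
  satisfy Caratheodory's criterion, and they generate the Borel sets.\<close>

lemma measure_space_spherical: "measure_space UNIV (sets borel) (spherical_measure d N)"
proof -
  let ?\<mu> = "spherical_measure d N"
  have oms: "outer_measure_space (Pow UNIV) ?\<mu>"
    unfolding spherical_measure_def by (rule outer_measure_space_caratheodory)
  have sep: "?\<mu> A + ?\<mu> A' \<le> ?\<mu> (A \<union> A')"
    if e: "0 < e" and AA: "\<And>x y. x \<in> A \<Longrightarrow> y \<in> A' \<Longrightarrow> e \<le> d x y" for A A' e
    unfolding spherical_measure_def
  proof (rule caratheodory_construction_separated)
    \<comment> \<open>A ball of diameter at most \<kappa> e / 3 has radius at most e / 3, so any two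
      of its points are closer than \<open>e\<close>.\<close>
    show "0 < \<kappa> * e / 3" using e \<kappa>_pos by simp
    fix C assume C: "C \<in> closed_balls d" "dist_diameter d C \<le> \<kappa> * e / 3"
    then obtain x r where x: "C = mcball x r" "0 < r" by (auto simp: closed_balls_def)
    then have "r \<le> e / 3" using C(2) \<kappa>_pos by (simp add: diam_ball)
    show "C \<inter> A = {} \<or> C \<inter> A' = {}"
    proof (rule ccontr)
      assume "\<not> ?thesis"
      then obtain a a' where a: "a \<in> A" "a' \<in> A'" "d x a \<le> r" "d x a' \<le> r" using x by auto
      then have "e \<le> d a x + d x a'" using AA[OF a(1,2)] triangle[of a x a'] by simp
      then show False using a \<open>r \<le> e / 3\<close> e by (simp add: commute)
    qed
  qed
  let ?L = "lambda_system UNIV (Pow UNIV) ?\<mu>"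
  interpret P: sigma_algebra UNIV "Pow UNIV :: 'a set set" by (rule sigma_algebra_Pow)
  have ms: "measure_space UNIV ?L ?\<mu>" by (rule P.caratheodory_lemma[OF oms])
  have closed_L: "K \<in> ?L" if "closed K" for K
  proof -
    have far: "\<exists>r>0. \<forall>y\<in>K. r \<le> d x y" if "x \<notin> K" for x
    proof -
      have "open (- K)" using \<open>closed K\<close> by (simp add: open_Compl)
      moreover have "x \<in> - K" using that by simp
      ultimately obtain r where r: "0 < r" "\<And>y. d x y < r \<Longrightarrow> y \<in> - K" by (rule open_contains) auto
      have "r \<le> d x y" if "y \<in> K" for y
        using r(2)[of y] that by (cases "d x y < r") auto
      then show ?thesis using r(1) by blast
    qed
    have "?\<mu> (X \<inter> K) + ?\<mu> (X - K) = ?\<mu> X" for X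
    proof (rule antisym)
      show "?\<mu> (X \<inter> K) + ?\<mu> (X - K) \<le> ?\<mu> X"
      proof (rule caratheodory_criterion[OF oms met])
        show "?\<mu> A + ?\<mu> A' \<le> ?\<mu> (A \<union> A')" if "0 < e" "\<And>x y. x \<in> A \<Longrightarrow> y \<in> A' \<Longrightarrow> e \<le> d x y" for A A' e
          using that by (rule sep)
        show "\<exists>r>0. \<forall>y\<in>K. r \<le> d x y" if "x \<notin> K" for x using that by (rule far)
      qed
      have "?\<mu> X = ?\<mu> (X \<inter> K \<union> (X - K))" by (simp only: Int_Diff_Un)
      also have "\<dots> \<le> ?\<mu> (X \<inter> K) + ?\<mu> (X - K)"
        unfolding spherical_measure_def by (rule caratheodory_construction_Un_le)
      finally show "?\<mu> X \<le> ?\<mu> (X \<inter> K) + ?\<mu> (X - K)" .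
    qed
    then show ?thesis unfolding P.lambda_system_eq by simp
  qed
  have "sigma_algebra UNIV ?L" using ms by (simp add: measure_space_def)
  then have "sigma_sets UNIV (Collect closed) \<subseteq> ?L"
    by (rule sigma_algebra.sigma_sets_subset) (use closed_L in auto)
  then have "sets borel \<subseteq> ?L" by (simp add: borel_eq_closed)
  then show ?thesis
    by (rule measure_down[OF ms, rotated]) (metis sets.sigma_algebra_axioms space_borel)
qed

lemma sets_spherical_borel [simp]: "sets (spherical_borel d N) = sets borel"
  using sets.sigma_sets_eq[of "borel :: 'a measure"] by (simp add: spherical_borel_def)

lemma emeasure_spherical_borel:
  "A \<in> sets borel \<Longrightarrow> emeasure (spherical_borel d N) A = spherical_measure d N A"
  unfolding spherical_borel_def
  by (rule emeasure_measure_of_sigma)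
    (use measure_space_spherical[of N] sets.sigma_algebra_axioms[of "borel :: 'a measure"] in
      \<open>auto simp: measure_space_def\<close>)

section \<open>Ball densities and their measurability\<close>

definition ball_gauge :: "nat \<Rightarrow> 'a set \<Rightarrow> real" where
  "ball_gauge N C = (dist_diameter d C / 2) ^ N"

lemma ball_gauge_mcball: "0 < r \<Longrightarrow> ball_gauge N (mcball x r) = (\<kappa> * r / 2) ^ N"
  by (simp add: ball_gauge_def diam_ball)

lemma ball_gauge_pos: "C \<in> closed_balls d \<Longrightarrow> 0 < ball_gauge N C"
  using \<kappa>_pos by (auto simp: closed_balls_def ball_gauge_mcball)

definition ball_density :: "nat \<Rightarrow> 'a measure \<Rightarrow> real \<Rightarrow> 'a \<Rightarrow> ennreal" where
  "ball_density N \<nu> \<epsilon> x = (SUP C\<in>{C \<in> closed_balls d. x \<in> C \<and> dist_diameter d C < \<epsilon>}.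
          emeasure \<nu> C / ennreal (ball_gauge N C))"

lemma federer_density_eq: "federer_density d N \<nu> x = (INF \<epsilon>\<in>{0<..}. ball_density N \<nu> \<epsilon> x)"
  by (simp add: federer_density_def ball_density_def ball_gauge_def)

lemma ball_density_mono: "\<epsilon> \<le> \<epsilon>' \<Longrightarrow> ball_density N \<nu> \<epsilon> x \<le> ball_density N \<nu> \<epsilon>' x"
  unfolding ball_density_def by (rule SUP_subset_mono) auto

lemma less_divide_ennreal:
  fixes a t :: ennreal
  assumes "0 < b"
  shows "t < a / ennreal b \<longleftrightarrow> t * ennreal b < a"
proof -
  have "a / ennreal b \<le> t \<longleftrightarrow> a \<le> t * ennreal b"
  proof
    assume "a / ennreal b \<le> t"
    then have "a / ennreal b * ennreal b \<le> t * ennreal b" by (rule mult_right_mono) simp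
    moreover have "a / ennreal b * ennreal b = a"
      by (rule ennreal_divide_times_cancel[OF assms])
    ultimately show "a \<le> t * ennreal b" by simp
  next
    assume "a \<le> t * ennreal b"
    then show "a / ennreal b \<le> t"
      using assms by (intro divide_le_posI_ennreal) (auto simp: mult.commute)
  qed
  then show ?thesis by (metis not_le)
qed

lemma ball_density_less_iff:
  "t < ball_density N \<nu> \<epsilon> x \<longleftrightarrow>
    (\<exists>y r. 0 < r \<and> d y x \<le> r \<and> \<kappa> * r < \<epsilon> \<and> t * ennreal ((\<kappa> * r / 2) ^ N) < emeasure \<nu> (mcball y r))"
proof -
  have "t < ball_density N \<nu> \<epsilon> x \<longleftrightarrow> (\<exists>y r. 0 < r \<and> x \<in> mcball y r \<and> dist_diameter d (mcball y r) < \<epsilon> \<and>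
      t < emeasure \<nu> (mcball y r) / ennreal (ball_gauge N (mcball y r)))"
    by (simp only: ball_density_def less_SUP_iff closed_balls_def Bex_def mem_Collect_eq) blast
  also have "\<dots> \<longleftrightarrow> (\<exists>y r. 0 < r \<and> d y x \<le> r \<and> \<kappa> * r < \<epsilon> \<and> t * ennreal ((\<kappa> * r / 2) ^ N) < emeasure \<nu> (mcball y r))"
    using \<kappa>_pos by (intro ex_cong1) (auto simp: diam_ball ball_gauge_mcball less_divide_ennreal)
  finally show ?thesis .
qed

text \<open>The density is the limit of lower semicontinuous functions: a ball with large density ratio
  may be replaced by a slightly larger concentric one, which is a neighbourhood of \<open>x\<close>.\<close>

lemma open_ball_density:
  assumes \<nu>: "sets \<nu> = sets borel"
  shows "open {x. t < ball_density N \<nu> \<epsilon> x}"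
  unfolding open_iff
proof
  fix x assume "x \<in> {x. t < ball_density N \<nu> \<epsilon> x}"
  then obtain y r where r: "0 < r" "d y x \<le> r" "\<kappa> * r < \<epsilon>"
    and t: "t * ennreal ((\<kappa> * r / 2) ^ N) < emeasure \<nu> (mcball y r)"
    by (auto simp: ball_density_less_iff)
  have "((\<lambda>s. t * ennreal ((\<kappa> * s / 2) ^ N)) \<longlongrightarrow> t * ennreal ((\<kappa> * r / 2) ^ N)) (at_right r)"
  proof (rule tendsto_mult_ennreal)
    show "((\<lambda>s. ennreal ((\<kappa> * s / 2) ^ N)) \<longlongrightarrow> ennreal ((\<kappa> * r / 2) ^ N)) (at_right r)"
      by (intro tendsto_intros) simp
  qed (use r \<kappa>_pos in auto)
  then have "\<forall>\<^sub>F s in at_right r. t * ennreal ((\<kappa> * s / 2) ^ N) < emeasure \<nu> (mcball y r)"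
    using t by (rule order_tendstoD)
  moreover have "((\<lambda>s. \<kappa> * s) \<longlongrightarrow> \<kappa> * r) (at_right r)" by (intro tendsto_intros)
  then have "\<forall>\<^sub>F s in at_right r. \<kappa> * s < \<epsilon>" using r(3) by (rule order_tendstoD)
  moreover have "\<forall>\<^sub>F s in at_right r. r < s" by (simp add: eventually_at_right_less)
  ultimately have "\<forall>\<^sub>F s in at_right r. t * ennreal ((\<kappa> * s / 2) ^ N) < emeasure \<nu> (mcball y r) \<and> \<kappa> * s < \<epsilon> \<and> r < s"
    by (intro eventually_conj)
  then obtain s where s: "t * ennreal ((\<kappa> * s / 2) ^ N) < emeasure \<nu> (mcball y r)" "\<kappa> * s < \<epsilon>" "r < s"
    using eventually_happens'[of "at_right r"] by (metis (mono_tags, lifting) trivial_limit_at_right_real)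
  have "emeasure \<nu> (mcball y r) \<le> emeasure \<nu> (mcball y s)"
    using s(3) \<nu> closed_mcball by (intro emeasure_mono) auto
  then have "t * ennreal ((\<kappa> * s / 2) ^ N) < emeasure \<nu> (mcball y s)" using s(1) by (rule less_le_trans[rotated])
  moreover have "d y z \<le> s" if "d x z < s - r" for z
    using triangle[of y x z] that r(2) by simp
  ultimately have "z \<in> {x. t < ball_density N \<nu> \<epsilon> x}" if "d x z < s - r" for z
    using that s r(1) unfolding mem_Collect_eq ball_density_less_iff by (meson less_trans)
  then show "\<exists>r>0. \<forall>z. d x z < r \<longrightarrow> z \<in> {x. t < ball_density N \<nu> \<epsilon> x}" using s(3)
    by (intro exI[of _ "s - r"]) auto
qed

lemma ball_density_measurable:
  assumes "sets \<nu> = sets borel"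
  shows "ball_density N \<nu> \<epsilon> \<in> borel_measurable borel"
  by (rule borel_measurableI_greater) (use open_ball_density[OF assms] in auto)

text \<open>The suprema are monotone in the scale, so countably many scales suffice; measurability
  of the density is inherited from the fixed scales.\<close>

lemma federer_density_eq_seq:
  "federer_density d N \<nu> x = (INF k. ball_density N \<nu> (1 / real (Suc k)) x)"
proof (rule antisym)
  show "federer_density d N \<nu> x \<le> (INF k. ball_density N \<nu> (1 / real (Suc k)) x)"
    unfolding federer_density_eq by (intro INF_greatest INF_lower) simp
  show "(INF k. ball_density N \<nu> (1 / real (Suc k)) x) \<le> federer_density d N \<nu> x"
    unfolding federer_density_eq
  proof (rule INF_greatest)
    fix \<epsilon> :: real assume "\<epsilon> \<in> {0<..}"
    then obtain k where "1 / real (Suc k) < \<epsilon>" using nat_approx_posE[of \<epsilon>] by auto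
    then have "ball_density N \<nu> (1 / real (Suc k)) x \<le> ball_density N \<nu> \<epsilon> x"
      by (intro ball_density_mono) simp
    then show "(INF k. ball_density N \<nu> (1 / real (Suc k)) x) \<le> ball_density N \<nu> \<epsilon> x"
      by (rule INF_lower2[rotated]) simp
  qed
qed

lemma federer_density_measurable:
  assumes "sets \<nu> = sets borel"
  shows "federer_density d N \<nu> \<in> borel_measurable borel"
proof -
  have "(\<lambda>x. INF k. ball_density N \<nu> (1 / real (Suc k)) x) \<in> borel_measurable borel"
    by (intro borel_measurable_INF ball_density_measurable assms) simp
  then show ?thesis by (simp add: federer_density_eq_seq[abs_def])
qed

section \<open>Comparison of a Borel measure with the spherical measure\<close>

text \<open>At each point the bound holds for all balls below some scale; \<open>A\<close> is the
  increasing union of the sets \<open>A' k\<close> on which the scale 1/(k+1) works uniformly. There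
  every sufficiently fine ball \<open>C\<close> that meets \<open>A' k\<close> has measure at most
  \<open>t\<close> times its gauge, and summing over a cover gives the estimate.\<close>

lemma emeasure_le_of_density_less:
  assumes \<nu>: "sets \<nu> = sets borel" and A: "A \<in> sets borel" and t: "0 < t"
    and dens: "\<And>x. x \<in> A \<Longrightarrow> federer_density d N \<nu> x < ennreal t"
  shows "emeasure \<nu> A \<le> ennreal t * emeasure (spherical_borel d N) A"
proof -
  define A' where "A' k = {x\<in>A. ball_density N \<nu> (1 / real (Suc k)) x \<le> ennreal t}" for k
  have "A' k = A \<inter> {x \<in> space borel. ball_density N \<nu> (1 / real (Suc k)) x \<le> ennreal t}" for k
    by (auto simp: A'_def)
  then have A'_sets: "A' k \<in> sets borel" for k
    using sets.Int[OF A borel_measurable_le[OF ball_density_measurable[OF \<nu>] borel_measurable_const]]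
    by simp
  have "(\<Union>k. A' k) = A"
  proof
    show "A \<subseteq> (\<Union>k. A' k)"
    proof
      fix x assume "x \<in> A"
      then have "(INF k. ball_density N \<nu> (1 / real (Suc k)) x) < ennreal t"
        using dens federer_density_eq_seq by simp
      then obtain k where "ball_density N \<nu> (1 / real (Suc k)) x < ennreal t" by (auto simp: INF_less_iff)
      then show "x \<in> (\<Union>k. A' k)" using \<open>x \<in> A\<close> by (auto simp: A'_def intro!: exI[of _ k])
    qed
  qed (auto simp: A'_def)
  moreover have "incseq A'"
  proof (rule incseq_SucI)
    fix k
    have "ball_density N \<nu> (1 / real (Suc (Suc k))) x \<le> ball_density N \<nu> (1 / real (Suc k)) x" for x
      by (intro ball_density_mono divide_left_mono) auto
    then show "A' k \<subseteq> A' (Suc k)" unfolding A'_def by (blast intro: order_trans)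
  qed
  moreover have "range A' \<subseteq> sets \<nu>" using A'_sets \<nu> by blast
  ultimately have "emeasure \<nu> A = (SUP k. emeasure \<nu> (A' k))"
    using SUP_emeasure_incseq[of A' \<nu>] by simp
  also have "\<dots> \<le> ennreal t * spherical_measure d N A"
  proof (rule SUP_least)
    fix k
    \<comment> \<open>\<open>ball_density\<close> admits diameters strictly below its scale, while
      covers admit diameters up to theirs; hence the next scale.\<close>
    let ?\<delta> = "1 / real (Suc (Suc k))"
    have "emeasure \<nu> (A' k) / ennreal t \<le> cover_content (closed_balls d) (dist_diameter d) (\<lambda>C. (dist_diameter d C / 2) ^ N) ?\<delta> A"
    proof (rule cover_content_geI)
      fix \<C> assume \<C>: "countable \<C>" "\<C> \<subseteq> closed_balls d" "A \<subseteq> \<Union>\<C>" "\<forall>C\<in>\<C>. dist_diameter d C \<le> ?\<delta>"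
      \<comment> \<open>The density controls only the balls that meet \<open>A' k\<close>; these
        still cover \<open>A' k\<close>, and dropping the others lowers the sum.\<close>
      define \<D> where "\<D> = {C\<in>\<C>. C \<inter> A' k \<noteq> {}}"
      have "\<D> \<subseteq> \<C>" by (auto simp: \<D>_def)
      have le: "emeasure \<nu> C \<le> ennreal t * ennreal (ball_gauge N C)" if C_in: "C \<in> \<D>" for C
      proof (rule ccontr)
        assume "\<not> ?thesis"
        then have large: "ennreal t * ennreal (ball_gauge N C) < emeasure \<nu> C" by (simp add: not_le)
        obtain x where x: "x \<in> C" "x \<in> A' k" using C_in by (auto simp: \<D>_def)
        have C: "C \<in> closed_balls d" "dist_diameter d C \<le> ?\<delta>" using C_in \<C> by (auto simp: \<D>_def)
        have "?\<delta> < 1 / real (Suc k)" by (rule divide_strict_left_mono) auto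
        then have "emeasure \<nu> C / ennreal (ball_gauge N C) \<le> ball_density N \<nu> (1 / real (Suc k)) x"
          unfolding ball_density_def using C x by (intro SUP_upper) simp
        also have "\<dots> \<le> ennreal t" using x by (simp add: A'_def)
        finally have "emeasure \<nu> C / ennreal (ball_gauge N C) \<le> ennreal t" .
        moreover have "ennreal t < emeasure \<nu> C / ennreal (ball_gauge N C)"
          using large less_divide_ennreal[OF ball_gauge_pos[OF C(1)]] by simp
        ultimately show False by simp
      qed
      have "emeasure \<nu> (A' k) \<le> (\<Sum>\<^sub>\<infinity>C\<in>\<D>. emeasure \<nu> C)"
      proof (rule emeasure_le_infsum)
        show "countable \<D>" using \<C>(1) \<open>\<D> \<subseteq> \<C>\<close> by (rule countable_subset[rotated])
        show "\<D> \<subseteq> sets \<nu>" using \<C>(2) \<open>\<D> \<subseteq> \<C>\<close> closed_ball_borel \<nu> by auto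
        show "A' k \<subseteq> \<Union>\<D>" using \<C>(3) by (auto simp: \<D>_def A'_def)
      qed
      also have "\<dots> \<le> (\<Sum>\<^sub>\<infinity>C\<in>\<D>. ennreal t * ennreal (ball_gauge N C))"
        by (intro infsum_mono nonneg_summable_on_complete le) auto
      also have "\<dots> = ennreal t * (\<Sum>\<^sub>\<infinity>C\<in>\<D>. ennreal (ball_gauge N C))"
        by (rule infsum_ennreal_cmult)
      also have "\<dots> \<le> ennreal t * (\<Sum>\<^sub>\<infinity>C\<in>\<C>. ennreal (ball_gauge N C))"
        by (intro mult_left_mono infsum_ennreal_mono_set \<open>\<D> \<subseteq> \<C>\<close>) simp
      finally show "emeasure \<nu> (A' k) / ennreal t \<le> (\<Sum>\<^sub>\<infinity>C\<in>\<C>. ennreal ((dist_diameter d C / 2) ^ N))"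
        using t by (intro divide_le_posI_ennreal) (auto simp: ball_gauge_def)
    qed
    also have "\<dots> \<le> spherical_measure d N A"
      unfolding spherical_measure_def by (rule cover_content_le_caratheodory) simp
    finally have "emeasure \<nu> (A' k) / ennreal t * ennreal t \<le> spherical_measure d N A * ennreal t"
      by (rule mult_right_mono) simp
    then show "emeasure \<nu> (A' k) \<le> ennreal t * spherical_measure d N A"
      unfolding ennreal_divide_times_cancel[OF t] by (simp add: mult.commute)
  qed
  finally show ?thesis by (simp add: emeasure_spherical_borel[OF A])
qed

text \<open>The disjoint balls selected by Vitali's lemma have total gauge at most
  \<open>\<nu>(V) / t\<close>. The finitely many balls in \<open>Q0\<close>, together with the
  fivefold enlargements of all the others, still cover \<open>A\<close>, and the enlargements
  contribute at most \<open>e\<close>.\<close>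

lemma spherical_le_of_density_greater:
  assumes \<nu>: "sets \<nu> = sets borel" and V: "open V" "A \<subseteq> V"
    and dens: "\<And>x. x \<in> A \<Longrightarrow> ennreal t < federer_density d N \<nu> x"
  shows "ennreal t * spherical_measure d N A \<le> emeasure \<nu> V"
proof (cases "t \<le> 0 \<or> emeasure \<nu> V = \<infinity>")
  case True then show ?thesis by (auto simp: ennreal_neg)
next
  case False
  then have t: "0 < t" and fin: "emeasure \<nu> V < \<infinity>" by (auto simp: less_top)
  have "cover_content (closed_balls d) (dist_diameter d) (\<lambda>C. (dist_diameter d C / 2) ^ N) \<delta> A
      \<le> emeasure \<nu> V / ennreal t" (is "?c \<le> _") if \<delta>: "0 < \<delta>" for \<delta>
  proof (rule ennreal_le_epsilon)
    fix e :: real assume e: "0 < e"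
    define B where "B p = mcball (fst p) (snd p)" for p :: "'a \<times> real"
    define B5 where "B5 p = mcball (fst p) (5 * snd p)" for p :: "'a \<times> real"
    define g where "g p = ennreal (ball_gauge N (B p))" for p :: "'a \<times> real"
    \<comment> \<open>The factor 5 in the size condition keeps the enlarged balls below the scale
      \<delta> as well.\<close>
    define P where "P = {p. 0 < snd p \<and> 5 * \<kappa> * snd p \<le> \<delta> \<and> B p \<subseteq> V \<and> ennreal t * g p < emeasure \<nu> (B p)}"
    have rad: "0 < r \<and> r \<le> \<delta> / (5 * \<kappa>)" if "(x, r) \<in> P" for x r
      using that \<kappa>_pos by (auto simp: P_def field_simps)
    have "\<exists>Q\<subseteq>P. (\<forall>p\<in>Q. \<forall>q\<in>Q. p \<noteq> q \<longrightarrow> B p \<inter> B q = {}) \<and>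
        (\<forall>p\<in>P. \<exists>q\<in>Q. B p \<inter> B q \<noteq> {} \<and> snd p \<le> 2 * snd q)"
      unfolding B_def by (rule vitali_covering_pairs[OF met]) (rule rad)
    then obtain Q where Q: "Q \<subseteq> P" and disj': "\<forall>p\<in>Q. \<forall>q\<in>Q. p \<noteq> q \<longrightarrow> B p \<inter> B q = {}"
      and meets': "\<forall>p\<in>P. \<exists>q\<in>Q. B p \<inter> B q \<noteq> {} \<and> snd p \<le> 2 * snd q" by (elim exE conjE) (rule that)
    have disj: "B p \<inter> B q = {}" if "p \<in> Q" "q \<in> Q" "p \<noteq> q" for p q using disj' that by simp
    have meets: "\<exists>q\<in>Q. B p \<inter> B q \<noteq> {} \<and> snd p \<le> 2 * snd q" if "p \<in> P" for p
      by (rule bspec[OF meets' that])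
    have pos: "0 < snd p" if "p \<in> Q" for p using that Q by (auto simp: P_def)
    have centre: "fst p \<in> mball (fst p) (snd p)" if "p \<in> Q" for p using pos[OF that] by simp
    have "inj_on B Q"
    proof (rule inj_onI, rule ccontr)
      fix p q assume "p \<in> Q" "q \<in> Q" "B p = B q" "p \<noteq> q"
      then have "B p = {}" using disj by blast
      moreover have "fst p \<in> B p" using pos[OF \<open>p \<in> Q\<close>] by (simp add: B_def)
      ultimately show False by blast
    qed
    have disj_balls: "disjoint (B ` Q)"
      unfolding disjoint_def using disj by blast
    \<comment> \<open>Disjoint sets with nonempty Euclidean interior form a countable
      family.\<close>
    have "countable (B ` Q)"
    proof (rule countable_disjoint_nonempty_interior_subsets)
      show "pairwise disjnt (B ` Q)"
        using disj_balls by (auto simp del: disjoint_iff simp: pairwise_def disjnt_def disjoint_def)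
      fix C assume "C \<in> B ` Q" "interior C = {}"
      then obtain p where p: "p \<in> Q" "C = B p" by blast
      have "mball (fst p) (snd p) \<subseteq> interior C"
        unfolding p(2) B_def by (rule interior_maximal[OF _ open_mball]) auto
      then show "C = {}" using \<open>interior C = {}\<close> centre[OF p(1)] by blast
    qed
    then have count_Q: "countable Q" using \<open>inj_on B Q\<close> by (rule countable_image_inj_on)
    have "ennreal t * infsum g Q = infsum (\<lambda>p. ennreal t * g p) Q"
      by (rule infsum_ennreal_cmult[symmetric])
    also have "\<dots> \<le> infsum (emeasure \<nu> \<circ> B) Q"
      by (intro infsum_mono nonneg_summable_on_complete) (use Q in \<open>auto simp: P_def intro: less_imp_le\<close>)
    also have "\<dots> = infsum (emeasure \<nu>) (B ` Q)"
      by (rule infsum_reindex[OF \<open>inj_on B Q\<close>, symmetric])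
    also have "\<dots> \<le> emeasure \<nu> V"
    proof (rule infsum_disjoint_le_emeasure[OF disj_balls])
      show "B ` Q \<subseteq> sets \<nu>" unfolding \<nu> B_def using closed_mcball by auto
      show "\<Union>(B ` Q) \<subseteq> V" using Q by (auto simp: P_def)
      show "V \<in> sets \<nu>" unfolding \<nu> using V by simp
    qed
    finally have sum_Q: "ennreal t * infsum g Q \<le> emeasure \<nu> V" .
    then have sum_Q': "infsum g Q \<le> emeasure \<nu> V / ennreal t"
    proof -
      have "infsum g Q = (ennreal t * infsum g Q) / ennreal t"
        using t by (simp add: mult.commute[of "ennreal t"] mult_divide_eq_ennreal)
      also have "\<dots> \<le> emeasure \<nu> V / ennreal t" by (rule divide_right_mono_ennreal[OF sum_Q])
      finally show ?thesis .
    qed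
    have "emeasure \<nu> V / ennreal t < \<infinity>"
      using fin t by (simp add: less_top[symmetric] ennreal_divide_eq_top_iff)
    then have "infsum g Q < \<infinity>" using sum_Q' by (rule le_less_trans[rotated])
    \<comment> \<open>A fivefold radius multiplies the gauge by \<open>5 ^ N\<close>, hence this
      bound for the tail.\<close>
    moreover have "0 < ennreal (e / 5 ^ N)" using e by simp
    ultimately obtain Q0 where Q0: "finite Q0" "Q0 \<subseteq> Q" "infsum g (Q - Q0) \<le> ennreal (e / 5 ^ N)"
      by (rule infsum_ennreal_tail)
    let ?\<C> = "B ` Q0 \<union> B5 ` (Q - Q0)"
    have "?c \<le> (\<Sum>\<^sub>\<infinity>C\<in>?\<C>. ennreal ((dist_diameter d C / 2) ^ N))"
    proof (rule cover_content_leI)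
      show "countable ?\<C>" using count_Q Q0(1) by (simp add: countable_finite)
      show "?\<C> \<subseteq> closed_balls d"
      proof
        fix C assume "C \<in> ?\<C>"
        then obtain p where p: "p \<in> Q" "C = B p \<or> C = B5 p" using Q0(2) by blast
        have "B p \<in> closed_balls d" unfolding closed_balls_def B_def mem_Collect_eq
          using pos[OF p(1)] by (intro exI[of _ "fst p"] exI[of _ "snd p"]) simp
        moreover have "B5 p \<in> closed_balls d" unfolding closed_balls_def B5_def mem_Collect_eq
          using pos[OF p(1)] by (intro exI[of _ "fst p"] exI[of _ "5 * snd p"]) simp
        ultimately show "C \<in> closed_balls d" using p(2) by (elim disjE) simp_all
      qed
      show "dist_diameter d C \<le> \<delta>" if C: "C \<in> ?\<C>" for C
      proof -
        obtain p where p: "p \<in> Q" "C = B p \<or> C = B5 p" using Q0(2) C by blast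
        have "5 * \<kappa> * snd p \<le> \<delta>" using p(1) Q by (auto simp: P_def)
        moreover have "0 < \<kappa> * snd p" using pos[OF p(1)] \<kappa>_pos by simp
        ultimately show ?thesis using p(2) pos[OF p(1)]
          by (auto simp: B_def B5_def diam_ball algebra_simps)
      qed
      show "A \<subseteq> \<Union>?\<C>"
      proof
        fix x assume x: "x \<in> A"
        show "x \<in> \<Union>?\<C>"
        proof (cases "x \<in> \<Union>(B ` Q0)")
          case True then show ?thesis by blast
        next
          case False
          \<comment> \<open>The union of the finitely many balls in \<open>Q0\<close> is closed. So
            a small ball containing \<open>x\<close> avoids it, and the selected ball that it meets
            must lie outside \<open>Q0\<close>.\<close>
          have "open (V - \<Union>(B ` Q0))"
            using V(1) Q0(1) closed_mcball by (intro open_Diff closed_Union) (auto simp: B_def)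
          moreover have "x \<in> V - \<Union>(B ` Q0)" using False x V by blast
          ultimately obtain \<rho> where \<rho>: "0 < \<rho>" "\<And>y. d x y < \<rho> \<Longrightarrow> y \<in> V - \<Union>(B ` Q0)"
            by (rule open_contains) auto
          \<comment> \<open>The first bound makes the radius less than \<rho>/2, so that a ball
            containing \<open>x\<close> stays within distance \<rho> of \<open>x\<close>; the second
            one puts the ball into \<open>P\<close>.\<close>
          define \<epsilon> where "\<epsilon> = min (\<kappa> * \<rho> / 2) (\<delta> / 5)"
          have "0 < \<epsilon>" using \<rho>(1) \<delta> \<kappa>_pos by (simp add: \<epsilon>_def)
          then have "federer_density d N \<nu> x \<le> ball_density N \<nu> \<epsilon> x"
            unfolding federer_density_eq by (intro INF_lower) simp
          then have "ennreal t < ball_density N \<nu> \<epsilon> x" using dens[OF x] by (rule less_le_trans[rotated])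
          then obtain y r where r: "0 < r" "d y x \<le> r" "\<kappa> * r < \<epsilon>"
            and dr: "ennreal t * ennreal ((\<kappa> * r / 2) ^ N) < emeasure \<nu> (mcball y r)"
            unfolding ball_density_less_iff by blast
          have "\<kappa> * r < \<kappa> * (\<rho> / 2)" using r(3) by (simp add: \<epsilon>_def)
          then have r\<rho>: "2 * r < \<rho>" using \<kappa>_pos by simp
          have sub: "z \<in> V - \<Union>(B ` Q0)" if "d y z \<le> r" for z
            using triangle[of x y z] that r(2) r\<rho> by (intro \<rho>(2)) (simp add: commute)
          have "(y, r) \<in> P" unfolding P_def mem_Collect_eq
          proof (intro conjI)
            show "0 < snd (y, r)" using r by simp
            show "5 * \<kappa> * snd (y, r) \<le> \<delta>" using r(3) by (simp add: \<epsilon>_def)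
            show "B (y, r) \<subseteq> V" using sub by (auto simp: B_def)
            show "ennreal t * g (y, r) < emeasure \<nu> (B (y, r))"
              using dr r(1) by (simp add: B_def g_def ball_gauge_mcball)
          qed
          then obtain q where q: "q \<in> Q" "B (y, r) \<inter> B q \<noteq> {}" "r \<le> 2 * snd q" using meets by force
          then obtain z where z: "d y z \<le> r" "d (fst q) z \<le> snd q" by (auto simp: B_def)
          have "q \<notin> Q0" using sub[OF z(1)] z(2) by (auto simp: B_def)
          \<comment> \<open>With \<open>z\<close> in both balls, \<open>x\<close> is within
            \<open>snd q + 2 * r\<close> of the centre of \<open>q\<close>, and
            \<open>r \<le> 2 * snd q\<close>; this is the origin of the factor 5.\<close>
          have "d (fst q) x \<le> d (fst q) z + d z x" by (rule triangle) auto
          also have "d z x \<le> d z y + d y x" by (rule triangle) auto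
          finally have "x \<in> B5 q" using z r q(3) by (simp add: B5_def commute)
          then show ?thesis using q(1) \<open>q \<notin> Q0\<close> by blast
        qed
      qed
    qed
    also have "\<dots> \<le> (\<Sum>\<^sub>\<infinity>C\<in>B ` Q0. ennreal ((dist_diameter d C / 2) ^ N))
        + (\<Sum>\<^sub>\<infinity>C\<in>B5 ` (Q - Q0). ennreal ((dist_diameter d C / 2) ^ N))"
      by (rule infsum_ennreal_Un_le)
    also have "\<dots> \<le> emeasure \<nu> V / ennreal t + ennreal e"
    proof (rule add_mono)
      have "(\<Sum>\<^sub>\<infinity>C\<in>B ` Q0. ennreal ((dist_diameter d C / 2) ^ N)) \<le> infsum g Q0"
        using infsum_ennreal_image_le[of "\<lambda>C. ennreal ((dist_diameter d C / 2) ^ N)" B Q0]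
        by (simp add: g_def[abs_def] ball_gauge_def o_def)
      also have "\<dots> \<le> infsum g Q" by (rule infsum_ennreal_mono_set[OF Q0(2)])
      finally show "(\<Sum>\<^sub>\<infinity>C\<in>B ` Q0. ennreal ((dist_diameter d C / 2) ^ N)) \<le> emeasure \<nu> V / ennreal t"
        using sum_Q' by (rule order_trans)
      have g5: "ennreal ((dist_diameter d (B5 p) / 2) ^ N) = ennreal (5 ^ N) * g p" if "p \<in> Q" for p
      proof -
        have "dist_diameter d (B5 p) / 2 = 5 * (\<kappa> * snd p / 2)"
          using pos[OF that] by (simp add: B5_def diam_ball)
        then have "(dist_diameter d (B5 p) / 2) ^ N = 5 ^ N * ball_gauge N (B p)"
          using pos[OF that] by (simp only: B_def ball_gauge_mcball power_mult_distrib)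
        moreover have "0 \<le> ball_gauge N (B p)"
          using pos[OF that] \<kappa>_pos by (simp add: B_def ball_gauge_mcball)
        ultimately show ?thesis unfolding g_def by (simp only: ennreal_mult zero_le_power zero_le_numeral)
      qed
      have "(\<Sum>\<^sub>\<infinity>C\<in>B5 ` (Q - Q0). ennreal ((dist_diameter d C / 2) ^ N))
          \<le> (\<Sum>\<^sub>\<infinity>p\<in>Q - Q0. ennreal ((dist_diameter d (B5 p) / 2) ^ N))"
        using infsum_ennreal_image_le[of "\<lambda>C. ennreal ((dist_diameter d C / 2) ^ N)" B5 "Q - Q0"]
        by (simp add: o_def)
      also have "\<dots> = (\<Sum>\<^sub>\<infinity>p\<in>Q - Q0. ennreal (5 ^ N) * g p)"
        by (rule infsum_cong) (use g5 in auto)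
      also have "\<dots> = ennreal (5 ^ N) * infsum g (Q - Q0)" by (rule infsum_ennreal_cmult)
      also have "\<dots> \<le> ennreal (5 ^ N) * ennreal (e / 5 ^ N)" by (rule mult_left_mono[OF Q0(3)]) simp
      also have "\<dots> = ennreal e" using e by (subst ennreal_mult[symmetric]) auto
      finally show "(\<Sum>\<^sub>\<infinity>C\<in>B5 ` (Q - Q0). ennreal ((dist_diameter d C / 2) ^ N)) \<le> ennreal e" .
    qed
    finally show "?c \<le> emeasure \<nu> V / ennreal t + ennreal e" .
  qed
  then have "spherical_measure d N A \<le> emeasure \<nu> V / ennreal t"
    unfolding spherical_measure_def caratheodory_construction_eq by (intro SUP_least) simp
  then have "spherical_measure d N A * ennreal t \<le> emeasure \<nu> V / ennreal t * ennreal t"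
    by (rule mult_right_mono) simp
  then show ?thesis unfolding ennreal_divide_times_cancel[OF t] by (simp add: mult.commute)
qed

text \<open>Outer regularity replaces the open neighbourhood by \<open>A\<close> itself. It is
  available for finite measures, hence the restriction of \<open>\<nu>\<close> to
  \<open>V\<close>.\<close>

lemma spherical_borel_le_of_density_greater:
  assumes \<nu>: "sets \<nu> = sets borel" and V: "open V" "A \<subseteq> V" "emeasure \<nu> V < \<infinity>" and A: "A \<in> sets borel"
    and dens: "\<And>x. x \<in> A \<Longrightarrow> ennreal t < federer_density d N \<nu> x"
  shows "ennreal t * emeasure (spherical_borel d N) A \<le> emeasure \<nu> A"
proof -
  let ?M = "density \<nu> (indicator V)"
  have V': "V \<in> sets \<nu>" using V \<nu> by simp
  have M: "emeasure ?M X = emeasure \<nu> (V \<inter> X)" if "X \<in> sets borel" for X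
  proof -
    have "X \<in> sets \<nu>" using that \<nu> by simp
    then have "emeasure ?M X = (\<integral>\<^sup>+x. indicator V x * indicator X x \<partial>\<nu>)"
      using V' by (intro emeasure_density) auto
    also have "\<dots> = (\<integral>\<^sup>+x. indicator (V \<inter> X) x \<partial>\<nu>)"
      by (intro nn_integral_cong) (auto simp: indicator_def)
    finally show ?thesis using V' \<open>X \<in> sets \<nu>\<close> by (simp add: nn_integral_indicator sets.Int)
  qed
  have "emeasure \<nu> A = emeasure ?M A" using M[OF A] V(2) by (simp add: Int_absorb1)
  also have "\<dots> = (INF U \<in> {U. A \<subseteq> U \<and> open U}. emeasure ?M U)"
  proof (rule outer_regular)
    show "sets ?M = sets borel" using \<nu> by simp
    have "space ?M = UNIV" using sets_eq_imp_space_eq[OF \<nu>] by simp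
    then show "emeasure ?M (space ?M) \<noteq> \<infinity>" using M[of UNIV] V(3) by simp
  qed fact
  also have "\<dots> \<ge> ennreal t * emeasure (spherical_borel d N) A"
  proof (rule INF_greatest)
    fix U assume "U \<in> {U. A \<subseteq> U \<and> open U}"
    then have U: "open U" "A \<subseteq> U" by auto
    have "ennreal t * emeasure (spherical_borel d N) A \<le> emeasure \<nu> (V \<inter> U)"
      unfolding emeasure_spherical_borel[OF A]
      using U V \<nu> dens by (intro spherical_le_of_density_greater) auto
    also have "\<dots> = emeasure ?M U" using M[of U] U by simp
    finally show "ennreal t * emeasure (spherical_borel d N) A \<le> emeasure ?M U" .
  qed
  finally show ?thesis .
qed

end

section \<open>From the comparison inequalities to the integral of the density\<close>

lemma ennreal_le_of_scaling:
  fixes x y :: ennreal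
  assumes "\<And>s. 1 < s \<Longrightarrow> x \<le> ennreal s * y"
  shows "x \<le> y"
proof (rule LIMSEQ_le_const)
  have "(\<lambda>n. ennreal (1 + 1 / real (Suc n)) * y) \<longlonglongrightarrow> ennreal (1 + 0) * y"
  proof (rule tendsto_mult_ennreal)
    show "(\<lambda>n. ennreal (1 + 1 / real (Suc n))) \<longlonglongrightarrow> ennreal (1 + 0)"
      by (intro tendsto_ennrealI tendsto_add tendsto_const LIMSEQ_Suc[OF lim_1_over_n])
  qed auto
  then show "(\<lambda>n. ennreal (1 + 1 / real (Suc n)) * y) \<longlonglongrightarrow> y" by simp
  show "\<exists>N. \<forall>n\<ge>N. x \<le> ennreal (1 + 1 / real (Suc n)) * y"
    by (intro exI[of _ 0] allI impI assms) simp
qed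

context diameter_metric begin

text \<open>On the level set \<open>X k\<close> the density lies in [s^k, s^(k+1)), so
  \<open>\<nu>\<close> and the measure \<open>L\<close> with density \<theta> agree there up to
  powers of \<open>s\<close>. Summing over the integers \<open>k\<close> and letting
  \<open>s\<close> tend to 1 gives equality.\<close>

lemma emeasure_eq_integral_density_finite:
  assumes \<nu>: "sets \<nu> = sets borel" and V: "open V" "A \<subseteq> V" "emeasure \<nu> V < \<infinity>" and A: "A \<in> sets borel"
    and dens: "\<And>x. x \<in> A \<Longrightarrow> 0 < federer_density d N \<nu> x \<and> federer_density d N \<nu> x < \<infinity>"
  shows "emeasure \<nu> A = (\<integral>\<^sup>+x\<in>A. federer_density d N \<nu> x \<partial>spherical_borel d N)"
proof -
  let ?\<theta> = "federer_density d N \<nu>" and ?S = "spherical_borel d N"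
  define L where "L = density ?S ?\<theta>"
  have \<theta>_meas: "?\<theta> \<in> borel_measurable borel" by (rule federer_density_measurable[OF \<nu>])
  then have \<theta>_meas': "?\<theta> \<in> borel_measurable ?S"
    using measurable_cong_sets[OF sets_spherical_borel refl] by blast
  have L_sets: "sets L = sets borel" by (simp add: L_def)
  have L_eq: "emeasure L X = (\<integral>\<^sup>+x\<in>X. ?\<theta> x \<partial>?S)" if "X \<in> sets borel" for X
    unfolding L_def using that by (intro emeasure_density \<theta>_meas') simp
  have bounds: "emeasure \<nu> A \<le> ennreal s * emeasure L A \<and> emeasure L A \<le> ennreal (s * s) * emeasure \<nu> A"
    if s: "1 < s" for s :: real
  proof -
    define X where "X k = {x\<in>A. \<lfloor>log s (enn2real (?\<theta> x))\<rfloor> = k}" for k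
    have X_iff: "x \<in> X k \<longleftrightarrow> x \<in> A \<and> ennreal (s powr real_of_int k) \<le> ?\<theta> x \<and> ?\<theta> x < ennreal (s powr real_of_int (k + 1))" for x k
    proof (cases "x \<in> A")
      case True
      obtain \<tau> where \<tau>: "?\<theta> x = ennreal \<tau>" "0 < \<tau>"
        using dens[OF True] by (cases "?\<theta> x") (auto simp: ennreal_less_zero_iff)
      then show ?thesis
        using True s floor_log_eq_powr_iff[of \<tau> s k] by (simp add: X_def ennreal_less_iff)
    qed (simp add: X_def)
    have X_sets: "X k \<in> sets borel" for k
    proof -
      have "X k = A \<inter> ({x\<in>space borel. ennreal (s powr real_of_int k) \<le> ?\<theta> x} \<inter> {x\<in>space borel. ?\<theta> x < ennreal (s powr real_of_int (k + 1))})"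
        by (auto simp: X_iff)
      also have "\<dots> \<in> sets borel"
        by (intro sets.Int A borel_measurable_le borel_measurable_less borel_measurable_const \<theta>_meas)
      finally show ?thesis .
    qed
    have X_disj: "disjoint_family_on X UNIV" by (auto simp: disjoint_family_on_def X_def)
    have X_UN: "(\<Union>k. X k) = A" by (auto simp: X_def)
    \<comment> \<open>The level sets are indexed by integers, so the countable sum is written as an
      integral over \<open>count_space\<close>.\<close>
    have X_sum: "emeasure M A = (\<integral>\<^sup>+k. emeasure M (X k) \<partial>count_space UNIV)" if "sets M = sets borel" for M
      unfolding X_UN[symmetric] using that X_sets X_disj by (intro emeasure_UN_countable) auto
    have S_le: "ennreal (s powr real_of_int k) * emeasure ?S (X k) \<le> emeasure L (X k)" for k
    proof -
      have "ennreal (s powr real_of_int k) * emeasure ?S (X k)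
          = (\<integral>\<^sup>+x. ennreal (s powr real_of_int k) * indicator (X k) x \<partial>?S)"
        using X_sets by (simp add: nn_integral_cmult_indicator)
      also have "\<dots> \<le> (\<integral>\<^sup>+x\<in>X k. ?\<theta> x \<partial>?S)"
        by (intro nn_integral_mono) (auto simp: X_iff indicator_def)
      finally show ?thesis by (simp add: L_eq[OF X_sets])
    qed
    have le_S: "emeasure L (X k) \<le> ennreal (s powr real_of_int (k + 1)) * emeasure ?S (X k)" for k
    proof -
      have "(\<integral>\<^sup>+x\<in>X k. ?\<theta> x \<partial>?S) \<le> (\<integral>\<^sup>+x. ennreal (s powr real_of_int (k + 1)) * indicator (X k) x \<partial>?S)"
        by (intro nn_integral_mono) (auto simp: X_iff indicator_def intro: less_imp_le)
      also have "\<dots> = ennreal (s powr real_of_int (k + 1)) * emeasure ?S (X k)"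
        using X_sets by (simp add: nn_integral_cmult_indicator)
      finally show ?thesis by (simp add: L_eq[OF X_sets])
    qed
    have lower: "emeasure \<nu> (X k) \<le> ennreal s * emeasure L (X k)" for k
    proof -
      have "emeasure \<nu> (X k) \<le> ennreal (s powr real_of_int (k + 1)) * emeasure ?S (X k)"
        using s by (intro emeasure_le_of_density_less[OF \<nu> X_sets]) (auto simp: X_iff)
      also have "ennreal (s powr real_of_int (k + 1)) = ennreal s * ennreal (s powr real_of_int k)"
        using s by (simp add: powr_add ennreal_mult[symmetric] mult.commute)
      finally show ?thesis using S_le[of k] by (metis mult.assoc mult_left_mono order_trans zero_le)
    qed
    have upper: "emeasure L (X k) \<le> ennreal (s * s) * emeasure \<nu> (X k)" for k
    proof -
      \<comment> \<open>The comparison requires a strict lower bound for the density, whereas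
        \<open>X k\<close> provides only s^k \<le> \<theta>. Stepping down to s^(k-1) makes it
        strict, at the price of a second factor \<open>s\<close>.\<close>
      have "ennreal (s powr real_of_int (k - 1)) * emeasure ?S (X k) \<le> emeasure \<nu> (X k)"
      proof (rule spherical_borel_le_of_density_greater[OF \<nu> V(1) _ V(3) X_sets])
        show "X k \<subseteq> V" using V(2) by (auto simp: X_iff)
        fix x assume "x \<in> X k"
        have "s powr real_of_int (k - 1) < s powr real_of_int k" using s by simp
        then have "ennreal (s powr real_of_int (k - 1)) < ennreal (s powr real_of_int k)"
          by (rule ennreal_lessI[rotated]) (use s in simp)
        then show "ennreal (s powr real_of_int (k - 1)) < ?\<theta> x"
          using \<open>x \<in> X k\<close> by (auto simp: X_iff)
      qed
      then have "ennreal (s * s) * (ennreal (s powr real_of_int (k - 1)) * emeasure ?S (X k)) \<le> ennreal (s * s) * emeasure \<nu> (X k)"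
        by (rule mult_left_mono) simp
      moreover have "ennreal (s powr real_of_int (k + 1)) = ennreal (s * s) * ennreal (s powr real_of_int (k - 1))"
        using s by (simp add: powr_add powr_diff ennreal_mult[symmetric] field_simps)
      ultimately show ?thesis using le_S[of k] by (simp add: mult.assoc)
    qed
    show ?thesis
    proof
      have "emeasure \<nu> A \<le> (\<integral>\<^sup>+k. ennreal s * emeasure L (X k) \<partial>count_space UNIV)"
        unfolding X_sum[OF \<nu>] by (intro nn_integral_mono lower)
      also have "\<dots> = ennreal s * emeasure L A"
        unfolding X_sum[OF L_sets] by (rule nn_integral_cmult) simp
      finally show "emeasure \<nu> A \<le> ennreal s * emeasure L A" .
      have "emeasure L A \<le> (\<integral>\<^sup>+k. ennreal (s * s) * emeasure \<nu> (X k) \<partial>count_space UNIV)"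
        unfolding X_sum[OF L_sets] by (intro nn_integral_mono upper)
      also have "\<dots> = ennreal (s * s) * emeasure \<nu> A"
        unfolding X_sum[OF \<nu>] by (rule nn_integral_cmult) simp
      finally show "emeasure L A \<le> ennreal (s * s) * emeasure \<nu> A" .
    qed
  qed
  have "emeasure \<nu> A = emeasure L A"
  proof (rule antisym)
    show "emeasure \<nu> A \<le> emeasure L A" by (rule ennreal_le_of_scaling[OF conjunct1[OF bounds]])
    show "emeasure L A \<le> emeasure \<nu> A"
    proof (rule ennreal_le_of_scaling)
      fix s :: real assume "1 < s"
      \<comment> \<open>The upper bound carries the square of its ratio, so it is applied to the
        square root of \<open>s\<close>.\<close>
      then have "1 < sqrt s" and eq: "sqrt s * sqrt s = s" by simp_all
      from conjunct2[OF bounds[OF this(1)]] show "emeasure L A \<le> ennreal s * emeasure \<nu> A"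
        by (simp only: eq)
    qed
  qed
  then show ?thesis using L_eq[OF A] by simp
qed

text \<open>Finiteness of the density at a point forces \<open>\<nu>\<close> to be finite on some
  ball about it. By Lindelof countably many open sets of finite measure cover \<open>A\<close>, and
  \<open>A\<close> is cut along them into disjoint pieces.\<close>

lemma emeasure_eq_integral_density:
  assumes \<nu>: "sets \<nu> = sets borel" and A: "A \<in> sets borel"
    and dens: "\<And>x. x \<in> A \<Longrightarrow> 0 < federer_density d N \<nu> x \<and> federer_density d N \<nu> x < \<infinity>"
  shows "emeasure \<nu> A = (\<integral>\<^sup>+x\<in>A. federer_density d N \<nu> x \<partial>spherical_borel d N)"
proof -
  let ?\<theta> = "federer_density d N \<nu>" and ?S = "spherical_borel d N"
  define L where "L = density ?S ?\<theta>"
  have "?\<theta> \<in> borel_measurable ?S"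
    using federer_density_measurable[OF \<nu>] measurable_cong_sets[OF sets_spherical_borel refl] by blast
  then have L_eq: "emeasure L X = (\<integral>\<^sup>+x\<in>X. ?\<theta> x \<partial>?S)" if "X \<in> sets borel" for X
    unfolding L_def using that by (intro emeasure_density) simp_all
  have L_sets: "sets L = sets borel" by (simp add: L_def)
  define \<O> where "\<O> = {U. open U \<and> emeasure \<nu> U < \<infinity>}"
  have cover: "\<exists>U\<in>\<O>. x \<in> U" if x_in: "x \<in> A" for x
  proof -
    obtain \<epsilon> where \<epsilon>: "0 < \<epsilon>" "ball_density N \<nu> \<epsilon> x < \<infinity>"
      using dens[OF x_in] unfolding federer_density_eq by (auto simp: INF_less_iff)
    define r where "r = \<epsilon> / (2 * \<kappa>)"
    have r: "0 < r" "\<kappa> * r < \<epsilon>" using \<epsilon>(1) \<kappa>_pos by (auto simp: r_def)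
    have "\<not> ball_density N \<nu> \<epsilon> x < ball_density N \<nu> \<epsilon> x" by simp
    \<comment> \<open>If the ball had infinite measure, its ratio would exceed every finite value;
      taking the density itself as the threshold makes it greater than itself.\<close>
    have "emeasure \<nu> (mcball x r) < \<infinity>"
    proof (rule ccontr)
      assume "\<not> ?thesis"
      moreover have "ball_density N \<nu> \<epsilon> x * ennreal ((\<kappa> * r / 2) ^ N) < \<infinity>"
        using \<epsilon>(2) by (simp add: ennreal_mult_eq_top_iff less_top[symmetric])
      ultimately have "ball_density N \<nu> \<epsilon> x * ennreal ((\<kappa> * r / 2) ^ N) < emeasure \<nu> (mcball x r)"
        by (simp add: not_less top_unique)
      then have "ball_density N \<nu> \<epsilon> x < ball_density N \<nu> \<epsilon> x"
        unfolding ball_density_less_iff[of "ball_density N \<nu> \<epsilon> x"] using r by (intro exI[of _ x] exI[of _ r]) simp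
      then show False by simp
    qed
    moreover have "emeasure \<nu> (mball x r) \<le> emeasure \<nu> (mcball x r)"
      using \<nu> closed_mcball by (intro emeasure_mono) auto
    ultimately have "mball x r \<in> \<O>" unfolding \<O>_def using open_mball by (auto intro: le_less_trans)
    then show ?thesis using r(1) by (intro bexI[of _ "mball x r"]) auto
  qed
  obtain \<U> where \<U>: "\<U> \<subseteq> \<O>" "countable \<U>" "\<Union>\<U> = \<Union>\<O>"
    by (rule Lindelof[of \<O>]) (simp add: \<O>_def)
  \<comment> \<open>The empty set is added so that the family is nonempty and can be
    enumerated.\<close>
  define U where "U = from_nat_into (insert {} \<U>)"
  have U: "range U = insert {} \<U>"
    unfolding U_def using \<U>(2) by (intro range_from_nat_into) simp_all
  have U_O: "open (U i)" "emeasure \<nu> (U i) < \<infinity>" for i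
  proof -
    have "U i \<in> insert {} \<O>" using U \<U>(1) by blast
    then show "open (U i)" "emeasure \<nu> (U i) < \<infinity>" by (auto simp: \<O>_def)
  qed
  define X where "X i = A \<inter> disjointed U i" for i
  have X_sets: "X i \<in> sets borel" for i
  proof -
    have "range U \<subseteq> sets borel" using U_O by auto
    then have "range (disjointed U) \<subseteq> sets borel" by (rule sets.range_disjointed_sets)
    then show ?thesis unfolding X_def using A by auto
  qed
  have "(\<Union>i. X i) = A \<inter> (\<Union>i. disjointed U i)" unfolding X_def by (rule Int_UN_distrib[symmetric])
  also have "\<dots> = A \<inter> \<Union>\<U>" unfolding UN_disjointed_eq U by simp
  also have "\<dots> = A" unfolding \<U>(3) using cover by blast
  finally have X_UN: "(\<Union>i. X i) = A" .
  have X_disj: "disjoint_family X"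
    using disjoint_family_disjointed[of U] unfolding X_def disjoint_family_on_def by blast
  have X_eq: "emeasure \<nu> (X i) = emeasure L (X i)" for i
    unfolding L_eq[OF X_sets]
  proof (rule emeasure_eq_integral_density_finite[OF \<nu> _ _ _ X_sets])
    show "X i \<subseteq> U i" using disjointed_subset[of U i] by (auto simp: X_def)
  qed (use U_O dens in \<open>auto simp: X_def\<close>)
  have X_sum: "emeasure M A = (\<Sum>i. emeasure M (X i))" if "sets M = sets borel" for M
    unfolding X_UN[symmetric] using that X_sets X_disj by (intro suminf_emeasure[symmetric]) auto
  have "emeasure \<nu> A = emeasure L A" unfolding X_sum[OF \<nu>] X_sum[OF L_sets] X_eq ..
  then show ?thesis using L_eq[OF A] by simp
qed

end

section \<open>Hausdorff measure on subspaces\<close>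

no_notation Matrix.scalar_prod (infix \<open>\<bullet>\<close> 70)
hide_const (open) Matrix.orthogonal
hide_fact (open) Matrix.orthogonal_def

lemma hausdorff_measure_mono: "A \<subseteq> A' \<Longrightarrow> hausdorff_measure n A \<le> hausdorff_measure n A'"
  unfolding hausdorff_measure_def by (rule caratheodory_construction_mono)

lemma orthonormal_expansion:
  fixes Bs :: "'a::euclidean_space set"
  assumes "pairwise orthogonal Bs" "\<And>b. b \<in> Bs \<Longrightarrow> norm b = 1" "finite Bs" "x \<in> span Bs"
  shows "x = (\<Sum>b\<in>Bs. (x \<bullet> b) *\<^sub>R b)"
proof -
  define y where "y = x - (\<Sum>b\<in>Bs. (x \<bullet> b) *\<^sub>R b)"
  have "y \<bullet> b = 0" if "b \<in> Bs" for b
  proof -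
    have "(\<Sum>c\<in>Bs. (x \<bullet> c) *\<^sub>R c) \<bullet> b = (\<Sum>c\<in>Bs. if c = b then x \<bullet> b else 0)"
      unfolding inner_sum_left
    proof (rule sum.cong)
      fix c assume "c \<in> Bs"
      show "(x \<bullet> c) *\<^sub>R c \<bullet> b = (if c = b then x \<bullet> b else 0)"
      proof (cases "c = b")
        case True
        then show ?thesis using assms(2)[OF that] by (simp add: norm_eq_1)
      next
        case False
        then have "orthogonal c b" using assms(1) \<open>c \<in> Bs\<close> that by (auto simp: pairwise_def)
        then show ?thesis using False by (simp add: orthogonal_def)
      qed
    qed simp
    also have "\<dots> = x \<bullet> b" using that assms(3) by simp
    finally show ?thesis by (simp add: y_def inner_diff_left)
  qed
  moreover have "y \<in> span Bs" unfolding y_def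
    using assms(4) by (intro span_diff span_sum span_scale) (auto intro: span_base)
  ultimately have "orthogonal y y"
    by (intro orthogonal_to_span[of y Bs y]) (auto simp: orthogonal_def)
  then show ?thesis by (simp add: y_def orthogonal_def)
qed

text \<open>In orthonormal coordinates of \<open>V\<close> a cube of side 2R is cut into k^m cubes
  of side s = 2R/k. By the l1 bound each has diameter at most m s, so the total gauge is at most
  \<omega> k^m (m R / k)^n, where \<omega> is the volume of the unit ball; since m \<le> n this
  stays below the constant \<open>c\<close> for all \<open>k\<close>.\<close>

lemma hausdorff_measure_subspace_finite:
  fixes V :: "'a::euclidean_space set"
  assumes V: "subspace V" "dim V \<le> n" and K: "bounded K"
  shows "hausdorff_measure n (V \<inter> K) < \<infinity>"
proof -
  obtain Bs where Bs: "Bs \<subseteq> V" "pairwise orthogonal Bs" "\<And>b. b \<in> Bs \<Longrightarrow> norm b = 1"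
    "independent Bs" "card Bs = dim V" "span Bs = V"
    using orthonormal_basis_subspace[OF V(1)] by blast
  have fin: "finite Bs" using Bs(4) by (rule independent_imp_finite)
  define m where "m = card Bs"
  have "m \<le> n" using V(2) Bs(5) by (simp add: m_def)
  obtain R where R: "0 < R" "K \<subseteq> cball 0 R"
    using K unfolding bounded_pos by (auto simp: subset_iff)
  define c where "c = unit_ball_vol (real n) * (real m * R) ^ n"
  have "0 \<le> c" using R by (simp add: c_def)
  have "cover_content {C. bounded C} diameter (\<lambda>C. unit_ball_vol (real n) * (diameter C / 2) ^ n) \<delta> (V \<inter> K)
      \<le> ennreal c" (is "?cc \<le> _") if \<delta>: "0 < \<delta>" for \<delta>
  proof -
    obtain k0 where k0: "2 * R * real m / \<delta> < real k0" using reals_Archimedean2 by blast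
    define k where "k = Suc k0"
    have k: "0 < k" "2 * R * real m / \<delta> < real k" using k0 by (auto simp: k_def)
    define s where "s = 2 * R / real k"
    have s: "0 < s" "real m * s \<le> \<delta>" using R k \<delta> by (auto simp: s_def field_simps)
    define C where "C f = {x \<in> V. \<forall>b\<in>Bs. - R + s * real (f b) \<le> x \<bullet> b \<and> x \<bullet> b \<le> - R + s * (real (f b) + 1)}"
      for f :: "'a \<Rightarrow> nat"
    define I where "I = Bs \<rightarrow>\<^sub>E {..<k}"
    have finI: "finite I" unfolding I_def using fin by (intro finite_PiE) auto
    have cardI: "card I = k ^ m" unfolding I_def m_def using fin by (simp add: card_PiE)
    have close: "norm (x - y) \<le> real m * s" if "x \<in> C f" "y \<in> C f" for x y f
    proof -
      have xy: "x - y \<in> span Bs" using that V(1) Bs(6) by (auto simp: C_def subspace_diff)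
      have "norm (x - y) = norm (\<Sum>b\<in>Bs. ((x - y) \<bullet> b) *\<^sub>R b)"
        using orthonormal_expansion[OF Bs(2,3) fin xy] by simp
      also have "\<dots> \<le> (\<Sum>b\<in>Bs. norm (((x - y) \<bullet> b) *\<^sub>R b))" by (rule norm_sum)
      also have "\<dots> \<le> (\<Sum>b\<in>Bs. s)"
      proof (rule sum_mono)
        fix b assume b: "b \<in> Bs"
        have "\<bar>x \<bullet> b - y \<bullet> b\<bar> \<le> s" using that b by (auto simp: C_def algebra_simps abs_le_iff dest!: bspec[of _ _ b])
        then show "norm (((x - y) \<bullet> b) *\<^sub>R b) \<le> s" using Bs(3)[OF b] by (simp add: inner_diff_left)
      qed
      finally show ?thesis by (simp add: m_def)
    qed
    have diam: "diameter (C f) \<le> real m * s" for f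
      using close s by (intro diameter_le) auto
    have bnd: "bounded (C f)" for f
    proof (cases "C f = {}")
      case False
      then obtain x where "x \<in> C f" by blast
      then have "C f \<subseteq> cball x (real m * s)" using close[of x f] by (auto simp: dist_norm)
      then show ?thesis using bounded_subset bounded_cball by blast
    qed simp
    have "?cc \<le> (\<Sum>\<^sub>\<infinity>X\<in>C ` I. ennreal (unit_ball_vol (real n) * (diameter X / 2) ^ n))"
    proof (rule cover_content_leI)
      show "countable (C ` I)" using finI by (simp add: countable_finite)
      show "C ` I \<subseteq> {C. bounded C}" using bnd by auto
      show "diameter X \<le> \<delta>" if "X \<in> C ` I" for X using that diam s(2) order_trans by blast
      show "V \<inter> K \<subseteq> \<Union>(C ` I)"
      proof
        fix x assume x: "x \<in> V \<inter> K"
        \<comment> \<open>The truncation at \<open>k - 1\<close> assigns the right end of the range,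
          where the floor equals \<open>k\<close>, to the last cube.\<close>
        define f where "f = (\<lambda>b\<in>Bs. min (k - 1) (nat \<lfloor>(x \<bullet> b + R) / s\<rfloor>))"
        have "f \<in> I" using k by (auto simp: f_def I_def)
        moreover have "x \<in> C f" unfolding C_def mem_Collect_eq
        proof (intro conjI ballI)
          show "x \<in> V" using x by simp
          fix b assume b: "b \<in> Bs"
          have "norm x \<le> R" using x R by auto
          then have "\<bar>x \<bullet> b\<bar> \<le> R" using Cauchy_Schwarz_ineq2[of x b] Bs(3)[OF b] by simp
          then have xb: "0 \<le> x \<bullet> b + R" "x \<bullet> b + R \<le> 2 * R" by (auto simp: abs_le_iff)
          have "real k * s = 2 * R" using k(1) by (simp add: s_def)
          then have u: "0 \<le> (x \<bullet> b + R) / s" "(x \<bullet> b + R) / s \<le> real k"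
            using s(1) xb by (auto simp: pos_divide_le_eq)
          define u where "u = (x \<bullet> b + R) / s"
          have fb: "f b = min (k - 1) (nat \<lfloor>u\<rfloor>)" using b by (simp add: f_def u_def)
          have fl: "real (nat \<lfloor>u\<rfloor>) \<le> u" "u < real (nat \<lfloor>u\<rfloor>) + 1"
            using u(1) unfolding u_def[symmetric] by linarith+
          have "real (f b) \<le> u" using fl(1) fb by simp
          then have "s * real (f b) \<le> s * u" using s(1) by simp
          moreover have su: "s * u = x \<bullet> b + R" using s(1) by (simp add: u_def)
          ultimately show "- R + s * real (f b) \<le> x \<bullet> b" by simp
          have "u \<le> real (f b) + 1"
          proof (cases "nat \<lfloor>u\<rfloor> \<le> k - 1")
            case True then show ?thesis using fl fb by simp
          next
            case False
            then have "f b = k - 1" using fb by simp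
            then have "real (f b) + 1 = real k" using k(1) by simp
            then show ?thesis using u(2) by (simp add: u_def)
          qed
          then have "s * u \<le> s * (real (f b) + 1)" using s(1) by simp
          then show "x \<bullet> b \<le> - R + s * (real (f b) + 1)" using su by simp
        qed
        ultimately show "x \<in> \<Union>(C ` I)" by blast
      qed
    qed
    also have "\<dots> \<le> (\<Sum>\<^sub>\<infinity>f\<in>I. ennreal (unit_ball_vol (real n) * (diameter (C f) / 2) ^ n))"
      using infsum_ennreal_image_le[of "\<lambda>X. ennreal (unit_ball_vol (real n) * (diameter X / 2) ^ n)" C I]
      by (simp add: o_def)
    also have "\<dots> = (\<Sum>f\<in>I. ennreal (unit_ball_vol (real n) * (diameter (C f) / 2) ^ n))"
      by (rule infsum_finite[OF finI])
    also have "\<dots> \<le> (\<Sum>f\<in>I. ennreal (unit_ball_vol (real n) * (real m * s / 2) ^ n))"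
      using diam diameter_ge_0[OF bnd]
      by (intro sum_mono ennreal_leI mult_left_mono power_mono divide_right_mono) auto
    also have "\<dots> = ennreal (real (k ^ m) * (unit_ball_vol (real n) * (real m * s / 2) ^ n))"
      using s(1) by (simp add: cardI ennreal_mult ennreal_of_nat_eq_real_of_nat)
    also have "\<dots> \<le> ennreal c"
    proof (rule ennreal_leI)
      have "real k ^ m * (real m * s / 2) ^ n = real k ^ m * (real m * R) ^ n / real k ^ n"
        by (simp add: s_def power_divide)
      also have "\<dots> = (real m * R) ^ n * (real k ^ m / real k ^ n)" by simp
      also have "\<dots> \<le> (real m * R) ^ n * 1"
      proof (rule mult_left_mono)
        have "real k ^ m \<le> real k ^ n" using k(1) \<open>m \<le> n\<close> by (intro power_increasing) auto
        then show "real k ^ m / real k ^ n \<le> 1" using k(1) by simp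
      qed (use R in simp)
      finally have "real k ^ m * (real m * s / 2) ^ n \<le> (real m * R) ^ n" by simp
      then have "unit_ball_vol (real n) * (real k ^ m * (real m * s / 2) ^ n) \<le> c"
        unfolding c_def by (intro mult_left_mono) auto
      then show "real (k ^ m) * (unit_ball_vol (real n) * (real m * s / 2) ^ n) \<le> c"
        by (simp add: mult_ac)
    qed
    finally show ?thesis .
  qed
  then have "hausdorff_measure n (V \<inter> K) \<le> ennreal c"
    unfolding hausdorff_measure_def caratheodory_construction_eq by (intro SUP_least) simp
  then show ?thesis by (rule le_less_trans) simp
qed

text \<open>The box has side \<delta> in the directions of \<open>B0\<close> and side 1 in all
  others, so Lebesgue measure of the whole space measures its base.\<close>

lemma emeasure_lborel_partial_box:
  fixes B0 :: "'a::euclidean_space set" and p :: 'a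
  assumes B0: "B0 \<subseteq> Basis" and \<delta>: "0 \<le> \<delta>"
  defines "l \<equiv> \<Sum>b\<in>Basis. (if b \<in> B0 then p \<bullet> b else 0) *\<^sub>R b"
    and "u \<equiv> \<Sum>b\<in>Basis. (if b \<in> B0 then p \<bullet> b + \<delta> else 1) *\<^sub>R b"
  shows "emeasure lborel (cbox l u) = ennreal (\<delta> ^ card B0)"
    and "x \<in> cbox l u \<longleftrightarrow> (\<forall>b\<in>B0. p \<bullet> b \<le> x \<bullet> b \<and> x \<bullet> b \<le> p \<bullet> b + \<delta>) \<and>
      (\<forall>b\<in>Basis - B0. 0 \<le> x \<bullet> b \<and> x \<bullet> b \<le> 1)"
proof -
  have l: "l \<bullet> b = (if b \<in> B0 then p \<bullet> b else 0)" if "b \<in> Basis" for b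
    unfolding l_def using that by simp
  have u: "u \<bullet> b = (if b \<in> B0 then p \<bullet> b + \<delta> else 1)" if "b \<in> Basis" for b
    unfolding u_def using that by simp
  have "emeasure lborel (cbox l u) = ennreal (\<Prod>b\<in>Basis. (u - l) \<bullet> b)"
    using \<delta> l u by (intro emeasure_lborel_cbox) auto
  also have "(\<Prod>b\<in>Basis. (u - l) \<bullet> b) = (\<Prod>b\<in>Basis. if b \<in> B0 then \<delta> else 1)"
    by (rule prod.cong) (auto simp: inner_diff_left l u)
  also have "\<dots> = (\<Prod>b\<in>B0. \<delta>)"
    using B0 by (simp add: prod.If_cases Int_absorb1)
  finally show "emeasure lborel (cbox l u) = ennreal (\<delta> ^ card B0)" by simp
  show "x \<in> cbox l u \<longleftrightarrow> (\<forall>b\<in>B0. p \<bullet> b \<le> x \<bullet> b \<and> x \<bullet> b \<le> p \<bullet> b + \<delta>) \<and>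
      (\<forall>b\<in>Basis - B0. 0 \<le> x \<bullet> b \<and> x \<bullet> b \<le> 1)"
    unfolding mem_box using B0 by (auto simp: l u split: if_splits dest: subsetD)
qed

text \<open>Rotating \<open>V\<close> onto a coordinate subspace \<open>W\<close>, a covering of \<open>V \<inter> ball 0 r\<close> yields a covering of
  a box by cylinders over cubes in \<open>W\<close>, to which Lebesgue measure of the whole space applies.\<close>

lemma hausdorff_measure_subspace_pos:
  fixes V :: "'a::euclidean_space set"
  assumes V: "subspace V" "dim V = n" and r: "0 < r"
  shows "0 < hausdorff_measure n (V \<inter> ball 0 r)"
proof -
  have "n \<le> card (Basis :: 'a set)" using V(2) dim_subset_UNIV[of V] by simp
  then obtain B0 :: "'a set" where B0: "B0 \<subseteq> Basis" "card B0 = n" "finite B0"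
    using obtain_subset_with_card_n by metis
  have "independent B0" using independent_mono[OF independent_Basis B0(1)] .
  then have dimW: "dim (span B0) = n" using B0(2) by (simp add: dim_eq_card_independent)
  have dim_eq: "dim V = dim (span B0)" using V(2) dimW by simp
  obtain f g :: "'a \<Rightarrow> 'a" where fg: "linear f" "linear g" "f ` V = span B0" "g ` span B0 = V"
    "\<And>x. x \<in> V \<Longrightarrow> norm (f x) = norm x" "\<And>x. x \<in> span B0 \<Longrightarrow> norm (g x) = norm x"
    "\<And>x. x \<in> V \<Longrightarrow> g (f x) = x" "\<And>x. x \<in> span B0 \<Longrightarrow> f (g x) = x"
    by (rule isometries_subspaces[OF V(1) subspace_span[of B0] dim_eq]) (rule that)
  \<comment> \<open>By the l1 bound for the norm, the cube of side \<open>a\<close> in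
    \<open>span B0\<close> lies in the ball of radius \<open>r\<close>.\<close>
  define a where "a = r / (real DIM('a) + 1)"
  have a: "0 < a" "real DIM('a) * a < r" using r by (auto simp: a_def field_simps)
  define lo where "lo p = (\<Sum>b\<in>Basis. (if b \<in> B0 then p \<bullet> b else 0) *\<^sub>R b)" for p :: 'a
  define hi where "hi p \<delta> = (\<Sum>b\<in>Basis. (if b \<in> B0 then p \<bullet> b + \<delta> else 1) *\<^sub>R b)" for p :: 'a and \<delta> :: real
  note box = emeasure_lborel_partial_box[OF B0(1), folded lo_def hi_def, unfolded B0(2)]
  have coord: "(\<Sum>c\<in>B0. w c *\<^sub>R c) \<bullet> b = (if b \<in> B0 then w b else 0)" if b: "b \<in> Basis" for w b
  proof -
    have "(\<Sum>c\<in>B0. w c *\<^sub>R c) \<bullet> b = (\<Sum>c\<in>B0. if c = b then w b else 0)"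
      unfolding inner_sum_left
    proof (rule sum.cong)
      fix c assume "c \<in> B0"
      then have "c \<in> Basis" using B0(1) by blast
      then show "(w c *\<^sub>R c) \<bullet> b = (if c = b then w b else 0)" using inner_Basis[OF _ b] by simp
    qed simp
    then show ?thesis using B0(3) by simp
  qed
  define u where "u = (\<Sum>b\<in>B0. 1 *\<^sub>R b)"
  have ub: "u \<bullet> b = 1" if "b \<in> B0" for b
    unfolding u_def using coord[of b "\<lambda>_. 1"] B0(1) that by auto
  define \<omega> where "\<omega> = unit_ball_vol (real n)"
  have \<omega>: "0 < \<omega>" by (simp add: \<omega>_def)
  \<comment> \<open>A covering set of diameter D is charged with a cube of side 2D, and (2D)^n = 4^n
    (D/2)^n; this is the origin of \<open>4 ^ n\<close>. Any fixed scale serves, as the contents lie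
    below the measure.\<close>
  have "ennreal (\<omega> * a ^ n / 4 ^ n)
    \<le> cover_content {C. bounded C} diameter (\<lambda>C. \<omega> * (diameter C / 2) ^ n) 1 (V \<inter> ball 0 r)"
  proof (rule cover_content_geI)
    fix \<C> :: "'a set set"
    assume \<C>: "countable \<C>" "\<C> \<subseteq> {C. bounded C}" "V \<inter> ball 0 r \<subseteq> \<Union>\<C>"
    \<comment> \<open>A covering set that meets \<open>V\<close> has a reference point there, which
      the isometry can transport; the others do not help to cover.\<close>
    define \<D> where "\<D> = {C\<in>\<C>. C \<inter> V \<noteq> {}}"
    define c where "c C = (SOME x. x \<in> C \<inter> V)" for C
    have c: "c C \<in> C" "c C \<in> V" if "C \<in> \<D>" for C
      using someI_ex[of "\<lambda>x. x \<in> C \<inter> V"] that by (auto simp: \<D>_def c_def)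
    \<comment> \<open>All coordinates of \<open>u\<close> along \<open>B0\<close> are 1, so the base
      is the cube of half-side \<open>diameter C\<close> centred at the image of the reference
      point.\<close>
    define X where "X C = cbox (lo (f (c C) - diameter C *\<^sub>R u)) (hi (f (c C) - diameter C *\<^sub>R u) (2 * diameter C))" for C
    have nonneg: "0 \<le> diameter C" if "C \<in> \<C>" for C using \<C>(2) that by (auto intro: diameter_ge_0)
    have "ennreal (a ^ n) = emeasure lborel (cbox (lo 0) (hi 0 a))"
      using a by (intro box(1)[symmetric]) simp
    also have "\<dots> \<le> infsum (emeasure lborel) (X ` \<D>)"
    proof (rule emeasure_le_infsum)
      show "countable (X ` \<D>)" using \<C>(1) by (auto simp: \<D>_def)
      show "X ` \<D> \<subseteq> sets lborel" by (auto simp: X_def)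
      show "cbox (lo 0) (hi 0 a) \<subseteq> \<Union>(X ` \<D>)"
      proof
        fix x assume "x \<in> cbox (lo 0) (hi 0 a)"
        then have x: "\<And>b. b \<in> B0 \<Longrightarrow> 0 \<le> x \<bullet> b \<and> x \<bullet> b \<le> a" "\<And>b. b \<in> Basis - B0 \<Longrightarrow> 0 \<le> x \<bullet> b \<and> x \<bullet> b \<le> 1"
          using box(2)[of a x 0] a by auto
        define y where "y = (\<Sum>b\<in>B0. (x \<bullet> b) *\<^sub>R b)"
        have yW: "y \<in> span B0" unfolding y_def by (intro span_sum span_scale span_base)
        have yb: "y \<bullet> b = (if b \<in> B0 then x \<bullet> b else 0)" if "b \<in> Basis" for b
          unfolding y_def by (rule coord[OF that])
        have "norm y \<le> (\<Sum>b\<in>Basis. \<bar>y \<bullet> b\<bar>)" by (rule norm_le_l1)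
        also have "\<dots> \<le> (\<Sum>b\<in>(Basis :: 'a set). a)" using x(1) a yb by (intro sum_mono) auto
        also have "\<dots> < r" using a(2) by simp
        finally have "norm y < r" .
        then have gy: "g y \<in> V \<inter> ball 0 r" using fg(4,6) yW by auto
        then obtain C where C: "C \<in> \<C>" "g y \<in> C" using \<C>(3) by blast
        then have CD: "C \<in> \<D>" using gy by (auto simp: \<D>_def)
        have "y - f (c C) = f (g y - c C)" using fg(8)[OF yW] linear_diff[OF fg(1)] by simp
        then have "norm (y - f (c C)) = norm (g y - c C)"
          using fg(5)[OF subspace_diff[OF V(1), of "g y" "c C"]] gy c(2)[OF CD] by simp
        also have "\<dots> \<le> diameter C"
          using diameter_bounded_bound[of C "g y" "c C"] C \<C>(2) c(1)[OF CD] by (auto simp: dist_norm)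
        finally have nf: "norm (y - f (c C)) \<le> diameter C" .
        have le: "\<bar>(y - f (c C)) \<bullet> b\<bar> \<le> diameter C" if "b \<in> B0" for b
        proof -
          have "norm b = 1" using that B0(1) by auto
          then show ?thesis using Cauchy_Schwarz_ineq2[of "y - f (c C)" b] nf by simp
        qed
        have "x \<in> X C" unfolding X_def
        proof (subst box(2))
          show "0 \<le> 2 * diameter C" using nonneg[OF C(1)] by simp
          have "(f (c C) - diameter C *\<^sub>R u) \<bullet> b \<le> x \<bullet> b \<and> x \<bullet> b \<le> (f (c C) - diameter C *\<^sub>R u) \<bullet> b + 2 * diameter C"
            if "b \<in> B0" for b
            using le[OF that] yb[of b] that B0(1) ub[OF that] by (auto simp: inner_diff_left abs_le_iff)
          then show "(\<forall>b\<in>B0. (f (c C) - diameter C *\<^sub>R u) \<bullet> b \<le> x \<bullet> b \<and> x \<bullet> b \<le> (f (c C) - diameter C *\<^sub>R u) \<bullet> b + 2 * diameter C) \<and>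
            (\<forall>b\<in>Basis - B0. 0 \<le> x \<bullet> b \<and> x \<bullet> b \<le> 1)" using x(2) by blast
        qed
        then show "x \<in> \<Union>(X ` \<D>)" using CD by blast
      qed
    qed
    also have "\<dots> \<le> infsum (emeasure lborel \<circ> X) \<D>" by (rule infsum_ennreal_image_le)
    also have "\<dots> = (\<Sum>\<^sub>\<infinity>C\<in>\<D>. ennreal (4 ^ n / \<omega>) * ennreal (\<omega> * (diameter C / 2) ^ n))"
    proof (rule infsum_cong)
      fix C assume "C \<in> \<D>"
      then have nn: "0 \<le> diameter C" using nonneg by (auto simp: \<D>_def)
      have "(emeasure lborel \<circ> X) C = ennreal ((2 * diameter C) ^ n)"
        using nn by (simp add: X_def box(1))
      also have "(2 * diameter C) ^ n = 4 ^ n / \<omega> * (\<omega> * (diameter C / 2) ^ n)"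
      proof -
        have "(2 * diameter C) ^ n = (4 * (diameter C / 2)) ^ n" by simp
        also have "\<dots> = 4 ^ n * (diameter C / 2) ^ n" by (rule power_mult_distrib)
        finally show ?thesis using \<omega> by simp
      qed
      also have "ennreal \<dots> = ennreal (4 ^ n / \<omega>) * ennreal (\<omega> * (diameter C / 2) ^ n)"
        using \<omega> nn by (intro ennreal_mult) auto
      finally show "(emeasure lborel \<circ> X) C = ennreal (4 ^ n / \<omega>) * ennreal (\<omega> * (diameter C / 2) ^ n)" .
    qed
    also have "\<dots> = ennreal (4 ^ n / \<omega>) * (\<Sum>\<^sub>\<infinity>C\<in>\<D>. ennreal (\<omega> * (diameter C / 2) ^ n))"
      by (rule infsum_ennreal_cmult)
    also have "\<dots> \<le> ennreal (4 ^ n / \<omega>) * (\<Sum>\<^sub>\<infinity>C\<in>\<C>. ennreal (\<omega> * (diameter C / 2) ^ n))"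
      by (intro mult_left_mono infsum_ennreal_mono_set) (auto simp: \<D>_def)
    finally have "ennreal (\<omega> / 4 ^ n) * ennreal (a ^ n)
        \<le> ennreal (\<omega> / 4 ^ n) * (ennreal (4 ^ n / \<omega>) * (\<Sum>\<^sub>\<infinity>C\<in>\<C>. ennreal (\<omega> * (diameter C / 2) ^ n)))"
      by (rule mult_left_mono) simp
    also have "\<dots> = (ennreal (\<omega> / 4 ^ n) * ennreal (4 ^ n / \<omega>)) * (\<Sum>\<^sub>\<infinity>C\<in>\<C>. ennreal (\<omega> * (diameter C / 2) ^ n))"
      by (rule mult.assoc[symmetric])
    also have "ennreal (\<omega> / 4 ^ n) * ennreal (4 ^ n / \<omega>) = 1"
      using \<omega> by (subst ennreal_mult[symmetric]) auto
    also have "ennreal (\<omega> / 4 ^ n) * ennreal (a ^ n) = ennreal (\<omega> * a ^ n / 4 ^ n)"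
      using \<omega> a by (subst ennreal_mult[symmetric]) auto
    finally show "ennreal (\<omega> * a ^ n / 4 ^ n) \<le> (\<Sum>\<^sub>\<infinity>C\<in>\<C>. ennreal (\<omega> * (diameter C / 2) ^ n))" by simp
  qed
  also have "\<dots> \<le> hausdorff_measure n (V \<inter> ball 0 r)"
    unfolding hausdorff_measure_def \<omega>_def by (rule cover_content_le_caratheodory) simp
  finally show ?thesis using \<omega> a by (simp add: less_le_trans[rotated])
qed

section \<open>Homogeneous distances\<close>

text \<open>The entries are functions rather than vectors, so that a word of the
  Baker-Campbell-Hausdorff series becomes a list of the two coordinate projections.\<close>

lemma nested_bracket_differentiable:
  fixes br :: "'a::euclidean_space \<Rightarrow> 'a \<Rightarrow> 'a" and fs :: "('b::real_normed_vector \<Rightarrow> 'a) list"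
  assumes br: "bilinear br" and "\<And>f. f \<in> set fs \<Longrightarrow> f differentiable (at z)"
  shows "(\<lambda>z. nested_bracket br (map (\<lambda>f. f z) fs)) differentiable (at z)"
  using assms(2)
proof (induction fs)
  case (Cons f fs)
  show ?case
  proof (cases fs)
    case Nil then show ?thesis using Cons.prems[of f] by simp
  next
    case (Cons g gs)
    have "(\<lambda>z. nested_bracket br (map (\<lambda>f. f z) fs)) differentiable (at z)"
      using Cons.IH Cons.prems by simp
    moreover have "f differentiable (at z)" using Cons.prems by simp
    moreover have "bounded_bilinear br" using br by (simp add: bilinear_conv_bounded_bilinear)
    ultimately have "(\<lambda>z. br (f z) (nested_bracket br (map (\<lambda>f. f z) fs))) differentiable (at z)"
      unfolding differentiable_def using bounded_bilinear.FDERIV by blast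
    then show ?thesis using Cons by simp
  qed
qed simp

lemma bch_differentiable:
  fixes br :: "'a::euclidean_space \<Rightarrow> 'a \<Rightarrow> 'a"
  assumes "bilinear br"
  shows "(\<lambda>z. bch br m (fst z) (snd z)) differentiable (at z)"
proof -
  define P where "P = {ps :: (nat \<times> nat) list. (\<forall>(r, s)\<in>set ps. 0 < r + s) \<and> sum_list (map (\<lambda>(r, s). r + s) ps) \<in> {1..m}}"
  define c where "c ps = (-1) ^ (length ps - 1) /
        (real (length ps) * real (sum_list (map (\<lambda>(r, s). r + s) ps))
          * prod_list (map (\<lambda>(r, s). fact r * fact s) ps))" for ps :: "(nat \<times> nat) list"
  define w :: "(nat \<times> nat) list \<Rightarrow> ('a \<times> 'a \<Rightarrow> 'a) list"
    where "w ps = concat (map (\<lambda>(r, s). replicate r fst @ replicate s snd) ps)" for ps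
  have word: "concat (map (\<lambda>(r, s). replicate r (fst z) @ replicate s (snd z)) ps) = map (\<lambda>f. f z) (w ps)"
    for ps and z :: "'a \<times> 'a"
    by (induction ps) (auto simp: w_def)
  have eq: "bch br m (fst z) (snd z) = (\<Sum>ps\<in>P. c ps *\<^sub>R nested_bracket br (map (\<lambda>f. f z) (w ps)))" for z
    unfolding bch_def P_def c_def word ..
  have "(\<lambda>z. nested_bracket br (map (\<lambda>f. f z) (w ps))) differentiable (at z)" for ps
  proof (rule nested_bracket_differentiable[OF assms])
    fix f assume "f \<in> set (w ps)"
    then have "f = fst \<or> f = snd" by (auto simp: w_def)
    then show "f differentiable (at z)"
      by (auto intro!: bounded_linear_imp_differentiable bounded_linear_fst bounded_linear_snd)
  qed
  then have "\<forall>ps. \<exists>D. ((\<lambda>z. nested_bracket br (map (\<lambda>f. f z) (w ps))) has_derivative D) (at z)"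
    unfolding differentiable_def by (rule allI)
  from choice[OF this] obtain D
    where D: "\<forall>ps. ((\<lambda>z. nested_bracket br (map (\<lambda>f. f z) (w ps))) has_derivative D ps) (at z)" ..
  have "((\<lambda>z. \<Sum>ps\<in>P. c ps *\<^sub>R nested_bracket br (map (\<lambda>f. f z) (w ps)))
      has_derivative (\<lambda>h. \<Sum>ps\<in>P. c ps *\<^sub>R D ps h)) (at z)"
    by (intro has_derivative_sum has_derivative_scaleR_right D[rule_format])
  then show ?thesis unfolding eq differentiable_def by blast
qed

text \<open>Riesz representation of the coordinate functionals by means of \<open>adjoint\<close>:
  coordinates in a basis that is not orthonormal become inner products.\<close>

lemma dual_family:
  fixes B :: "'a::euclidean_space set"
  assumes "independent B"
  obtains w where "\<And>b c. b \<in> B \<Longrightarrow> c \<in> B \<Longrightarrow> b \<bullet> w c = (if b = c then 1 else 0)"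
proof -
  have "\<exists>v. \<forall>b\<in>B. b \<bullet> v = (if b = c then 1 else 0)" for c
  proof -
    obtain \<phi> :: "'a \<Rightarrow> real" where \<phi>: "linear \<phi>" "\<forall>b\<in>B. \<phi> b = (if b = c then 1 else 0)"
      using linear_independent_extend[OF assms, of "\<lambda>b. if b = c then 1 else 0"] by blast
    have "b \<bullet> adjoint \<phi> 1 = \<phi> b" for b using adjoint_works[OF \<phi>(1), of b 1] by simp
    then show ?thesis using \<phi>(2) by (intro exI[of _ "adjoint \<phi> 1"]) simp
  qed
  then obtain w where "\<And>c. \<forall>b\<in>B. b \<bullet> w c = (if b = c then 1 else 0)" by metis
  then show ?thesis by (intro that[of w]) blast
qed

lemma dual_expansion:
  fixes B :: "'a::euclidean_space set"
  assumes B: "independent B" "x \<in> span B"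
    and w: "\<And>b c. b \<in> B \<Longrightarrow> c \<in> B \<Longrightarrow> b \<bullet> w c = (if b = c then 1 else 0)"
  shows "x = (\<Sum>b\<in>B. (x \<bullet> w b) *\<^sub>R b)"
proof -
  have fin: "finite B" using B(1) by (rule independent_imp_finite)
  have lin: "linear (\<lambda>x. \<Sum>b\<in>B. (x \<bullet> w b) *\<^sub>R b)"
    by (intro linearI) (simp_all add: inner_add_left scaleR_add_left sum.distrib scaleR_sum_right)
  have "id x = (\<Sum>b\<in>B. (x \<bullet> w b) *\<^sub>R b)"
  proof (rule linear_eq_on_span[OF linear_id lin _ B(2)])
    fix b assume b: "b \<in> B"
    have "(\<Sum>c\<in>B. (b \<bullet> w c) *\<^sub>R c) = (\<Sum>c\<in>B. if b = c then b else 0)"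
      using w[OF b] by (intro sum.cong) auto
    then show "id b = (\<Sum>c\<in>B. (b \<bullet> w c) *\<^sub>R c)" using b fin by simp
  qed
  then show ?thesis by simp
qed

section \<open>Left translations and their differentials\<close>

context homogeneous_group begin

sublocale G: Groups.group mul 0 uminus by (rule group)

lemma mul_differentiable: "(\<lambda>z. mul (fst z) (snd z)) differentiable (at z)"
  unfolding mul_bch by (rule bch_differentiable[OF bracket_bilinear])

lemma mul_cancel [simp]: "mul (- x) (mul x y) = y" "mul x (mul (- x) y) = y"
  by (simp_all add: G.assoc[symmetric])

lemma mul_left_differentiable: "mul p differentiable (at y)"
proof -
  have "(\<lambda>y. (p, y)) differentiable (at y)"
    unfolding differentiable_def by (rule exI) (rule has_derivative_Pair[OF has_derivative_const has_derivative_ident])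
  then have "(\<lambda>z. mul (fst z) (snd z)) \<circ> (\<lambda>y. (p, y)) differentiable (at y)"
    by (rule differentiable_chain_at) (rule mul_differentiable)
  then show ?thesis by (simp add: o_def)
qed

lemma continuous_mul_left: "continuous_on A (mul p)"
  by (rule continuous_at_imp_continuous_on) (use mul_left_differentiable differentiable_imp_continuous_within in blast)

lemma left_diff_has_derivative: "(mul p has_derivative left_diff mul p) (at 0)"
  unfolding left_diff_def using mul_left_differentiable by (simp add: frechet_derivative_works[symmetric])

lemma linear_left_diff: "linear (left_diff mul p)"
  using left_diff_has_derivative has_derivative_linear by blast

text \<open>Translation by \<open>- p\<close> undoes translation by \<open>p\<close>, so the chain
  rule gives a left inverse of the differential; an injective linear endomorphism is onto.\<close>

lemma bij_left_diff: "bij (left_diff mul p)"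
proof -
  obtain D where D: "(mul (- p) has_derivative D) (at (mul p 0))"
    using mul_left_differentiable[of "- p" "mul p 0"] unfolding differentiable_def by blast
  have "(mul (- p) \<circ> mul p has_derivative D \<circ> left_diff mul p) (at 0)"
    by (rule diff_chain_at[OF left_diff_has_derivative D])
  moreover have "mul (- p) \<circ> mul p = (\<lambda>x. x)" by (simp add: fun_eq_iff)
  ultimately have "D \<circ> left_diff mul p = (\<lambda>x. x)"
    using has_derivative_unique[OF _ has_derivative_ident] by metis
  then have "inj (left_diff mul p)" by (metis inj_on_id2 inj_on_imageI2)
  then show ?thesis using linear_left_diff linear_injective_imp_surjective by (auto simp: bij_def)
qed

end

section \<open>Graded coordinates and dilations\<close>

locale graded_basis = homogeneous_group H \<iota> br mul
  for H :: "nat \<Rightarrow> 'a::euclidean_space set" and \<iota> br mul +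
  fixes es :: "'a list"
  assumes adapted: "adapted_basis H \<iota> es"
begin

definition deg :: "'a \<Rightarrow> nat" where "deg e = (THE j. e \<in> H j)"

lemma es_facts:
  shows "distinct es" and "e \<in> set es \<Longrightarrow> \<exists>j\<in>{1..\<iota>}. e \<in> H j"
    and "j \<in> {1..\<iota>} \<Longrightarrow> independent (set es \<inter> H j)" and "j \<in> {1..\<iota>} \<Longrightarrow> span (set es \<inter> H j) = H j"
  using adapted unfolding adapted_basis_def by blast+

lemma layer_unique:
  assumes "x \<in> H i" "x \<in> H j" "x \<noteq> 0"
  shows "i = j"
  using layers_orthogonal[of i j x x] assms by auto

lemma es_nonzero: "e \<in> set es \<Longrightarrow> e \<noteq> 0"
  using es_facts(2,3) dependent_zero by (metis IntI)

lemma deg_eq: "e \<in> set es \<Longrightarrow> e \<in> H j \<Longrightarrow> deg e = j"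
  unfolding deg_def using layer_unique es_nonzero by blast

lemma es_in_layer: "e \<in> set es \<Longrightarrow> e \<in> H (deg e)" and deg_pos: "e \<in> set es \<Longrightarrow> 1 \<le> deg e"
  and deg_le: "e \<in> set es \<Longrightarrow> deg e \<le> \<iota>"
  using es_facts(2) deg_eq by fastforce+

text \<open>The layers are orthogonal, so pairing a vanishing combination with its component
  \<open>x\<close> in one layer gives \<open>x \<bullet> x = 0\<close>; independence inside that
  layer does the rest.\<close>

lemma independent_es: "independent (set es)"
proof (rule independent_if_scalars_zero)
  fix u and e assume sum0: "(\<Sum>x\<in>set es. u x *\<^sub>R x) = 0" and e: "e \<in> set es"
  let ?B = "set es \<inter> H (deg e)"
  define x where "x = (\<Sum>v\<in>?B. u v *\<^sub>R v)"
  have "x \<in> H (deg e)" unfolding x_def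
    using layer_subspace by (intro subspace_sum subspace_scale) auto
  have "x \<bullet> x = (\<Sum>v\<in>?B. u v * (v \<bullet> x))"
    by (subst x_def) (simp add: inner_sum_left)
  also have "\<dots> = (\<Sum>v\<in>set es. u v * (v \<bullet> x))"
  proof (rule sum.mono_neutral_left)
    show "\<forall>v\<in>set es - ?B. u v * (v \<bullet> x) = 0"
    proof
      fix v assume v: "v \<in> set es - ?B"
      then have "deg v \<noteq> deg e" using es_in_layer[of v] by auto
      then have "v \<bullet> x = 0" using layers_orthogonal[OF _ es_in_layer \<open>x \<in> _\<close>] v by blast
      then show "u v * (v \<bullet> x) = 0" by simp
    qed
  qed auto
  also have "\<dots> = (\<Sum>v\<in>set es. u v *\<^sub>R v) \<bullet> x" by (simp add: inner_sum_left)
  also have "\<dots> = 0" by (simp add: sum0)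
  finally have "x = 0" by simp
  moreover have "independent ?B" using deg_pos[OF e] deg_le[OF e] by (intro es_facts(3)) simp
  ultimately show "u e = 0"
    using independentD[of ?B ?B u e] e es_in_layer[OF e] unfolding x_def by auto
qed simp

lemma span_es: "span (set es) = UNIV"
proof -
  have "H j \<subseteq> span (set es)" if "j \<in> {1..\<iota>}" for j
    using es_facts(4)[OF that] span_mono[of "set es \<inter> H j" "set es"] by auto
  then have "span (\<Union>i\<in>{1..\<iota>}. H i) \<subseteq> span (set es)"
    by (intro span_minimal UN_least) simp_all
  then show ?thesis unfolding layers_span by blast
qed

text \<open>\<open>es\<close> need not be orthonormal, so coordinates are taken against dual
  vectors.\<close>

definition coframe :: "'a \<Rightarrow> 'a" where
  "coframe = (SOME w. \<forall>b\<in>set es. \<forall>c\<in>set es. b \<bullet> w c = (if b = c then 1 else 0))"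

lemma coframe: "b \<in> set es \<Longrightarrow> c \<in> set es \<Longrightarrow> b \<bullet> coframe c = (if b = c then 1 else 0)"
proof -
  have "\<exists>w. \<forall>b\<in>set es. \<forall>c\<in>set es. b \<bullet> w c = (if b = c then 1 else 0)"
    using dual_family[OF independent_es] by metis
  then have "\<forall>b\<in>set es. \<forall>c\<in>set es. b \<bullet> coframe c = (if b = c then 1 else 0)"
    unfolding coframe_def by (rule someI_ex)
  then show "b \<in> set es \<Longrightarrow> c \<in> set es \<Longrightarrow> b \<bullet> coframe c = (if b = c then 1 else 0)" by blast
qed

lemma es_expansion: "x = (\<Sum>e\<in>set es. (x \<bullet> coframe e) *\<^sub>R e)"
  by (rule dual_expansion[OF independent_es _ coframe]) (simp_all add: span_es)

text \<open>\<open>dilation\<close> is a definite description: the basis of layer vectors provides a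
  map as required, and the layers span the space, which makes it unique.\<close>

lemma
  shows linear_dilation: "linear (dilation H r)" and dilation_layer: "v \<in> H i \<Longrightarrow> dilation H r v = r ^ i *\<^sub>R v"
proof -
  obtain g where g: "linear g" "\<forall>e\<in>set es. g e = r ^ deg e *\<^sub>R e"
    using linear_independent_extend[OF independent_es, of "\<lambda>e. r ^ deg e *\<^sub>R e"] by blast
  have layer: "g v = r ^ i *\<^sub>R v" if v: "v \<in> H i" for i v
  proof (cases "i \<in> {1..\<iota>}")
    case True
    show ?thesis
    proof (rule linear_eq_on_span[OF g(1) linear_scaleR])
      show "v \<in> span (set es \<inter> H i)" using es_facts(4)[OF True] v by simp
      show "g e = r ^ i *\<^sub>R e" if "e \<in> set es \<inter> H i" for e using that g(2) deg_eq by auto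
    qed
  next
    case False
    then have "H i = {0}" using layer_zero layer_above by (cases "i = 0") auto
    then show ?thesis using v linear_0[OF g(1)] by simp
  qed
  have uniq: "f = g" if f: "linear f \<and> (\<forall>i. \<forall>v\<in>H i. f v = r ^ i *\<^sub>R v)" for f
  proof
    fix x
    show "f x = g x"
    proof (rule linear_eq_on_span[OF conjunct1[OF f] g(1)])
      show "x \<in> span (\<Union>i\<in>{1..\<iota>}. H i)" unfolding layers_span by simp
      show "f v = g v" if "v \<in> (\<Union>i\<in>{1..\<iota>}. H i)" for v using that f layer by auto
    qed
  qed
  have "dilation H r = g" unfolding dilation_def
    by (rule the_equality) (use g(1) layer uniq in auto)
  then show "linear (dilation H r)" "v \<in> H i \<Longrightarrow> dilation H r v = r ^ i *\<^sub>R v"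
    using g(1) layer by auto
qed

lemma dilation_es: "e \<in> set es \<Longrightarrow> dilation H r e = r ^ deg e *\<^sub>R e"
  by (rule dilation_layer[OF es_in_layer])

lemma dilation_expansion: "dilation H r x = (\<Sum>e\<in>set es. (r ^ deg e * (x \<bullet> coframe e)) *\<^sub>R e)"
proof -
  have "dilation H r x = dilation H r (\<Sum>e\<in>set es. (x \<bullet> coframe e) *\<^sub>R e)" using es_expansion by simp
  also have "\<dots> = (\<Sum>e\<in>set es. (x \<bullet> coframe e) *\<^sub>R dilation H r e)"
    by (simp add: linear_sum[OF linear_dilation] linear_scale[OF linear_dilation])
  also have "\<dots> = (\<Sum>e\<in>set es. (r ^ deg e * (x \<bullet> coframe e)) *\<^sub>R e)"
    by (rule sum.cong) (auto simp: dilation_es mult.commute)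
  finally show ?thesis .
qed

lemma dilation_coord: "e \<in> set es \<Longrightarrow> dilation H r x \<bullet> coframe e = r ^ deg e * (x \<bullet> coframe e)"
proof -
  assume e: "e \<in> set es"
  have "dilation H r x \<bullet> coframe e = (\<Sum>c\<in>set es. if c = e then r ^ deg e * (x \<bullet> coframe e) else 0)"
    unfolding dilation_expansion inner_sum_left by (rule sum.cong) (auto simp: coframe e)
  then show ?thesis using e by simp
qed

lemma dilation_dilation: "dilation H r (dilation H s x) = dilation H (r * s) x"
  unfolding dilation_expansion[of r] dilation_expansion[of "r * s"]
  by (rule sum.cong) (auto simp: dilation_coord power_mult_distrib mult.assoc)

lemma dilation_1 [simp]: "dilation H 1 x = x"
  unfolding dilation_expansion[of 1] using es_expansion[of x] by simp

lemma dilation_zero [simp]: "dilation H r 0 = 0"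
  by (rule linear_0[OF linear_dilation])

lemma dilation_inverse: "r \<noteq> 0 \<Longrightarrow> dilation H (1 / r) (dilation H r x) = x"
  by (simp add: dilation_dilation)

lemma dilation_0_left: "dilation H 0 x = 0"
  unfolding dilation_expansion using deg_pos by (intro sum.neutral) force

definition coord_bound :: real where "coord_bound = (\<Sum>e\<in>set es. norm (coframe e) * norm e)"

lemma norm_dilation_le:
  assumes "\<And>e. e \<in> set es \<Longrightarrow> \<bar>r ^ deg e\<bar> \<le> c"
  shows "norm (dilation H r x) \<le> c * coord_bound * norm x"
proof -
  have "norm (dilation H r x) \<le> (\<Sum>e\<in>set es. norm ((r ^ deg e * (x \<bullet> coframe e)) *\<^sub>R e))"
    unfolding dilation_expansion by (rule norm_sum)
  also have "\<dots> \<le> (\<Sum>e\<in>set es. c * (norm x * norm (coframe e)) * norm e)"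
  proof (rule sum_mono)
    fix e assume e: "e \<in> set es"
    have "\<bar>r ^ deg e\<bar> * \<bar>x \<bullet> coframe e\<bar> \<le> c * (norm x * norm (coframe e))"
      using assms[OF e] Cauchy_Schwarz_ineq2[of x "coframe e"] by (intro mult_mono) (auto intro: order_trans[OF abs_ge_zero])
    then show "norm ((r ^ deg e * (x \<bullet> coframe e)) *\<^sub>R e) \<le> c * (norm x * norm (coframe e)) * norm e"
      by (simp add: abs_mult mult_right_mono)
  qed
  also have "\<dots> = c * coord_bound * norm x"
    by (simp add: coord_bound_def sum_distrib_left sum_distrib_right mult_ac)
  finally show ?thesis .
qed

text \<open>The norm of the dilated vector is continuous in \<open>r\<close> and vanishes at
  \<open>r = 0\<close>, since all degrees are positive. At \<open>R\<close> it is at least 1: a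
  nonzero coordinate grows at least linearly for \<open>R \<ge> 1\<close>. The intermediate value
  theorem applies.\<close>

lemma dilation_to_sphere:
  assumes "x \<noteq> 0"
  obtains r where "0 < r" "norm (dilation H r x) = 1"
proof -
  obtain e where e: "e \<in> set es" "x \<bullet> coframe e \<noteq> 0"
    using es_expansion[of x] assms by (metis (mono_tags, lifting) scaleR_zero_left sum.neutral)
  have cont: "continuous_on UNIV (\<lambda>r. norm (dilation H r x))"
    unfolding dilation_expansion by (intro continuous_intros)
  have "coframe e \<noteq> 0" using e(2) by auto
  define R where "R = max 1 (norm (coframe e) / \<bar>x \<bullet> coframe e\<bar>)"
  have "norm (coframe e) / \<bar>x \<bullet> coframe e\<bar> \<le> R" by (simp add: R_def)
  also have "R = R ^ 1" by simp
  also have "\<dots> \<le> R ^ deg e" using deg_pos[OF e(1)] by (intro power_increasing) (auto simp: R_def)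
  finally have "norm (coframe e) \<le> R ^ deg e * \<bar>x \<bullet> coframe e\<bar>" using e(2) by (simp add: field_simps)
  also have "\<dots> = \<bar>dilation H R x \<bullet> coframe e\<bar>" by (simp add: dilation_coord[OF e(1)] abs_mult R_def)
  also have "\<dots> \<le> norm (dilation H R x) * norm (coframe e)" by (rule Cauchy_Schwarz_ineq2)
  finally have "1 \<le> norm (dilation H R x)" using \<open>coframe e \<noteq> 0\<close> by simp
  moreover have "0 \<le> R" by (simp add: R_def)
  ultimately obtain r where r: "0 \<le> r" "norm (dilation H r x) = 1"
    using IVT'[of "\<lambda>r. norm (dilation H r x)" 0 1 R] continuous_on_subset[OF cont] dilation_0_left by auto
  then have "r \<noteq> 0" using dilation_0_left by auto
  show ?thesis by (rule that[of r]) (use r \<open>r \<noteq> 0\<close> in simp_all)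
qed

end

section \<open>Homogeneous distances and the Euclidean topology\<close>

locale graded_metric = graded_basis H \<iota> br mul es
  for H :: "nat \<Rightarrow> 'a::euclidean_space set" and \<iota> br mul es +
  fixes d :: "'a \<Rightarrow> 'a \<Rightarrow> real"
  assumes hom_dist: "homogeneous_distance H mul d"
begin

lemma metric_d: "Metric_space UNIV d"
  and d_left: "d (mul z x) (mul z y) = d x y"
  and d_dilation: "0 < r \<Longrightarrow> d (dilation H r x) (dilation H r y) = r * d x y"
  using hom_dist by (auto simp: homogeneous_distance_def)

sublocale M: Metric_space UNIV d by (rule metric_d)

lemma d_eq: "d x y = d 0 (mul (- x) y)"
  using d_left[of "- x" x y] by simp

lemma d0_dilation: "0 < r \<Longrightarrow> d 0 (dilation H r x) = r * d 0 x"
  using d_dilation[of r 0 x] by simp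

lemma d0_uminus: "d 0 (- x) = d 0 x"
  using d_left[of x 0 "- x"] by (simp add: M.commute)

lemma d0_mul_le: "d 0 (mul x y) \<le> d 0 x + d 0 y"
  using M.triangle[of 0 x "mul x y"] d_left[of x 0 y] by simp

text \<open>Dilation by the root of degree \<open>deg e\<close> of \<bar>t\<bar> takes
  \<open>e\<close> to \<bar>t\<bar> times \<open>e\<close>; the sign is harmless because
  \<open>- x\<close> is the group inverse of \<open>x\<close>.\<close>

lemma d0_scaled:
  assumes e: "e \<in> set es"
  shows "d 0 (t *\<^sub>R e) = root (deg e) \<bar>t\<bar> * d 0 e"
proof (cases "t = 0")
  case True then show ?thesis using deg_pos[OF e] by simp
next
  case False
  have pos: "0 < root (deg e) \<bar>t\<bar>" using False deg_pos[OF e] by simp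
  have "dilation H (root (deg e) \<bar>t\<bar>) e = \<bar>t\<bar> *\<^sub>R e"
    using deg_pos[OF e] by (simp add: dilation_es[OF e])
  then have "d 0 (\<bar>t\<bar> *\<^sub>R e) = root (deg e) \<bar>t\<bar> * d 0 e" using d0_dilation[OF pos, of e] by simp
  moreover have "d 0 (t *\<^sub>R e) = d 0 (\<bar>t\<bar> *\<^sub>R e)"
    using d0_uminus[of "t *\<^sub>R e"] by (cases "0 \<le> t") auto
  ultimately show ?thesis by simp
qed

text \<open>The multiples of a vector \<open>e\<close> form a one-parameter subgroup, so this is the
  product of one-parameter factors in the order of \<open>l\<close>.\<close>

definition ordered_product :: "'a list \<Rightarrow> 'a \<Rightarrow> 'a" where
  "ordered_product l x = foldr (\<lambda>e acc. mul ((x \<bullet> coframe e) *\<^sub>R e) acc) l 0"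

lemma ordered_product_simps [simp]:
  "ordered_product [] x = 0"
  "ordered_product (e # l) x = mul ((x \<bullet> coframe e) *\<^sub>R e) (ordered_product l x)"
  by (simp_all add: ordered_product_def)

lemma d0_ordered_product:
  "set l \<subseteq> set es \<Longrightarrow>
    d 0 (ordered_product l x) \<le> (\<Sum>e\<leftarrow>l. root (deg e) \<bar>x \<bullet> coframe e\<bar> * d 0 e)"
proof (induction l)
  case (Cons e l)
  have "d 0 (ordered_product (e # l) x) \<le> d 0 ((x \<bullet> coframe e) *\<^sub>R e) + d 0 (ordered_product l x)"
    using d0_mul_le by simp
  then show ?case using Cons d0_scaled[of e "x \<bullet> coframe e"] by simp
qed simp

text \<open>Since \<open>0\<close> is the unit, both partial differentials at the origin are the
  identity.\<close>

lemma mul_has_derivative_0: "((\<lambda>z. mul (fst z) (snd z)) has_derivative (\<lambda>h. fst h + snd h)) (at 0)"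
proof -
  obtain D where D: "((\<lambda>z. mul (fst z) (snd z)) has_derivative D) (at 0)"
    using mul_differentiable unfolding differentiable_def by blast
  have at0: "((\<lambda>z. mul (fst z) (snd z)) has_derivative D) (at (0, 0))"
    using D by (simp add: zero_prod_def)
  have "((\<lambda>x. (x, 0)) has_derivative (\<lambda>h. (h, 0::'a))) (at (0::'a))"
    by (rule has_derivative_Pair[OF has_derivative_ident has_derivative_const])
  from diff_chain_at[OF this at0] have "((\<lambda>x. x) has_derivative (\<lambda>h. D (h, 0))) (at (0::'a))"
    by (simp add: o_def)
  then have D1: "D (h, 0) = h" for h
    using has_derivative_unique[OF _ has_derivative_ident] by (metis (no_types))
  have "((\<lambda>y. (0, y)) has_derivative (\<lambda>h. (0::'a, h))) (at (0::'a))"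
    by (rule has_derivative_Pair[OF has_derivative_const has_derivative_ident])
  from diff_chain_at[OF this at0] have "((\<lambda>x. x) has_derivative (\<lambda>h. D (0, h))) (at (0::'a))"
    by (simp add: o_def)
  then have D2: "D (0, h) = h" for h
    using has_derivative_unique[OF _ has_derivative_ident] by (metis (no_types))
  have "D h = fst h + snd h" for h
  proof -
    have "D h = D ((fst h, 0) + (0, snd h))" by simp
    also have "\<dots> = D (fst h, 0) + D (0, snd h)"
      by (rule linear_add[OF has_derivative_linear[OF D]])
    finally show ?thesis by (simp add: D1 D2)
  qed
  then have "D = (\<lambda>h. fst h + snd h)" by (simp add: fun_eq_iff)
  then show ?thesis using D by simp
qed

lemma ordered_product_0 [simp]: "ordered_product l 0 = 0"
  by (induction l) auto

lemma coord_has_derivative: "((\<lambda>x. (x \<bullet> coframe e) *\<^sub>R e) has_derivative (\<lambda>h. (h \<bullet> coframe e) *\<^sub>R e)) (at x)"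
  by (auto intro!: derivative_eq_intros)

lemma ordered_product_has_derivative_0:
  "(ordered_product l has_derivative (\<lambda>h. \<Sum>e\<leftarrow>l. (h \<bullet> coframe e) *\<^sub>R e)) (at 0)"
proof (induction l)
  case Nil then show ?case using has_derivative_const[of 0 "at (0::'a)"] by (simp add: ordered_product_def[abs_def])
next
  case (Cons e l)
  let ?P = "\<lambda>x. ((x \<bullet> coframe e) *\<^sub>R e, ordered_product l x)"
  have P: "(?P has_derivative (\<lambda>h. ((h \<bullet> coframe e) *\<^sub>R e, \<Sum>e\<leftarrow>l. (h \<bullet> coframe e) *\<^sub>R e))) (at 0)"
    by (rule has_derivative_Pair[OF coord_has_derivative Cons])
  have "((\<lambda>z. mul (fst z) (snd z)) has_derivative (\<lambda>h. fst h + snd h)) (at (?P 0))"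
    using mul_has_derivative_0 by (simp add: zero_prod_def)
  from diff_chain_at[OF P this] show ?case by (simp add: o_def ordered_product_def[abs_def])
qed

lemma ordered_product_differentiable: "ordered_product l differentiable (at x)"
proof (induction l)
  case Nil then show ?case by (simp add: ordered_product_def[abs_def])
next
  case (Cons e l)
  let ?P = "\<lambda>x. ((x \<bullet> coframe e) *\<^sub>R e, ordered_product l x)"
  have "?P differentiable (at x)"
    using Cons coord_has_derivative has_derivative_Pair unfolding differentiable_def by blast
  from differentiable_chain_at[OF this mul_differentiable] show ?case
    by (simp add: o_def ordered_product_def[abs_def])
qed

text \<open>Canonical coordinates of the second kind show that a homogeneous distance is continuous: the
  homogeneity controls \<open>d 0\<close> on the factors, and the product map is open at \<open>0\<close>.\<close>

lemma d0_small:
  assumes \<eta>: "0 < \<eta>"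
  obtains U where "open U" "0 \<in> U" "\<And>y. y \<in> U \<Longrightarrow> d 0 y < \<eta>"
proof -
  \<comment> \<open>A continuous function vanishing at 0 that bounds \<open>d 0\<close> on the
    ordered product, by left invariance and homogeneity on each factor.\<close>
  define \<rho> where "\<rho> x = (\<Sum>e\<leftarrow>es. root (deg e) \<bar>x \<bullet> coframe e\<bar> * d 0 e)" for x
  have \<rho>_sum: "\<rho> x = (\<Sum>e\<in>set es. root (deg e) \<bar>x \<bullet> coframe e\<bar> * d 0 e)" for x
    unfolding \<rho>_def by (rule sum_list_distinct_conv_sum_set[OF es_facts(1)])
  have "continuous_on UNIV \<rho>"
    unfolding \<rho>_sum[abs_def] by (intro continuous_intros)
  then have "open {x. \<rho> x < \<eta>}" by (intro open_Collect_less continuous_on_const)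
  moreover have "\<rho> 0 = 0" unfolding \<rho>_sum by (intro sum.neutral) simp
  then have "0 \<in> {x. \<rho> x < \<eta>}" using \<eta> by simp
  ultimately obtain \<epsilon> where \<epsilon>: "0 < \<epsilon>" "ball 0 \<epsilon> \<subseteq> {x. \<rho> x < \<eta>}" by (meson openE)
  let ?\<Phi> = "ordered_product es"
  have der: "(?\<Phi> has_derivative (\<lambda>h. h)) (at 0)"
  proof -
    have "(\<Sum>e\<leftarrow>es. (h \<bullet> coframe e) *\<^sub>R e) = h" for h
      using sum_list_distinct_conv_sum_set[OF es_facts(1), of "\<lambda>e. (h \<bullet> coframe e) *\<^sub>R e"] es_expansion[of h] by simp
    then show ?thesis using ordered_product_has_derivative_0[of es] by simp
  qed
  have "?\<Phi> 0 \<in> interior (?\<Phi> ` ball 0 \<epsilon>)"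
  \<comment> \<open>The differential of the ordered product at 0 is the identity, so the image of a
    small ball is a neighbourhood of 0.\<close>
  proof (rule sussmann_open_mapping[where S = UNIV and f' = "\<lambda>h. h" and g' = "\<lambda>h. h"])
    show "continuous_on UNIV ?\<Phi>"
      by (rule continuous_at_imp_continuous_on)
        (use ordered_product_differentiable differentiable_imp_continuous_within in blast)
    show "0 \<in> interior (ball (0::'a) \<epsilon>)" using \<epsilon>(1) by simp
  qed (use der in \<open>auto simp: id_def o_def intro: bounded_linear_ident\<close>)
  then have "0 \<in> interior (?\<Phi> ` ball 0 \<epsilon>)" by simp
  moreover have "d 0 y < \<eta>" if y_in: "y \<in> interior (?\<Phi> ` ball 0 \<epsilon>)" for y
  proof -
    have "y \<in> ?\<Phi> ` ball 0 \<epsilon>" using y_in interior_subset by blast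
    then obtain x where x: "x \<in> ball 0 \<epsilon>" "y = ?\<Phi> x" by blast
    have "d 0 (?\<Phi> x) \<le> \<rho> x" unfolding \<rho>_def by (rule d0_ordered_product) simp
    then show ?thesis using x \<epsilon>(2) by auto
  qed
  ultimately show ?thesis by (intro that[of "interior (?\<Phi> ` ball 0 \<epsilon>)"]) simp_all
qed

lemma d_small:
  assumes "0 < \<eta>"
  obtains U where "open U" "x \<in> U" "\<And>y. y \<in> U \<Longrightarrow> d x y < \<eta>"
proof -
  obtain U where U: "open U" "0 \<in> U" "\<And>y. y \<in> U \<Longrightarrow> d 0 y < \<eta>"
    by (rule d0_small[OF assms]) (rule that)
  have "open (mul (- x) -` U)" by (rule open_vimage[OF U(1) continuous_mul_left])
  moreover have "d x y < \<eta>" if "y \<in> mul (- x) -` U" for y using U(3) that d_eq[of x y] by simp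
  ultimately show ?thesis using U(2) by (intro that[of "mul (- x) -` U"]) simp_all
qed

lemma continuous_d0: "continuous_on UNIV (d 0)"
  unfolding continuous_on_topological
proof (intro ballI allI impI)
  fix x :: 'a and T :: "real set" assume "open T" "d 0 x \<in> T"
  then obtain \<eta> where \<eta>: "0 < \<eta>" "ball (d 0 x) \<eta> \<subseteq> T" by (meson openE)
  obtain U where U: "open U" "x \<in> U" "\<And>y. y \<in> U \<Longrightarrow> d x y < \<eta>"
    by (rule d_small[OF \<eta>(1)]) (rule that)
  have "d 0 y \<in> T" if "y \<in> U" for y
  proof -
    have "\<bar>d 0 x - d 0 y\<bar> \<le> d x y"
      using M.triangle[of 0 x y] M.triangle[of 0 y x] by (simp add: M.commute abs_le_iff)
    then show ?thesis using U(3)[OF that] \<eta>(2) by (auto simp: dist_real_def)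
  qed
  then show "\<exists>A. open A \<and> x \<in> A \<and> (\<forall>y\<in>UNIV. y \<in> A \<longrightarrow> d 0 y \<in> T)" using U by blast
qed

text \<open>The constant \<open>m\<close> is the minimum of \<open>d 0\<close> on the Euclidean unit
  sphere, positive by compactness. Dilating \<open>x\<close> to the sphere and using homogeneity
  bounds the dilation factor by \<open>d 0 x / m\<close>.\<close>

lemma d0_norm:
  obtains m where "0 < m" "\<And>x. x \<noteq> 0 \<Longrightarrow> \<exists>s u. 0 < s \<and> s \<le> d 0 x / m \<and> norm u = 1 \<and> x = dilation H s u"
proof -
  have "\<exists>u\<in>sphere (0::'a) 1. \<forall>v\<in>sphere 0 1. d 0 u \<le> d 0 v"
    by (rule continuous_attains_inf) (simp_all add: continuous_on_subset[OF continuous_d0])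
  then obtain u0 where u0: "u0 \<in> sphere (0::'a) 1" "\<forall>v\<in>sphere 0 1. d 0 u0 \<le> d 0 v" by (elim bexE) (rule that)
  have "u0 \<noteq> 0" using u0(1) by auto
  then have pos: "0 < d 0 u0" by simp
  show ?thesis
  proof (rule that[OF pos])
    fix x :: 'a assume "x \<noteq> 0"
    then obtain r where r: "0 < r" "norm (dilation H r x) = 1" by (rule dilation_to_sphere)
    have "d 0 u0 \<le> d 0 (dilation H r x)" using r(2) by (intro bspec[OF u0(2)]) simp
    also have "\<dots> = r * d 0 x" by (rule d0_dilation[OF r(1)])
    finally have "1 / r \<le> d 0 x / d 0 u0" using r(1) pos by (simp add: field_simps)
    then show "\<exists>s u. 0 < s \<and> s \<le> d 0 x / d 0 u0 \<and> norm u = 1 \<and> x = dilation H s u"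
      using r dilation_inverse[of r x] by (intro exI[of _ "1 / r"] exI[of _ "dilation H r x"]) auto
  qed
qed

lemma norm_small:
  assumes \<eta>: "0 < \<eta>"
  obtains \<rho> where "0 < \<rho>" "\<And>x. d 0 x < \<rho> \<Longrightarrow> norm x < \<eta>"
proof -
  obtain m where m: "0 < m" "\<And>x. x \<noteq> 0 \<Longrightarrow> \<exists>s u. 0 < s \<and> s \<le> d 0 x / m \<and> norm u = 1 \<and> x = dilation H s u"
    by (rule d0_norm) (rule that)
  have K: "0 \<le> coord_bound" by (simp add: coord_bound_def sum_nonneg)
  \<comment> \<open>The bound by \<open>m\<close> forces \<open>s \<le> 1\<close>, where every power
    of \<open>s\<close> with positive exponent is at most \<open>s\<close>; adding 1 keeps the
    denominator positive.\<close>
  define \<rho> where "\<rho> = min m (m * \<eta> / (coord_bound + 1))"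
  show ?thesis
  proof (rule that[of \<rho>])
    show "0 < \<rho>" using m(1) \<eta> K by (simp add: \<rho>_def)
    fix x assume x: "d 0 x < \<rho>"
    show "norm x < \<eta>"
    proof (cases "x = 0")
      case True then show ?thesis using \<eta> by simp
    next
      case False
      then obtain s u where s: "0 < s" "s \<le> d 0 x / m" "norm u = 1" "x = dilation H s u" using m(2) by blast
      have "d 0 x / m < 1" using x m(1) by (simp add: \<rho>_def)
      then have "s \<le> 1" using s(2) by simp
      have "norm x \<le> s * coord_bound * norm u" unfolding s(4)
      proof (rule norm_dilation_le)
        fix e assume "e \<in> set es"
        then have "s ^ deg e \<le> s ^ 1" using deg_pos s(1) \<open>s \<le> 1\<close> by (intro power_decreasing) auto
        then show "\<bar>s ^ deg e\<bar> \<le> s" using s(1) by simp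
      qed
      also have "\<dots> \<le> s * (coord_bound + 1)" using s(1,3) by simp
      also have "\<dots> \<le> d 0 x / m * (coord_bound + 1)" using s(2) K by (intro mult_right_mono) auto
      also have "\<dots> < \<eta>"
      proof -
        have "d 0 x < m * \<eta> / (coord_bound + 1)" using x by (simp add: \<rho>_def)
        then have "d 0 x * (coord_bound + 1) < m * \<eta>" using K by (simp add: pos_less_divide_eq)
        then show ?thesis using m(1) by (simp add: pos_divide_less_eq mult.commute)
      qed
      finally show ?thesis .
    qed
  qed
qed

lemma bounded_d0: "bounded {x. d 0 x \<le> R}"
proof -
  obtain m where m: "0 < m" "\<And>x. x \<noteq> 0 \<Longrightarrow> \<exists>s u. 0 < s \<and> s \<le> d 0 x / m \<and> norm u = 1 \<and> x = dilation H s u"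
    by (rule d0_norm) (rule that)
  \<comment> \<open>As \<open>S \<ge> 1\<close> and \<open>s \<le> S\<close>, the single power of
    exponent \<iota> dominates s^(deg e) for all basis vectors.\<close>
  define S where "S = 1 + \<bar>R\<bar> / m"
  have S: "1 \<le> S" using m(1) by (simp add: S_def)
  have K: "0 \<le> coord_bound" by (simp add: coord_bound_def sum_nonneg)
  have "norm x \<le> S ^ \<iota> * coord_bound" if x: "d 0 x \<le> R" for x
  proof (cases "x = 0")
    case True then show ?thesis using S K by simp
  next
    case False
    then obtain s u where s: "0 < s" "s \<le> d 0 x / m" "norm u = 1" "x = dilation H s u" using m(2) by blast
    have "d 0 x / m \<le> \<bar>R\<bar> / m" using x m(1) by (intro divide_right_mono) auto
    then have "s \<le> S" using s(2) by (simp add: S_def)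
    have "norm x \<le> S ^ \<iota> * coord_bound * norm u" unfolding s(4)
    proof (rule norm_dilation_le)
      fix e assume e: "e \<in> set es"
      have "s ^ deg e \<le> S ^ deg e" using s(1) \<open>s \<le> S\<close> by (intro power_mono) auto
      also have "\<dots> \<le> S ^ \<iota>" using deg_le[OF e] S by (intro power_increasing) auto
      finally show "\<bar>s ^ deg e\<bar> \<le> S ^ \<iota>" using s(1) by simp
    qed
    then show ?thesis using s(3) by simp
  qed
  then show ?thesis unfolding bounded_iff by blast
qed

text \<open>Small Euclidean norm and small \<open>d 0\<close> imply each other at the origin; left
  translations are continuous for the one and isometric for the other, which carries this to every
  point.\<close>

lemma open_iff_d: "open U \<longleftrightarrow> (\<forall>x\<in>U. \<exists>r>0. \<forall>y. d x y < r \<longrightarrow> y \<in> U)"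
proof
  assume U: "open U"
  show "\<forall>x\<in>U. \<exists>r>0. \<forall>y. d x y < r \<longrightarrow> y \<in> U"
  proof
    fix x assume "x \<in> U"
    have "open (mul x -` U)" by (rule open_vimage[OF U continuous_mul_left])
    moreover have "0 \<in> mul x -` U" using \<open>x \<in> U\<close> by simp
    ultimately obtain \<eta> where \<eta>: "0 < \<eta>" "ball 0 \<eta> \<subseteq> mul x -` U" by (meson openE)
    obtain \<rho> where \<rho>: "0 < \<rho>" "\<And>x. d 0 x < \<rho> \<Longrightarrow> norm x < \<eta>"
      by (rule norm_small[OF \<eta>(1)]) (rule that)
    have "y \<in> U" if "d x y < \<rho>" for y
    proof -
      have "norm (mul (- x) y) < \<eta>" using that d_eq[of x y] by (intro \<rho>(2)) simp
      then have "mul (- x) y \<in> mul x -` U" using \<eta>(2) by auto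
      then show ?thesis by simp
    qed
    then show "\<exists>r>0. \<forall>y. d x y < r \<longrightarrow> y \<in> U" using \<rho>(1) by blast
  qed
next
  assume U: "\<forall>x\<in>U. \<exists>r>0. \<forall>y. d x y < r \<longrightarrow> y \<in> U"
  show "open U" unfolding open_subopen[of U]
  proof
    fix x assume "x \<in> U"
    then obtain r where r: "0 < r" "\<And>y. d x y < r \<Longrightarrow> y \<in> U" using U by blast
    obtain T where "open T" "x \<in> T" "\<And>y. y \<in> T \<Longrightarrow> d x y < r"
      by (rule d_small[OF r(1)]) (rule that)
    then show "\<exists>T. open T \<and> x \<in> T \<and> T \<subseteq> U" using r(2) by blast
  qed
qed

section \<open>Diameters of balls and bounds for the spherical factor\<close>

definition ball_diameter :: real where "ball_diameter = dist_diameter d (M.mcball 0 1)"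

lemma d_le_dist_diameter:
  assumes "p \<in> M.mcball x r" "q \<in> M.mcball x r"
  shows "d p q \<le> dist_diameter d (M.mcball x r)"
  unfolding dist_diameter_def
proof (rule cSUP_upper2[where x = "(p, q)"])
  show "bdd_above ((\<lambda>(x, y). d x y) ` (M.mcball x r \<times> M.mcball x r))"
  proof (rule bdd_aboveI2, clarsimp)
    fix a b assume "d x a \<le> r" "d x b \<le> r"
    then show "d a b \<le> 2 * r" using M.triangle[of a x b] by (simp add: M.commute)
  qed
qed (use assms in auto)

text \<open>Left translation combined with dilation by \<open>s / r\<close> maps the first ball into
  the second and multiplies distances by \<open>s / r\<close>. Used in both directions, this makes
  the diameter proportional to the radius.\<close>

lemma dist_diameter_le:
  assumes "0 < r" "0 < s"
  shows "dist_diameter d (M.mcball x r) \<le> (r / s) * dist_diameter d (M.mcball y s)"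
  unfolding dist_diameter_def[of d "M.mcball x r"]
proof (rule cSUP_least)
  have "x \<in> M.mcball x r" using assms by simp
  then show "M.mcball x r \<times> M.mcball x r \<noteq> {}" by blast
  fix pq assume "pq \<in> M.mcball x r \<times> M.mcball x r"
  then obtain p q where pq: "pq = (p, q)" "p \<in> M.mcball x r" "q \<in> M.mcball x r" by auto
  define h where "h p = mul y (dilation H (s / r) (mul (- x) p))" for p
  have sr: "0 < s / r" using assms by simp
  have h_d: "d (h a) (h b) = s / r * d a b" for a b
    unfolding h_def d_left d_dilation[OF sr] ..
  have "h x = y" by (simp add: h_def)
  have h_in: "h a \<in> M.mcball y s" if "a \<in> M.mcball x r" for a
  proof -
    have "d y (h a) = s / r * d x a" using h_d[of x a] \<open>h x = y\<close> by simp
    also have "\<dots> \<le> s / r * r" using that sr by (intro mult_left_mono) auto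
    finally show ?thesis using assms by simp
  qed
  have "d p q = (r / s) * d (h p) (h q)" using assms by (simp add: h_d)
  also have "\<dots> \<le> (r / s) * dist_diameter d (M.mcball y s)"
    using assms h_in pq by (intro mult_left_mono d_le_dist_diameter) auto
  finally show "(case pq of (x, y) \<Rightarrow> d x y) \<le> (r / s) * dist_diameter d (M.mcball y s)" by (simp add: pq)
qed

lemma dist_diameter_mcball: "0 < r \<Longrightarrow> dist_diameter d (M.mcball x r) = ball_diameter * r"
  using dist_diameter_le[of r 1 x 0] dist_diameter_le[of 1 r 0 x]
  by (simp add: ball_diameter_def field_simps)

lemma ball_diameter_pos: "0 < ball_diameter"
proof -
  obtain v :: 'a where v: "v \<noteq> 0" using nonempty_Basis nonzero_Basis by blast
  then have pos: "0 < d 0 v" by simp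
  define u where "u = dilation H (1 / d 0 v) v"
  have "d 0 u = 1" unfolding u_def using pos d0_dilation[of "1 / d 0 v" v] by simp
  then have "1 \<le> ball_diameter"
    unfolding ball_diameter_def using d_le_dist_diameter[of 0 0 1 u] by simp
  then show ?thesis by simp
qed

sublocale diameter_metric d ball_diameter
  by unfold_locales (rule open_iff_d, erule dist_diameter_mcball, rule ball_diameter_pos)

lemma spherical_factor_finite:
  assumes "subspace V" "dim V \<le> n"
  shows "spherical_factor d n V < \<infinity>"
proof -
  have "spherical_factor d n V \<le> hausdorff_measure n (V \<inter> {x. d 0 x \<le> 2})"
    unfolding spherical_factor_def
  proof (intro SUP_least hausdorff_measure_mono Int_mono order_refl)
    fix z assume z: "z \<in> M.mcball 0 1"
    show "M.mcball z 1 \<subseteq> {x. d 0 x \<le> 2}"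
    proof
      fix x assume "x \<in> M.mcball z 1"
      then show "x \<in> {x. d 0 x \<le> 2}" using M.triangle[of 0 z x] z by simp
    qed
  qed
  also have "\<dots> < \<infinity>" using hausdorff_measure_subspace_finite[OF assms bounded_d0] .
  finally show ?thesis .
qed

lemma spherical_factor_pos:
  assumes "subspace V" "dim V = n"
  shows "0 < spherical_factor d n V"
proof -
  obtain U where U: "open U" "0 \<in> U" "\<And>y. y \<in> U \<Longrightarrow> d 0 y < 1"
    by (rule d0_small[of 1]) (simp, rule that)
  then obtain r where r: "0 < r" "ball 0 r \<subseteq> U" by (meson openE)
  have "0 < hausdorff_measure n (V \<inter> ball 0 r)" by (rule hausdorff_measure_subspace_pos[OF assms r(1)])
  also have "\<dots> \<le> hausdorff_measure n (V \<inter> M.mcball 0 1)"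
  proof (intro hausdorff_measure_mono Int_mono order_refl)
    show "ball (0::'a) r \<subseteq> M.mcball 0 1"
    proof
      fix x :: 'a assume "x \<in> ball 0 r"
      then have "d 0 x < 1" using r(2) by (intro U(3)) blast
      then show "x \<in> M.mcball 0 1" by simp
    qed
  qed
  also have "\<dots> \<le> spherical_factor d n V"
    unfolding spherical_factor_def by (rule SUP_upper) simp
  finally show ?thesis .
qed

end

section \<open>Graded parts of simple multivectors\<close>

text \<open>Laplace expansion along row \<open>k\<close>: the cofactors of that row do not see its
  entries, so they may be computed with a zero row.\<close>

lemma det_mat_row_linear:
  fixes G :: "nat \<Rightarrow> nat \<Rightarrow> real"
  assumes k: "k < n"
  obtains c where "\<And>h. Determinant.det (Matrix.mat n n (\<lambda>(i, j). if i = k then h j else G i j)) = (\<Sum>j<n. h j * c j)"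
proof -
  let ?A = "\<lambda>h. Matrix.mat n n (\<lambda>(i, j). if i = k then h j else G i j)"
  have del: "mat_delete (?A h) k j = mat_delete (?A (\<lambda>_. 0)) k j" if "j < n" for h j
    by (rule eq_matI) (use k that in \<open>auto simp: mat_delete_def\<close>)
  have eq: "Determinant.det (?A h) = (\<Sum>j<n. h j * cofactor (?A (\<lambda>_. 0)) k j)" for h
  proof -
    have "?A h \<in> carrier_mat n n" by simp
    from laplace_expansion_row[OF this k]
    have "Determinant.det (?A h) = (\<Sum>j<n. ?A h $$ (k, j) * cofactor (?A h) k j)" .
    also have "\<dots> = (\<Sum>j<n. h j * cofactor (?A (\<lambda>_. 0)) k j)"
    proof (rule sum.cong)
      fix j assume "j \<in> {..<n}"
      then have j: "j < n" by simp
      have "?A h $$ (k, j) = h j" using k j by simp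
      then show "?A h $$ (k, j) * cofactor (?A h) k j = h j * cofactor (?A (\<lambda>_. 0)) k j"
        unfolding cofactor_def del[OF j, of h] by (simp only:)
    qed simp
    finally show ?thesis .
  qed
  show ?thesis using eq by (rule that[of "\<lambda>j. cofactor (?A (\<lambda>_. 0)) k j"])
qed

text \<open>Writing the dependence on one factor as an inner product makes sums and spans in that
  slot immediate.\<close>

lemma wedge_list_slot:
  fixes vs :: "'a::euclidean_space list"
  assumes k: "k < length vs"
  obtains u where "\<And>x. wedge_list (vs[k := x]) ws = x \<bullet> u"
proof (cases "length ws = length vs")
  case True
  obtain c where c: "\<And>h. Determinant.det (Matrix.mat (length vs) (length vs) (\<lambda>(i, j). if i = k then h j else vs ! i \<bullet> ws ! j))
      = (\<Sum>j<length vs. h j * c j)"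
    by (rule det_mat_row_linear[OF k, of "\<lambda>i j. vs ! i \<bullet> ws ! j"]) (rule that)
  have "wedge_list (vs[k := x]) ws = x \<bullet> (\<Sum>j<length vs. c j *\<^sub>R (ws ! j))" for x
  proof -
    have "wedge_list (vs[k := x]) ws = Determinant.det (Matrix.mat (length vs) (length vs)
        (\<lambda>(i, j). if i = k then x \<bullet> ws ! j else vs ! i \<bullet> ws ! j))"
      using True k unfolding wedge_list_def gram_det_def
      by (auto intro!: arg_cong[of _ _ Determinant.det] cong_mat simp: nth_list_update)
    also have "\<dots> = (\<Sum>j<length vs. (x \<bullet> ws ! j) * c j)" by (rule c)
    finally show ?thesis by (simp add: inner_sum_right mult.commute)
  qed
  then show ?thesis by (rule that)
next
  case False
  then have "wedge_list (vs[k := x]) ws = x \<bullet> 0" for x by (simp add: wedge_list_def)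
  then show ?thesis by (rule that)
qed

lemma wedge_list_repeated:
  assumes "i \<noteq> j" "i < length vs" "j < length vs" "vs ! i = vs ! j"
  shows "wedge_list vs ws = 0"
proof (cases "length ws = length vs")
  case True
  have "Determinant.det (Matrix.mat (length vs) (length vs) (\<lambda>(i, j). vs ! i \<bullet> ws ! j)) = 0"
    by (rule det_identical_rows[OF _ assms(1-3)]) (use assms in \<open>auto simp: Matrix.row_def\<close>)
  then show ?thesis using True by (simp add: wedge_list_def gram_det_def)
qed (simp add: wedge_list_def)

lemma wedge_list_slot_sum:
  assumes "k < length vs"
  shows "wedge_list (vs[k := \<Sum>b\<in>B. c b *\<^sub>R b]) ws = (\<Sum>b\<in>B. c b * wedge_list (vs[k := b]) ws)"
proof -
  obtain u where u: "\<And>x. wedge_list (vs[k := x]) ws = x \<bullet> u" using wedge_list_slot[OF assms] by blast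
  show ?thesis unfolding u by (simp add: inner_sum_left)
qed

lemma wedge_list_permute:
  assumes "mset vs = mset us"
  obtains c where "\<And>ws. wedge_list vs ws = c * wedge_list us ws"
proof -
  obtain p where p: "p permutes {..<length us}" "permute_list p us = vs"
    by (rule mset_eq_permutation[OF assms])
  let ?n = "length us"
  have len: "length vs = ?n" using p(2) by auto
  have p': "p permutes {0..<?n}" using p(1) by (simp add: lessThan_atLeast0)
  have nth: "vs ! i = us ! p i" if "i < ?n" for i using p that by (auto simp: permute_list_nth)
  have p_less: "p i < ?n" if "i < ?n" for i using permutes_in_image[OF p(1)] that by auto
  have "wedge_list vs ws = signof p * wedge_list us ws" for ws
  proof (cases "length ws = ?n")
    case True
    let ?A = "Matrix.mat ?n ?n (\<lambda>(i, j). us ! i \<bullet> ws ! j)"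
    have "wedge_list vs ws = Determinant.det (Matrix.mat ?n ?n (\<lambda>(i, j). ?A $$ (p i, j)))"
      using True len unfolding wedge_list_def gram_det_def
      by (auto intro!: arg_cong[of _ _ Determinant.det] cong_mat simp: nth p_less)
    also have "\<dots> = signof p * Determinant.det ?A" by (rule det_permute_rows[OF _ p']) simp
    finally show ?thesis using True by (simp add: wedge_list_def gram_det_def)
  qed (simp add: wedge_list_def len)
  then show ?thesis by (rule that)
qed

lemma wedge_list_cons: "wedge v (wedge_list ts) ws = wedge_list (v # ts) ws"
proof (cases "length ws = Suc (length ts)")
  case True
  let ?m = "length ts"
  let ?A = "Matrix.mat (Suc ?m) (Suc ?m) (\<lambda>(i, j). (v # ts) ! i \<bullet> ws ! j)"
  have "wedge_list (v # ts) ws = Determinant.det ?A"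
    using True by (simp add: wedge_list_def gram_det_def)
  also have "\<dots> = (\<Sum>j<Suc ?m. ?A $$ (0, j) * cofactor ?A 0 j)"
    by (rule laplace_expansion_row) auto
  also have "\<dots> = (\<Sum>j<Suc ?m. (-1) ^ j * (v \<bullet> ws ! j) * wedge_list ts (take j ws @ drop (Suc j) ws))"
  proof (rule sum.cong)
    fix j assume "j \<in> {..<Suc ?m}"
    then have j: "j < Suc ?m" by simp
    have len: "length (take j ws @ drop (Suc j) ws) = ?m" using True j by simp
    have "mat_delete ?A 0 j = Matrix.mat ?m ?m (\<lambda>(i, l). ts ! i \<bullet> (take j ws @ drop (Suc j) ws) ! l)"
      by (rule eq_matI) (use j True in \<open>auto simp: mat_delete_def nth_append min_def\<close>)
    then have "cofactor ?A 0 j = (-1) ^ j * wedge_list ts (take j ws @ drop (Suc j) ws)"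
      using len by (simp add: cofactor_def wedge_list_def gram_det_def)
    then show "?A $$ (0, j) * cofactor ?A 0 j = (-1) ^ j * (v \<bullet> ws ! j) * wedge_list ts (take j ws @ drop (Suc j) ws)"
      using j by simp
  qed simp
  also have "\<dots> = wedge v (wedge_list ts) ws" by (simp add: wedge_def True)
  finally show ?thesis ..
next
  case False
  have "wedge_list ts (take i ws @ drop (Suc i) ws) = 0" if "i < length ws" for i
    using False that by (auto simp: wedge_list_def)
  then show ?thesis using False by (simp add: wedge_def wedge_list_def)
qed

lemma wedge_list_cons_span:
  assumes "v \<in> span (set ts)"
  shows "wedge_list (v # ts) ws = 0"
proof -
  obtain u where u: "\<And>x. wedge_list ((v # ts)[0 := x]) ws = x \<bullet> u"
    using wedge_list_slot[of 0 "v # ts" ws] by auto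
  have "t \<bullet> u = 0" if t: "t \<in> set ts" for t
  proof -
    obtain i where "i < length ts" "ts ! i = t" using t by (auto simp: in_set_conv_nth)
    then have "wedge_list (t # ts) ws = 0" by (intro wedge_list_repeated[of 0 "Suc i"]) auto
    then show ?thesis using u[of t] by simp
  qed
  then have "v \<bullet> u = 0"
    using linear_eq_0_on_span[of "\<lambda>x. x \<bullet> u" "set ts" v] assms
    by (simp add: linear_iff inner_add_left)
  then show ?thesis using u[of v] by simp
qed

definition sub_list :: "'a list \<Rightarrow> nat set \<Rightarrow> 'a list" where
  "sub_list bs I = map (\<lambda>i. bs ! i) (sorted_list_of_set I)"

lemma finite_multi_indices: "finite (multi_indices bs n)"
  by (rule finite_subset[of _ "Pow {..<length bs}"]) (auto simp: multi_indices_def)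

lemma multi_indices_finite: "I \<in> multi_indices bs n \<Longrightarrow> finite I"
  by (auto simp: multi_indices_def intro: finite_subset)

lemma length_sub_list: "I \<in> multi_indices bs n \<Longrightarrow> length (sub_list cs I) = n"
  by (auto simp: multi_indices_def sub_list_def)

lemma wedge_list_basis_combination:
  assumes len: "length vs = n" and vs: "set vs \<subseteq> set bs"
  shows "\<exists>c. \<forall>ws. wedge_list vs ws = (\<Sum>I\<in>multi_indices bs n. c I * wedge_list (sub_list bs I) ws)"
proof (cases "distinct vs")
  case False
  then obtain i j where "i < length vs" "j < length vs" "i \<noteq> j" "vs ! i = vs ! j"
    by (auto simp: distinct_conv_nth)
  then have "wedge_list vs ws = 0" for ws by (intro wedge_list_repeated[of i j vs])
  then show ?thesis by (intro exI[of _ "\<lambda>_. 0"]) simp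
next
  case True
  define idx where "idx v = (SOME i. i < length bs \<and> bs ! i = v)" for v
  have idx: "idx v < length bs" "bs ! idx v = v" if "v \<in> set vs" for v
  proof -
    have "v \<in> set bs" using that vs by blast
    then have "\<exists>i. i < length bs \<and> bs ! i = v" by (simp add: in_set_conv_nth)
    from someI_ex[OF this] show "idx v < length bs" "bs ! idx v = v" by (simp_all add: idx_def)
  qed
  have "inj_on idx (set vs)" by (metis idx(2) inj_onI)
  then have dist: "distinct (map idx vs)" using True by (simp add: distinct_map)
  define I where "I = idx ` set vs"
  have I: "I \<in> multi_indices bs n"
    using idx(1) card_image[OF \<open>inj_on idx (set vs)\<close>] distinct_card[OF True] len
    by (auto simp: I_def multi_indices_def)
  have mm: "mset (map idx vs) = mset (sorted_list_of_set I)"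
    by (rule iffD1[OF set_eq_iff_mset_eq_distinct[OF dist distinct_sorted_list_of_set]])
      (simp add: I_def)
  have "map (\<lambda>i. bs ! i) (map idx vs) = vs" using idx(2) by (simp add: map_idI)
  then have "mset vs = mset (map (\<lambda>i. bs ! i) (map idx vs))" by simp
  also have "\<dots> = image_mset (\<lambda>i. bs ! i) (mset (sorted_list_of_set I))"
    unfolding mset_map[of "\<lambda>i. bs ! i"] mm ..
  also have "\<dots> = mset (sub_list bs I)" by (simp only: sub_list_def mset_map)
  finally have perm: "mset vs = mset (sub_list bs I)" .
  obtain c where c: "\<And>ws. wedge_list vs ws = c * wedge_list (sub_list bs I) ws"
    by (rule wedge_list_permute[OF perm]) (rule that)
  have "(\<Sum>J\<in>multi_indices bs n. (if J = I then c else 0) * wedge_list (sub_list bs J) ws)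
      = (\<Sum>J\<in>multi_indices bs n. if J = I then c * wedge_list (sub_list bs I) ws else 0)" for ws
    by (rule sum.cong) auto
  then show ?thesis using I finite_multi_indices[of bs n] c
    by (intro exI[of _ "\<lambda>J. if J = I then c else 0"]) simp
qed

lemma wedge_list_combination:
  assumes len: "length vs = n" and vs: "set vs \<subseteq> span (set bs)"
  shows "\<exists>c. \<forall>ws. wedge_list vs ws = (\<Sum>I\<in>multi_indices bs n. c I * wedge_list (sub_list bs I) ws)"
proof -
  \<comment> \<open>Induction on the number \<open>k\<close> of leading slots that may still hold
    arbitrary vectors of the span; the slots from \<open>k\<close> on already hold members of
    \<open>bs\<close>.\<close>
  have "\<exists>c. \<forall>ws. wedge_list vs ws = (\<Sum>I\<in>multi_indices bs n. c I * wedge_list (sub_list bs I) ws)"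
    if "k \<le> n" "length vs = n" "set vs \<subseteq> span (set bs)" "\<And>i. k \<le> i \<Longrightarrow> i < n \<Longrightarrow> vs ! i \<in> set bs" for k vs
    using that
  proof (induction k arbitrary: vs)
    case 0
    then have "set vs \<subseteq> set bs" by (auto simp: in_set_conv_nth)
    then show ?case using wedge_list_basis_combination[OF 0(2)] by blast
  next
    case (Suc k)
    have k: "k < length vs" using Suc.prems by simp
    have "vs ! k \<in> span (set bs)" using Suc.prems(3) k by auto
    then obtain a where a: "vs ! k = (\<Sum>b\<in>set bs. a b *\<^sub>R b)"
      by (auto simp: span_finite)
    have "\<exists>c. \<forall>ws. wedge_list (vs[k := b]) ws = (\<Sum>I\<in>multi_indices bs n. c I * wedge_list (sub_list bs I) ws)"
      if b: "b \<in> set bs" for b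
    proof (rule Suc.IH)
      show "set (vs[k := b]) \<subseteq> span (set bs)"
        using set_update_subset_insert[of vs k b] Suc.prems(3) span_base[OF b] by blast
      show "vs[k := b] ! i \<in> set bs" if "k \<le> i" "i < n" for i
        using Suc.prems(2,4) b that by (cases "i = k") auto
    qed (use Suc.prems in auto)
    then have "\<forall>b\<in>set bs. \<exists>c. \<forall>ws. wedge_list (vs[k := b]) ws = (\<Sum>I\<in>multi_indices bs n. c I * wedge_list (sub_list bs I) ws)"
      by (rule ballI)
    from bchoice[OF this] obtain c where c: "\<forall>b\<in>set bs. \<forall>ws. wedge_list (vs[k := b]) ws
        = (\<Sum>I\<in>multi_indices bs n. c b I * wedge_list (sub_list bs I) ws)" ..
    have "wedge_list vs ws = (\<Sum>I\<in>multi_indices bs n. (\<Sum>b\<in>set bs. a b * c b I) * wedge_list (sub_list bs I) ws)" for ws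
    proof -
      have "wedge_list vs ws = wedge_list (vs[k := \<Sum>b\<in>set bs. a b *\<^sub>R b]) ws" by (simp add: a[symmetric])
      also have "\<dots> = (\<Sum>b\<in>set bs. a b * wedge_list (vs[k := b]) ws)" by (rule wedge_list_slot_sum[OF k])
      also have "\<dots> = (\<Sum>b\<in>set bs. \<Sum>I\<in>multi_indices bs n. a b * (c b I * wedge_list (sub_list bs I) ws))"
        by (simp add: c sum_distrib_left)
      also have "\<dots> = (\<Sum>I\<in>multi_indices bs n. \<Sum>b\<in>set bs. a b * (c b I * wedge_list (sub_list bs I) ws))"
        by (rule sum.swap)
      finally show ?thesis by (simp add: sum_distrib_right mult.assoc)
    qed
    then show ?case by (intro exI[of _ "\<lambda>I. \<Sum>b\<in>set bs. a b * c b I"] allI)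
  qed
  from this[of n vs] show ?thesis using assms by simp
qed

text \<open>The Gram matrix has entries 0 and 1. It is the identity for \<open>I = J\<close>;
  otherwise equal cardinality provides an index in \<open>I\<close> outside \<open>J\<close>, whose
  row vanishes.\<close>

lemma wedge_list_dual:
  assumes I: "I \<in> multi_indices bs n" and J: "J \<in> multi_indices bs n"
    and fs: "length fs = length bs" "\<And>i j. i < length bs \<Longrightarrow> j < length bs \<Longrightarrow> bs ! i \<bullet> fs ! j = (if i = j then 1 else 0)"
  shows "wedge_list (sub_list bs I) (sub_list fs J) = (if I = J then 1 else 0)"
proof -
  let ?s = "sorted_list_of_set"
  have fin: "finite I" "finite J" using I J by (auto intro: multi_indices_finite)
  have len: "length (?s I) = n" "length (?s J) = n" using I J by (auto simp: multi_indices_def)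
  have less: "?s I ! i < length bs" "?s J ! i < length bs" if "i < n" for i
    using that nth_mem[of i "?s I"] nth_mem[of i "?s J"] len fin I J by (auto simp: multi_indices_def)
  have "wedge_list (sub_list bs I) (sub_list fs J)
      = Determinant.det (Matrix.mat n n (\<lambda>(a, b). if ?s I ! a = ?s J ! b then 1 else 0))"
    using len less fs(2) unfolding wedge_list_def gram_det_def
    by (auto simp: sub_list_def intro!: arg_cong[of _ _ Determinant.det] cong_mat)
  also have "\<dots> = (if I = J then 1 else 0)"
  proof (cases "I = J")
    case True
    have "Matrix.mat n n (\<lambda>(a, b). if ?s I ! a = ?s J ! b then 1 else (0::real)) = 1\<^sub>m n"
      using True len distinct_sorted_list_of_set[of J]
      by (intro eq_matI) (auto simp: nth_eq_iff_index_eq)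
    then show ?thesis using True by simp
  next
    case False
    have "card I = card J" using I J by (simp add: multi_indices_def)
    then obtain i where i: "i \<in> I" "i \<notin> J" using False fin card_subset_eq by (metis subsetI)
    then obtain a where a: "a < n" "?s I ! a = i"
      using len fin by (metis in_set_conv_nth set_sorted_list_of_set)
    let ?A = "Matrix.mat n n (\<lambda>(a, b). if ?s I ! a = ?s J ! b then 1 else (0::real))"
    have neq: "?s J ! b \<noteq> i" if "b < n" for b
      using that i(2) len fin nth_mem[of b "?s J"] by auto
    have zero: "?A $$ (a, b) = 0" if "b < n" for b using a that neq[OF that] by auto
    have "?A \<in> carrier_mat n n" by simp
    from laplace_expansion_row[OF this a(1)]
    have "Determinant.det ?A = (\<Sum>j<n. ?A $$ (a, j) * cofactor ?A a j)" .
    also have "\<dots> = 0" by (intro sum.neutral ballI) (simp only: zero lessThan_iff mult_zero_left)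
    finally have "Determinant.det ?A = 0" .
    then show ?thesis using False by simp
  qed
  finally show ?thesis .
qed

lemma wedge_list_expansion:
  assumes len: "length vs = n" and vs: "set vs \<subseteq> span (set bs)"
    and fs: "length fs = length bs" "\<And>i j. i < length bs \<Longrightarrow> j < length bs \<Longrightarrow> bs ! i \<bullet> fs ! j = (if i = j then 1 else 0)"
  shows "wedge_list vs ws = (\<Sum>I\<in>multi_indices bs n. wedge_list vs (sub_list fs I) * wedge_list (sub_list bs I) ws)"
proof -
  from wedge_list_combination[OF len vs] obtain c
    where c': "\<forall>ws. wedge_list vs ws = (\<Sum>I\<in>multi_indices bs n. c I * wedge_list (sub_list bs I) ws)" ..
  note c = c'[rule_format]
  have "wedge_list vs (sub_list fs J) = c J" if J: "J \<in> multi_indices bs n" for J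
  proof -
    have "wedge_list vs (sub_list fs J) = (\<Sum>I\<in>multi_indices bs n. if I = J then c I else 0)"
      unfolding c[of "sub_list fs J"] by (rule sum.cong) (auto simp: wedge_list_dual[OF _ J fs])
    then show ?thesis using J by (simp add: sum.delta[OF finite_multi_indices])
  qed
  then show ?thesis unfolding c[of ws] by (intro sum.cong) auto
qed

lemma mv_map_wedge_list:
  fixes T :: "'a::euclidean_space \<Rightarrow> 'a"
  assumes T: "linear T"
  shows "mv_map T (wedge_list vs) = wedge_list (map T vs)"
proof
  fix ws
  have "Matrix.mat (length vs) (length vs) (\<lambda>(i, j). vs ! i \<bullet> map (adjoint T) ws ! j)
      = Matrix.mat (length vs) (length vs) (\<lambda>(i, j). map T vs ! i \<bullet> ws ! j)" if "length ws = length vs"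
    using that by (intro cong_mat) (auto simp: adjoint_works[OF T])
  then show "mv_map T (wedge_list vs) ws = wedge_list (map T vs) ws"
    by (simp add: mv_map_def wedge_list_def gram_det_def)
qed

text \<open>With as many factors as spanning vectors a single multi-index remains in the expansion.
  Hence different frames of one tangent space have proportional n-vectors.\<close>

lemma wedge_list_eq_multiple:
  assumes "length vs = length ts" "set vs \<subseteq> span (set ts)"
  obtains c where "\<And>ws. wedge_list vs ws = c * wedge_list ts ws"
proof -
  have "multi_indices ts (length ts) = {{..<length ts}}"
  proof -
    have "I = {..<length ts}" if "I \<subseteq> {..<length ts}" "card I = length ts" for I
      using that by (intro card_subset_eq) auto
    then show ?thesis by (auto simp: multi_indices_def)
  qed
  moreover have "sub_list ts {..<length ts} = ts"
    by (simp add: sub_list_def lessThan_atLeast0 map_nth)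
  moreover from wedge_list_combination[OF assms] obtain c
    where "\<forall>ws. wedge_list vs ws = (\<Sum>I\<in>multi_indices ts (length ts). c I * wedge_list (sub_list ts I) ws)" ..
  ultimately have "\<forall>ws. wedge_list vs ws = c {..<length ts} * wedge_list ts ws" by simp
  then show ?thesis by (intro that[of "c {..<length ts}"]) simp
qed

text \<open>Evaluation at the dual family turns the Gram matrix into the identity.\<close>

lemma wedge_list_nonzero:
  assumes "distinct ts" "independent (set ts)"
  shows "\<exists>ws. wedge_list ts ws \<noteq> 0"
proof -
  obtain w where w: "\<And>b c. b \<in> set ts \<Longrightarrow> c \<in> set ts \<Longrightarrow> b \<bullet> w c = (if b = c then 1 else 0)"
    by (rule dual_family[OF assms(2)]) (rule that)
  have "Matrix.mat (length ts) (length ts) (\<lambda>(i, j). ts ! i \<bullet> map w ts ! j) = 1\<^sub>m (length ts)"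
    using w assms(1) by (intro eq_matI) (auto simp: nth_eq_iff_index_eq)
  then have "wedge_list ts (map w ts) = 1" by (simp add: wedge_list_def gram_det_def)
  then show ?thesis by (intro exI[of _ "map w ts"]) simp
qed

section \<open>Annihilators of multivectors\<close>

text \<open>The dimensions of \<open>B\<close> and of the orthogonal complement of \<open>A\<close>
  add up to more than that of the space, so the two intersect nontrivially.\<close>

lemma orthogonal_vector_exists:
  fixes A B :: "'a::euclidean_space set"
  assumes A: "subspace A" and B: "subspace B" and dim: "dim A < dim B"
  obtains v where "v \<in> B" "norm v = 1" "\<And>a. a \<in> A \<Longrightarrow> a \<bullet> v = 0"
proof -
  let ?C = "{y \<in> UNIV. \<forall>x\<in>A. orthogonal x y}"
  have C: "subspace ?C"
    by (auto simp: subspace_def orthogonal_def inner_add_right)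
  have "dim ?C + dim A = DIM('a)"
    using dim_subspace_orthogonal_to_vectors[OF A subspace_UNIV] by simp
  moreover have "dim {x + y |x y. x \<in> ?C \<and> y \<in> B} + dim (?C \<inter> B) = dim ?C + dim B"
    by (rule dim_sums_Int[OF C B])
  moreover have "dim {x + y |x y. x \<in> ?C \<and> y \<in> B} \<le> DIM('a)" by (rule dim_subset_UNIV)
  ultimately have "0 < dim (?C \<inter> B)" using dim by linarith
  have "\<not> ?C \<inter> B \<subseteq> {0}"
  proof
    assume "?C \<inter> B \<subseteq> {0}"
    then have "dim (?C \<inter> B) = 0" by (simp only: dim_eq_0)
    then show False using \<open>0 < dim _\<close> by (simp only: less_irrefl)
  qed
  then obtain y where y: "y \<in> ?C" "y \<in> B" "y \<noteq> 0" by blast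
  show ?thesis
  proof (rule that[of "(1 / norm y) *\<^sub>R y"])
    show "(1 / norm y) *\<^sub>R y \<in> B" using B y(2) by (rule subspace_scale)
    show "norm ((1 / norm y) *\<^sub>R y) = 1" using y(3) by simp
    show "a \<bullet> (1 / norm y) *\<^sub>R y = 0" if "a \<in> A" for a using y(1) that by (auto simp: orthogonal_def)
  qed
qed

text \<open>Shows linearity and continuity in \<open>v\<close>: annihilators are subspaces, and the
  product passes to limits.\<close>

lemma wedge_inner:
  "wedge v \<xi> ws = v \<bullet> (\<Sum>i<length ws. ((-1) ^ i * \<xi> (take i ws @ drop (Suc i) ws)) *\<^sub>R (ws ! i))"
  by (simp add: wedge_def inner_sum_right mult_ac)

lemma wedge_sum:
  "wedge v (\<lambda>ws. \<Sum>I\<in>Q. c I * \<xi> I ws) ws = (\<Sum>I\<in>Q. c I * wedge v (\<xi> I) ws)"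
proof -
  have "wedge v (\<lambda>ws. \<Sum>I\<in>Q. c I * \<xi> I ws) ws
      = (\<Sum>i<length ws. \<Sum>I\<in>Q. c I * ((-1) ^ i * inner v (ws ! i) * \<xi> I (take i ws @ drop (Suc i) ws)))"
    unfolding wedge_def by (rule sum.cong) (simp_all add: sum_distrib_left mult_ac)
  also have "\<dots> = (\<Sum>I\<in>Q. \<Sum>i<length ws. c I * ((-1) ^ i * inner v (ws ! i) * \<xi> I (take i ws @ drop (Suc i) ws)))"
    by (rule sum.swap)
  finally show ?thesis by (simp add: wedge_def sum_distrib_left)
qed

lemma wedge_mv_map:
  assumes "linear T"
  shows "wedge (T v) (mv_map T \<xi>) ws = wedge v \<xi> (map (adjoint T) ws)"
  unfolding wedge_def mv_map_def
  by (simp add: adjoint_works[OF assms] take_map drop_map)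

lemma subspace_annihilator: "subspace {v. wedge v \<xi> = (\<lambda>_. 0)}"
  unfolding subspace_def fun_eq_iff wedge_inner by (simp add: inner_add_left)

text \<open>A larger annihilator would contain a unit vector \<open>v\<close> orthogonal to all of
  \<open>ws\<close>. Evaluating v \<and> \<xi> at \<open>v # ws\<close> then leaves only the term
  \<open>\<xi> ws\<close>, which is not zero.\<close>

lemma dim_annihilator_le:
  assumes nz: "\<xi> ws \<noteq> 0"
  shows "dim {v. wedge v \<xi> = (\<lambda>_. 0)} \<le> length ws"
proof (rule ccontr)
  let ?A = "{v. wedge v \<xi> = (\<lambda>_. 0)}"
  assume "\<not> dim ?A \<le> length ws"
  moreover have "dim (span (set ws)) \<le> length ws"
    using dim_le_card'[of "set ws"] card_length[of ws] by simp
  ultimately have less: "dim (span (set ws)) < dim ?A" by linarith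
  obtain v where v: "v \<in> ?A" "norm v = 1" "\<And>a. a \<in> span (set ws) \<Longrightarrow> a \<bullet> v = 0"
    by (rule orthogonal_vector_exists[OF subspace_span subspace_annihilator less]) (rule that)
  have orth: "v \<bullet> ws ! i = 0" if "i < length ws" for i
    using v(3)[OF span_base[OF nth_mem[OF that]]] by (simp add: inner_commute)
  have "wedge v \<xi> (v # ws) = (\<Sum>i<Suc (length ws). if i = 0 then \<xi> ws else 0)"
    unfolding wedge_def
  proof (rule sum.cong)
    fix i assume "i \<in> {..<Suc (length ws)}"
    then show "(- 1) ^ i * (v \<bullet> (v # ws) ! i) * \<xi> (take i (v # ws) @ drop (Suc i) (v # ws)) = (if i = 0 then \<xi> ws else 0)"
      using v(2) orth by (cases i) (auto simp: norm_eq_1)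
  qed simp
  also have "\<dots> = \<xi> ws" by simp
  finally show False using v(1) nz by simp
qed

lemma wedge_list_scaled:
  fixes x :: "nat \<Rightarrow> 'a::euclidean_space"
  shows "wedge_list (map (\<lambda>i. c i *\<^sub>R x i) l) ws = (\<Prod>k<length l. c (l ! k)) * wedge_list (map x l) ws"
proof (cases "length ws = length l")
  case True
  let ?n = "length l"
  define a where "a i = Matrix.vec ?n (\<lambda>j. x (l ! i) \<bullet> ws ! j)" for i
  have "Matrix.mat ?n ?n (\<lambda>(i, j). map (\<lambda>i. c i *\<^sub>R x i) l ! i \<bullet> ws ! j) = mat\<^sub>r ?n ?n (\<lambda>i. c (l ! i) \<cdot>\<^sub>v a i)"
    by (rule eq_matI) (auto simp: a_def)
  moreover have "Matrix.mat ?n ?n (\<lambda>(i, j). map x l ! i \<bullet> ws ! j) = mat\<^sub>r ?n ?n a"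
    by (rule eq_matI) (auto simp: a_def)
  moreover have "Determinant.det (mat\<^sub>r ?n ?n (\<lambda>i. c (l ! i) \<cdot>\<^sub>v a i)) = (\<Prod>k\<in>{0..<?n}. c (l ! k)) * Determinant.det (mat\<^sub>r ?n ?n a)"
    by (rule det_rows_mul) (auto simp: a_def)
  ultimately show ?thesis using True
    by (simp add: wedge_list_def gram_det_def lessThan_atLeast0)
qed (simp add: wedge_list_def)

text \<open>\<open>mv_span\<close> attaches coefficients to multivectors; injectivity of
  \<open>E\<close> allows them to be indexed by \<open>Q\<close> instead.\<close>

lemma mv_span_image:
  assumes Q: "finite Q" and inj: "inj_on E Q"
  shows "\<eta> \<in> mv_span (E ` Q) \<longleftrightarrow> (\<exists>c. \<eta> = (\<lambda>ws. \<Sum>I\<in>Q. c I * E I ws))"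
proof
  assume "\<eta> \<in> mv_span (E ` Q)"
  then have "\<exists>c. \<eta> = (\<lambda>ws. \<Sum>\<xi>\<in>E ` Q. c \<xi> * \<xi> ws)" unfolding mv_span_def by simp
  then obtain c where "\<eta> = (\<lambda>ws. \<Sum>\<xi>\<in>E ` Q. c \<xi> * \<xi> ws)" ..
  then have "\<eta> = (\<lambda>ws. \<Sum>I\<in>Q. c (E I) * E I ws)" unfolding sum.reindex[OF inj] o_def .
  then show "\<exists>c. \<eta> = (\<lambda>ws. \<Sum>I\<in>Q. c I * E I ws)" by (rule exI[of _ "\<lambda>I. c (E I)"])
next
  assume "\<exists>c. \<eta> = (\<lambda>ws. \<Sum>I\<in>Q. c I * E I ws)"
  then obtain c where c: "\<eta> = (\<lambda>ws. \<Sum>I\<in>Q. c I * E I ws)" ..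
  have "(\<Sum>I\<in>Q. c I * E I ws) = (\<Sum>I\<in>Q. c (inv_into Q E (E I)) * E I ws)" for ws
    by (rule sum.cong) (simp_all add: inv_into_f_f[OF inj])
  then have "\<eta> = (\<lambda>ws. \<Sum>\<xi>\<in>E ` Q. c (inv_into Q E \<xi>) * \<xi> ws)"
    unfolding c sum.reindex[OF inj] o_def by (rule ext)
  then have "\<exists>c'. \<eta> = (\<lambda>ws. \<Sum>\<xi>\<in>E ` Q. c' \<xi> * \<xi> ws)"
    by (rule exI[of _ "\<lambda>\<xi>. c (inv_into Q E \<xi>)"])
  then show "\<eta> \<in> mv_span (E ` Q)" unfolding mv_span_def mem_Collect_eq .
qed

section \<open>Graded parts, dilations and the degree projection\<close>

context graded_basis begin

definition dual_es :: "'a list" where "dual_es = map coframe es"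

lemma dual_es: "length dual_es = length es"
  "i < length es \<Longrightarrow> j < length es \<Longrightarrow> es ! i \<bullet> dual_es ! j = (if i = j then 1 else 0)"
  using es_facts(1) by (auto simp: dual_es_def coframe nth_eq_iff_index_eq)

lemma index_degree_eq: "index_degree H es I = (\<Sum>i\<in>I. deg (es ! i))"
  by (simp add: index_degree_def deg_def)

text \<open>An explicit form of the degree projection at 0, with coordinates read off by the dual
  basis; \<open>left_translate_degree_proj\<close> links it to \<open>degree_proj\<close>.\<close>

definition graded_part :: "nat \<Rightarrow> 'a list \<Rightarrow> nat \<Rightarrow> 'a multivector" where
  "graded_part n ts M = (\<lambda>ws. \<Sum>I\<in>{I \<in> multi_indices es n. index_degree H es I = M}.
     wedge_list ts (sub_list dual_es I) * wedge_list (sub_list es I) ws)"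

lemma graded_part_eq_0_iff:
  "graded_part n ts M = (\<lambda>_. 0) \<longleftrightarrow>
    (\<forall>I\<in>multi_indices es n. index_degree H es I = M \<longrightarrow> wedge_list ts (sub_list dual_es I) = 0)"
proof
  assume 0: "graded_part n ts M = (\<lambda>_. 0)"
  show "\<forall>I\<in>multi_indices es n. index_degree H es I = M \<longrightarrow> wedge_list ts (sub_list dual_es I) = 0"
  proof (intro ballI impI)
    fix J assume J: "J \<in> multi_indices es n" "index_degree H es J = M"
    let ?Q = "{I \<in> multi_indices es n. index_degree H es I = M}"
    have "0 = graded_part n ts M (sub_list dual_es J)" using 0 by simp
    also have "\<dots> = (\<Sum>I\<in>?Q. if I = J then wedge_list ts (sub_list dual_es J) else 0)"
      unfolding graded_part_def by (rule sum.cong) (auto simp: wedge_list_dual[OF _ J(1) dual_es])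
    also have "\<dots> = wedge_list ts (sub_list dual_es J)"
      using J finite_multi_indices[of es n] by simp
    finally show "wedge_list ts (sub_list dual_es J) = 0" by simp
  qed
qed (auto simp: graded_part_def fun_eq_iff intro!: sum.neutral)

lemma es_wedge_expansion:
  assumes "length ts = n"
  shows "wedge_list ts ws = (\<Sum>I\<in>multi_indices es n. wedge_list ts (sub_list dual_es I) * wedge_list (sub_list es I) ws)"
  by (rule wedge_list_expansion[OF assms _ dual_es]) (simp_all add: span_es)

lemma mv_map_dilation_sub_list:
  assumes I: "I \<in> multi_indices es n"
  shows "mv_map (dilation H r) (wedge_list (sub_list es I)) ws = r ^ index_degree H es I * wedge_list (sub_list es I) ws"
proof -
  let ?l = "sorted_list_of_set I"
  have fin: "finite I" and sub: "I \<subseteq> {..<length es}" using I by (auto simp: multi_indices_def intro: finite_subset)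
  have "mv_map (dilation H r) (wedge_list (sub_list es I)) ws = wedge_list (map (dilation H r) (sub_list es I)) ws"
    by (simp add: mv_map_wedge_list[OF linear_dilation])
  also have "map (dilation H r) (sub_list es I) = map (\<lambda>i. r ^ deg (es ! i) *\<^sub>R (es ! i)) ?l"
    unfolding sub_list_def map_map
    by (rule map_cong) (use fin sub dilation_es in \<open>auto simp: o_def\<close>)
  also have "wedge_list \<dots> ws = (\<Prod>k<length ?l. r ^ deg (es ! (?l ! k))) * wedge_list (sub_list es I) ws"
    unfolding wedge_list_scaled by (simp add: sub_list_def)
  also have "(\<Prod>k<length ?l. r ^ deg (es ! (?l ! k))) = r ^ (\<Sum>k<length ?l. deg (es ! (?l ! k)))"
    by (simp add: power_sum)
  also have "(\<Sum>k<length ?l. deg (es ! (?l ! k))) = (\<Sum>i\<leftarrow>?l. deg (es ! i))"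
    by (simp add: sum_list_sum_nth lessThan_atLeast0)
  also have "\<dots> = index_degree H es I"
    using fin by (simp add: index_degree_eq sum_list_distinct_conv_sum_set)
  finally show ?thesis .
qed

lemma mv_map_dilation:
  assumes "length ts = n"
  shows "mv_map (dilation H r) (wedge_list ts) = (\<lambda>ws. \<Sum>I\<in>multi_indices es n.
     (wedge_list ts (sub_list dual_es I) * r ^ index_degree H es I) * wedge_list (sub_list es I) ws)"
proof
  fix ws
  have "mv_map (dilation H r) (wedge_list ts) ws = (\<Sum>I\<in>multi_indices es n.
      wedge_list ts (sub_list dual_es I) * mv_map (dilation H r) (wedge_list (sub_list es I)) ws)"
    unfolding mv_map_def by (rule es_wedge_expansion[OF assms])
  also have "\<dots> = (\<Sum>I\<in>multi_indices es n.
     (wedge_list ts (sub_list dual_es I) * r ^ index_degree H es I) * wedge_list (sub_list es I) ws)"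
    by (rule sum.cong) (simp_all add: mv_map_dilation_sub_list mult.assoc)
  finally show "mv_map (dilation H r) (wedge_list ts) ws = \<dots>" .
qed

lemma inj_dilation: "r \<noteq> 0 \<Longrightarrow> inj (dilation H r)"
  by (metis dilation_inverse injI)

text \<open>Let \<open>\<xi>\<close> be the part of top degree \<open>N\<close> of the simple multivector \<open>\<tau>\<close> spanned by \<open>ts\<close>. A vector \<open>v\<close>
  in the dilated span satisfies \<open>v \<and> \<delta>\<^sub>r \<tau> = 0\<close>, and \<open>r\<^sup>-\<^sup>N \<delta>\<^sub>r \<tau> \<rightarrow> \<xi>\<close> as \<open>r \<rightarrow> \<infinity>\<close>. Hence limits of unit
  vectors of the dilated spans annihilate \<open>\<xi>\<close>, so the annihilator is at least as large as the span.\<close>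

lemma dim_annihilator_graded_part:
  assumes ts: "length ts = n" "distinct ts" "independent (set ts)"
    and top: "\<And>I. I \<in> multi_indices es n \<Longrightarrow> N < index_degree H es I \<Longrightarrow> wedge_list ts (sub_list dual_es I) = 0"
  shows "n \<le> dim {v. wedge v (graded_part n ts N) = (\<lambda>_. 0)}"
proof (rule ccontr)
  let ?A = "{v. wedge v (graded_part n ts N) = (\<lambda>_. 0)}"
  let ?c = "\<lambda>I. wedge_list ts (sub_list dual_es I)"
  assume "\<not> n \<le> dim ?A"
  then have less: "dim ?A < n" by simp
  \<comment> \<open>If the annihilator had dimension less than \<open>n\<close>, each dilated span
    would contain a unit vector orthogonal to it.\<close>
  have "\<forall>k. \<exists>w. w \<in> span (set ts) \<and> norm (dilation H (real (Suc k)) w) = 1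
      \<and> (\<forall>a\<in>?A. a \<bullet> dilation H (real (Suc k)) w = 0)"
  proof
    fix k
    let ?T = "dilation H (real (Suc k)) ` span (set ts)"
    have sub: "subspace ?T" by (intro linear_subspace_image linear_dilation subspace_span)
    have "inj (dilation H (real (Suc k)))" by (rule inj_dilation) simp
    then have "inj_on (dilation H (real (Suc k))) (span (span (set ts)))"
      unfolding inj_on_def by blast
    then have "dim ?T = dim (span (set ts))" by (rule dim_image_eq[OF linear_dilation])
    also have "dim (span (set ts)) = n" using ts by (simp add: dim_eq_card_independent distinct_card)
    finally have less': "dim ?A < dim ?T" using less by simp
    obtain v where v: "v \<in> ?T" "norm v = 1" "\<And>a. a \<in> ?A \<Longrightarrow> a \<bullet> v = 0"
      by (rule orthogonal_vector_exists[OF subspace_annihilator sub less']) (rule that)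
    from v(1) obtain w where "w \<in> span (set ts)" "v = dilation H (real (Suc k)) w" by (elim imageE) (rule that)
    then show "\<exists>w. w \<in> span (set ts) \<and> norm (dilation H (real (Suc k)) w) = 1
        \<and> (\<forall>a\<in>?A. a \<bullet> dilation H (real (Suc k)) w = 0)"
      using v(2,3) by (intro exI[of _ w]) simp
  qed
  from choice[OF this] obtain w where w: "\<forall>k. w k \<in> span (set ts) \<and> norm (dilation H (real (Suc k)) (w k)) = 1
      \<and> (\<forall>a\<in>?A. a \<bullet> dilation H (real (Suc k)) (w k) = 0)" ..
  define v where "v k = dilation H (real (Suc k)) (w k)" for k
  have vw: "v k = dilation H (real (Suc k)) (w k)" "w k \<in> span (set ts)" "norm (v k) = 1" for k
    using w by (simp_all add: v_def)
  have v_orth: "a \<bullet> v k = 0" if "a \<in> ?A" for a k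
    using w that unfolding v_def by blast
  have "seq_compact (sphere (0::'a) 1)" by (simp add: compact_imp_seq_compact)
  moreover have "\<forall>k. v k \<in> sphere 0 1" using vw(3) by simp
  ultimately obtain l s where l: "l \<in> sphere 0 1" "strict_mono s" "(v \<circ> s) \<longlonglongrightarrow> l"
    by (rule seq_compactE) (rule that)
  have "wedge l (graded_part n ts N) ws = 0" for ws
  proof -
    have zero: "(\<Sum>I\<in>multi_indices es n. (?c I * real (Suc k) ^ index_degree H es I) * wedge (v k) (wedge_list (sub_list es I)) ws) = 0" for k
    proof -
      have "wedge (v k) (mv_map (dilation H (real (Suc k))) (wedge_list ts)) ws
          = wedge (w k) (wedge_list ts) (map (adjoint (dilation H (real (Suc k)))) ws)"
        unfolding vw(1) by (rule wedge_mv_map[OF linear_dilation])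
      also have "\<dots> = 0" unfolding wedge_list_cons by (rule wedge_list_cons_span[OF vw(2)])
      finally show ?thesis unfolding mv_map_dilation[OF ts(1)] wedge_sum .
    qed
    \<comment> \<open>The coefficients after division by r^N, along the convergent subsequence: they
      tend to 0 for degrees below \<open>N\<close>, are constant in degree \<open>N\<close> and
      vanish above by \<open>top\<close>.\<close>
    define q where "q I k = ?c I * (real (Suc (s k)) ^ index_degree H es I / real (Suc (s k)) ^ N)" for I k
    have "(\<Sum>I\<in>multi_indices es n. q I k * wedge (v (s k)) (wedge_list (sub_list es I)) ws) = 0" for k
    proof -
      have "(\<Sum>I\<in>multi_indices es n. q I k * wedge (v (s k)) (wedge_list (sub_list es I)) ws)
          = (\<Sum>I\<in>multi_indices es n. (?c I * real (Suc (s k)) ^ index_degree H es I) * wedge (v (s k)) (wedge_list (sub_list es I)) ws) / real (Suc (s k)) ^ N"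
        unfolding sum_divide_distrib by (rule sum.cong) (simp_all add: q_def)
      then show ?thesis by (simp only: zero div_0)
    qed
    moreover have "(\<lambda>k. \<Sum>I\<in>multi_indices es n. q I k * wedge (v (s k)) (wedge_list (sub_list es I)) ws)
      \<longlonglongrightarrow> (\<Sum>I\<in>multi_indices es n. (if index_degree H es I = N then ?c I else 0) * wedge l (wedge_list (sub_list es I)) ws)"
    proof (intro tendsto_sum tendsto_mult)
      fix I assume I: "I \<in> multi_indices es n"
      show "(\<lambda>k. wedge (v (s k)) (wedge_list (sub_list es I)) ws) \<longlonglongrightarrow> wedge l (wedge_list (sub_list es I)) ws"
        unfolding wedge_inner using l(3) by (intro tendsto_inner tendsto_const) (simp add: o_def)
      show "q I \<longlonglongrightarrow> (if index_degree H es I = N then ?c I else 0)"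
      proof (cases "index_degree H es I" N rule: linorder_cases)
        case less
        have q_eq: "q I k = ?c I * (1 / real (Suc (s k))) ^ (N - index_degree H es I)" for k
          using less by (simp add: q_def power_diff power_one_over divide_simps del: of_nat_Suc)
        have "(\<lambda>k. 1 / real (Suc (s k))) \<longlonglongrightarrow> 0"
          using LIMSEQ_subseq_LIMSEQ[OF LIMSEQ_Suc[OF lim_1_over_n] l(2)] by (simp add: o_def)
        then have lim: "(\<lambda>k. ?c I * (1 / real (Suc (s k))) ^ (N - index_degree H es I)) \<longlonglongrightarrow> ?c I * 0 ^ (N - index_degree H es I)"
          by (intro tendsto_intros)
        have "?c I * 0 ^ (N - index_degree H es I) = (if index_degree H es I = N then ?c I else 0)"
          using less by simp
        with lim show ?thesis unfolding ext[of "q I", OF q_eq] by (simp only:)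
      next
        case equal
        then have "q I = (\<lambda>k. ?c I)" by (simp add: q_def fun_eq_iff)
        then show ?thesis using equal by simp
      next
        case greater
        then have "q I = (\<lambda>k. 0)" using top[OF I] by (simp add: q_def fun_eq_iff)
        then show ?thesis using greater by simp
      qed
    qed
    ultimately have "(\<Sum>I\<in>multi_indices es n. (if index_degree H es I = N then ?c I else 0) * wedge l (wedge_list (sub_list es I)) ws) = 0"
      using LIMSEQ_unique[OF _ tendsto_const] by simp
    moreover have "wedge l (graded_part n ts N) ws
        = (\<Sum>I\<in>multi_indices es n. (if index_degree H es I = N then ?c I else 0) * wedge l (wedge_list (sub_list es I)) ws)"
      unfolding graded_part_def wedge_sum
      by (rule sum.mono_neutral_cong_left) (auto simp: finite_multi_indices)
    ultimately show ?thesis by simp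
  qed
  then have "l \<in> ?A" by (simp add: fun_eq_iff)
  \<comment> \<open>The limit lies in the annihilator and is orthogonal to it, yet has norm
    1.\<close>
  have "(\<lambda>k. l \<bullet> (v \<circ> s) k) \<longlonglongrightarrow> l \<bullet> l" using l(3) by (intro tendsto_inner tendsto_const)
  moreover have "(\<lambda>k. l \<bullet> (v \<circ> s) k) = (\<lambda>k. 0)" using v_orth[OF \<open>l \<in> ?A\<close>] by (simp add: fun_eq_iff)
  ultimately have "(\<lambda>k. 0) \<longlonglongrightarrow> l \<bullet> l" by simp
  then have "l \<bullet> l = 0" by (rule LIMSEQ_unique) (rule tendsto_const)
  then show False using l(1) by simp
qed

text \<open>The upper bound comes from any list at which the graded part does not vanish; such a
  list has length \<open>n\<close>.\<close>

lemma dim_annihilator_graded_part_eq: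
  assumes ts: "length ts = n" "distinct ts" "independent (set ts)"
    and top: "\<And>I. I \<in> multi_indices es n \<Longrightarrow> N < index_degree H es I \<Longrightarrow> wedge_list ts (sub_list dual_es I) = 0"
    and nz: "graded_part n ts N \<noteq> (\<lambda>_. 0)"
  shows "dim {v. wedge v (graded_part n ts N) = (\<lambda>_. 0)} = n"
proof (rule antisym)
  obtain ws where ws: "graded_part n ts N ws \<noteq> 0" using nz by auto
  have "length ws = n"
  proof (rule ccontr)
    assume "length ws \<noteq> n"
    then have "graded_part n ts N ws = 0" unfolding graded_part_def
      by (intro sum.neutral) (auto simp: wedge_list_def length_sub_list)
    then show False using ws by simp
  qed
  then show "dim {v. wedge v (graded_part n ts N) = (\<lambda>_. 0)} \<le> n"
    using dim_annihilator_le[of "graded_part n ts N", OF ws] by simp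
qed (rule dim_annihilator_graded_part[OF ts top])

abbreviation to_0 :: "'a \<Rightarrow> 'a \<Rightarrow> 'a" where "to_0 p \<equiv> inv_into UNIV (left_diff mul p)"

lemma linear_to_0: "linear (to_0 p)" and to_0_left_diff: "to_0 p (left_diff mul p v) = v"
  and inj_to_0: "inj (to_0 p)"
  using bij_left_diff[of p] linear_left_diff[of p]
  by (auto simp: bij_def inj_linear_imp_inv_linear surj_imp_inj_inv)

text \<open>The left invariant frame at \<open>p\<close> has the adjoint images \<open>fs\<close> of
  the dual basis as its dual family. Evaluation at lists from \<open>fs\<close> isolates single
  coefficients, which settles uniqueness in the definite description; the expansion in the frame
  settles existence.\<close>

lemma degree_proj_wedge_list:
  fixes p :: 'a
  assumes len: "length ts = n"
  defines "bs \<equiv> map (left_diff mul p) es"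
  shows "degree_proj H mul es n p M (wedge_list ts)
    = (\<lambda>ws. \<Sum>I\<in>{I \<in> multi_indices es n. index_degree H es I = M}.
        wedge_list (map (to_0 p) ts) (sub_list dual_es I) * wedge_list (sub_list bs I) ws)"
proof -
  define fs where "fs = map (adjoint (to_0 p)) dual_es"
  have fs: "length fs = length bs" by (simp add: fs_def bs_def dual_es(1))
  have dual: "bs ! i \<bullet> fs ! j = (if i = j then 1 else 0)" if "i < length bs" "j < length bs" for i j
  proof -
    have ij: "i < length es" "j < length es" using that by (simp_all add: bs_def)
    have "bs ! i \<bullet> fs ! j = to_0 p (left_diff mul p (es ! i)) \<bullet> dual_es ! j"
      using ij by (simp add: bs_def fs_def dual_es(1) adjoint_works[OF linear_to_0])
    then show ?thesis using dual_es(2)[OF ij] by (simp add: to_0_left_diff)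
  qed
  have mi: "multi_indices bs n = multi_indices es n" by (simp add: multi_indices_def bs_def)
  have span_bs: "span (set bs) = UNIV"
  proof -
    have "span (left_diff mul p ` set es) = left_diff mul p ` span (set es)"
      by (rule linear_span_image[OF linear_left_diff])
    then show ?thesis using bij_left_diff[of p] by (simp add: bs_def span_es bij_def)
  qed
  define E where "E I = wedge_list (sub_list bs I)" for I
  have E_eq: "left_invariant_mv mul es I p = E I" if I: "I \<in> multi_indices es n" for I
  proof -
    have "map (\<lambda>i. left_diff mul p (es ! i)) (sorted_list_of_set I) = sub_list bs I"
      unfolding sub_list_def bs_def
      by (rule map_cong) (use I multi_indices_finite[OF I] in \<open>auto simp: multi_indices_def\<close>)
    then show ?thesis by (simp add: left_invariant_mv_def E_def)
  qed
  have E_dual: "E I (sub_list fs J) = (if I = J then 1 else 0)"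
    if "I \<in> multi_indices es n" "J \<in> multi_indices es n" for I J
    unfolding E_def using that wedge_list_dual[of I bs n J fs] fs dual by (simp add: mi)
  have inj: "inj_on E (multi_indices es n)"
    by (rule inj_onI) (metis E_dual zero_neq_one)
  define c where "c I = wedge_list ts (sub_list fs I)" for I
  have c_eq: "c I = wedge_list (map (to_0 p) ts) (sub_list dual_es I)" if I: "I \<in> multi_indices es n" for I
  proof -
    have "sub_list fs I = map (adjoint (to_0 p)) (sub_list dual_es I)"
      unfolding sub_list_def fs_def map_map
      by (rule map_cong) (use I multi_indices_finite[OF I] dual_es(1) in \<open>auto simp: multi_indices_def\<close>)
    then show ?thesis
      unfolding c_def mv_map_wedge_list[OF linear_to_0, symmetric] mv_map_def by simp
  qed
  let ?mi = "multi_indices es n"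
  let ?Q = "{I \<in> ?mi. index_degree H es I = M}" and ?Q' = "{I \<in> ?mi. index_degree H es I \<noteq> M}"
  have fin: "finite ?Q" "finite ?Q'" using finite_multi_indices[of es n] by simp_all
  have span_Q: "mv_span {left_invariant_mv mul es I p | I. I \<in> ?mi \<and> index_degree H es I = M} = mv_span (E ` ?Q)"
    unfolding setcompr_eq_image by (rule arg_cong[of _ _ mv_span], rule image_cong) (simp_all add: E_eq)
  have span_Q': "mv_span {left_invariant_mv mul es I p | I. I \<in> ?mi \<and> index_degree H es I \<noteq> M} = mv_span (E ` ?Q')"
    unfolding setcompr_eq_image by (rule arg_cong[of _ _ mv_span], rule image_cong) (simp_all add: E_eq)
  note Q_iff = mv_span_image[OF fin(1) inj_on_subset[OF inj]] and Q'_iff = mv_span_image[OF fin(2) inj_on_subset[OF inj]]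
  have total: "wedge_list ts ws = (\<Sum>I\<in>?mi. c I * E I ws)" for ws
    unfolding c_def E_def mi[symmetric]
    by (rule wedge_list_expansion[OF len _ fs dual]) (simp_all add: span_bs)
  have split: "(\<Sum>I\<in>?mi. c I * E I ws) = (\<Sum>I\<in>?Q. c I * E I ws) + (\<Sum>I\<in>?Q'. c I * E I ws)" for ws
  proof -
    have "?mi = ?Q \<union> ?Q'" by blast
    then show ?thesis using sum.union_disjoint[OF fin, of "\<lambda>I. c I * E I ws"] by (auto simp: disjoint_iff)
  qed
  have "degree_proj H mul es n p M (wedge_list ts) = (\<lambda>ws. \<Sum>I\<in>?Q. c I * E I ws)"
    unfolding degree_proj_def span_Q span_Q'
  proof (rule the_equality)
    have "(\<lambda>ws. wedge_list ts ws - (\<Sum>I\<in>?Q. c I * E I ws)) = (\<lambda>ws. \<Sum>I\<in>?Q'. c I * E I ws)"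
      by (simp add: total split)
    then show "(\<lambda>ws. \<Sum>I\<in>?Q. c I * E I ws) \<in> mv_span (E ` ?Q) \<and>
        (\<lambda>ws. wedge_list ts ws - (\<Sum>I\<in>?Q. c I * E I ws)) \<in> mv_span (E ` ?Q')"
      using Q_iff Q'_iff by blast
  next
    fix \<eta> assume \<eta>: "\<eta> \<in> mv_span (E ` ?Q) \<and> (\<lambda>ws. wedge_list ts ws - \<eta> ws) \<in> mv_span (E ` ?Q')"
    then obtain a where a: "\<eta> = (\<lambda>ws. \<Sum>I\<in>?Q. a I * E I ws)" using Q_iff by blast
    from \<eta> obtain b where b: "(\<lambda>ws. wedge_list ts ws - \<eta> ws) = (\<lambda>ws. \<Sum>I\<in>?Q'. b I * E I ws)"
      using Q'_iff by blast
    have "a J = c J" if J: "J \<in> ?Q" for J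
    proof -
      have "\<eta> (sub_list fs J) = (\<Sum>I\<in>?Q. if I = J then a I else 0)"
        unfolding a using J by (intro sum.cong) (auto simp: E_dual)
      then have "\<eta> (sub_list fs J) = a J" using J fin by simp
      moreover have "wedge_list ts (sub_list fs J) - \<eta> (sub_list fs J) = (\<Sum>I\<in>?Q'. b I * E I (sub_list fs J))"
        using fun_cong[OF b, of "sub_list fs J"] .
      moreover have "(\<Sum>I\<in>?Q'. b I * E I (sub_list fs J)) = 0"
        using J by (intro sum.neutral) (auto simp: E_dual)
      ultimately show ?thesis by (simp add: c_def)
    qed
    then show "\<eta> = (\<lambda>ws. \<Sum>I\<in>?Q. c I * E I ws)" unfolding a by simp
  qed
  also have "\<dots> = (\<lambda>ws. \<Sum>I\<in>?Q. wedge_list (map (to_0 p) ts) (sub_list dual_es I) * wedge_list (sub_list bs I) ws)"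
    by (simp add: c_eq E_def)
  finally show ?thesis .
qed

lemma left_translate_degree_proj:
  assumes "length ts = n"
  shows "left_translate_to_0 mul p (degree_proj H mul es n p M (wedge_list ts)) = graded_part n (map (to_0 p) ts) M"
proof
  fix ws
  have "wedge_list (sub_list (map (left_diff mul p) es) I) (map (adjoint (to_0 p)) ws) = wedge_list (sub_list es I) ws"
    if I: "I \<in> multi_indices es n" for I
  proof -
    have "map (to_0 p) (sub_list (map (left_diff mul p) es) I) = sub_list es I"
      unfolding sub_list_def map_map
      by (rule map_cong) (use I multi_indices_finite[OF I] in \<open>auto simp: multi_indices_def to_0_left_diff\<close>)
    then show ?thesis
      using fun_cong[OF mv_map_wedge_list[OF linear_to_0], of p "sub_list (map (left_diff mul p) es) I" ws]
      by (simp add: mv_map_def)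
  qed
  then show "left_translate_to_0 mul p (degree_proj H mul es n p M (wedge_list ts)) ws = graded_part n (map (to_0 p) ts) M ws"
    by (simp add: left_translate_to_0_def degree_proj_wedge_list[OF assms] mv_map_def graded_part_def)
qed

lemma degree_proj_eq_0_iff:
  assumes len: "length ts = n"
  shows "degree_proj H mul es n p M (wedge_list ts) = (\<lambda>_. 0) \<longleftrightarrow> graded_part n (map (to_0 p) ts) M = (\<lambda>_. 0)"
proof
  assume "degree_proj H mul es n p M (wedge_list ts) = (\<lambda>_. 0)"
  then show "graded_part n (map (to_0 p) ts) M = (\<lambda>_. 0)"
    by (simp add: left_translate_degree_proj[OF len, symmetric] left_translate_to_0_def mv_map_def)
next
  assume "graded_part n (map (to_0 p) ts) M = (\<lambda>_. 0)"
  then show "degree_proj H mul es n p M (wedge_list ts) = (\<lambda>_. 0)"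
    unfolding degree_proj_wedge_list[OF len] graded_part_eq_0_iff by (auto simp: fun_eq_iff intro!: sum.neutral)
qed

end

section \<open>Tangent spaces\<close>

lemma orthonormal_list_dim:
  fixes ls :: "'a::euclidean_space list"
  assumes "\<And>i j. i < length ls \<Longrightarrow> j < length ls \<Longrightarrow> ls ! i \<bullet> ls ! j = (if i = j then 1 else 0)"
  shows "dim (span (set ls)) = length ls"
proof -
  have "distinct ls"
    unfolding distinct_conv_nth using assms by (metis zero_neq_one)
  have "pairwise orthogonal (set ls)"
  proof (rule pairwiseI)
    fix x y assume "x \<in> set ls" "y \<in> set ls" "x \<noteq> y"
    then obtain i j where "i < length ls" "x = ls ! i" "j < length ls" "y = ls ! j" "i \<noteq> j"
      by (auto simp: in_set_conv_nth)
    then show "orthogonal x y" using assms by (simp add: orthogonal_def)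
  qed
  moreover have "0 \<notin> set ls"
  proof
    assume "0 \<in> set ls"
    then obtain i where "i < length ls" "ls ! i = 0" by (auto simp: in_set_conv_nth)
    then show False using assms[of i i] by simp
  qed
  ultimately have "independent (set ls)" by (rule pairwise_orthogonal_independent)
  then show ?thesis using \<open>distinct ls\<close> by (simp add: dim_eq_card_independent distinct_card)
qed

text \<open>A curve in \<open>S\<close> is lifted to the parameter domain by the continuous inverse of the
  parametrization; the lift is \<open>O(t)\<close> because the differential is bounded below.\<close>

lemma tangent_space_parametrization:
  assumes lp: "local_parametrization n S ls U \<phi>" and x0: "x0 \<in> U" "x0 \<in> span (set ls)"
  defines "D \<equiv> frechet_derivative \<phi> (at x0)"
  shows "tangent_space S (\<phi> x0) = D ` span (set ls)" and "linear D" and "inj_on D (span (set ls))"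
proof -
  let ?V = "span (set ls)" and ?W = "\<phi> ` (U \<inter> span (set ls))"
  have U: "open U" and inj: "inj_on D ?V" and opW: "openin (top_of_set S) ?W"
    and diff: "\<phi> differentiable (at x0)"
    using lp x0 unfolding local_parametrization_def D_def by simp_all
  obtain \<psi> where hom: "homeomorphism (U \<inter> ?V) ?W \<phi> \<psi>"
    using lp unfolding local_parametrization_def by blast
  have der: "(\<phi> has_derivative D) (at x0)"
    using diff unfolding D_def by (simp add: frechet_derivative_works[symmetric])
  show lin: "linear D" by (rule has_derivative_linear[OF der])
  show "inj_on D ?V" by (rule inj)
  show "tangent_space S (\<phi> x0) = D ` ?V"
  proof
    show "D ` ?V \<subseteq> tangent_space S (\<phi> x0)"
    proof
      fix v assume "v \<in> D ` ?V"
      then obtain w where w: "w \<in> ?V" "v = D w" by blast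
      define \<gamma> where "\<gamma> t = \<phi> (x0 + t *\<^sub>R w)" for t :: real
      have "open ((\<lambda>t. x0 + t *\<^sub>R w) -` U)"
        by (rule open_vimage[OF U]) (intro continuous_intros)
      moreover have "0 \<in> (\<lambda>t::real. x0 + t *\<^sub>R w) -` U" using x0 by simp
      ultimately obtain \<epsilon> where \<epsilon>: "0 < \<epsilon>" "ball 0 \<epsilon> \<subseteq> (\<lambda>t. x0 + t *\<^sub>R w) -` U" by (meson openE)
      have "\<gamma> t \<in> S" if "t \<in> {-\<epsilon><..<\<epsilon>}" for t
      proof -
        have "x0 + t *\<^sub>R w \<in> U" using \<epsilon>(2) that by (auto simp: subset_iff dist_real_def)
        moreover have "x0 + t *\<^sub>R w \<in> ?V" using x0(2) w(1) by (intro span_add span_scale)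
        ultimately have "\<gamma> t \<in> ?W" unfolding \<gamma>_def by blast
        then show ?thesis using openin_imp_subset[OF opW] by blast
      qed
      moreover have "(\<gamma> has_vector_derivative v) (at 0)"
      proof -
        have "((\<lambda>t::real. x0 + t *\<^sub>R w) has_derivative (\<lambda>t. t *\<^sub>R w)) (at 0)"
          by (auto intro!: derivative_eq_intros)
        moreover have "(\<phi> has_derivative D) (at (x0 + 0 *\<^sub>R w))" using der by simp
        ultimately have "(\<phi> \<circ> (\<lambda>t::real. x0 + t *\<^sub>R w) has_derivative D \<circ> (\<lambda>t. t *\<^sub>R w)) (at 0)"
          by (rule diff_chain_at)
        moreover have "D \<circ> (\<lambda>t. t *\<^sub>R w) = (\<lambda>t. t *\<^sub>R v)"
          by (simp add: fun_eq_iff linear_scale[OF lin] w(2))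
        ultimately show ?thesis by (simp add: has_vector_derivative_def \<gamma>_def[abs_def] o_def)
      qed
      moreover have "\<gamma> 0 = \<phi> x0" by (simp add: \<gamma>_def)
      ultimately show "v \<in> tangent_space S (\<phi> x0)"
        unfolding tangent_space_def using \<epsilon>(1) by blast
    qed
    show "tangent_space S (\<phi> x0) \<subseteq> D ` ?V"
    proof
      fix v assume "v \<in> tangent_space S (\<phi> x0)"
      then have "\<exists>\<gamma> \<epsilon>. 0 < \<epsilon> \<and> (\<forall>t\<in>{-\<epsilon><..<\<epsilon>}. \<gamma> t \<in> S) \<and> \<gamma> 0 = \<phi> x0 \<and>
           (\<gamma> has_vector_derivative v) (at (0::real))" unfolding tangent_space_def by simp
      then obtain \<gamma> \<epsilon> where \<gamma>: "0 < \<epsilon>" "\<forall>t\<in>{-\<epsilon><..<\<epsilon>}. \<gamma> t \<in> S" "\<gamma> 0 = \<phi> x0"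
        "(\<gamma> has_vector_derivative v) (at (0::real))" by (elim exE conjE) (rule that)
      have D_zero: "\<forall>x\<in>?V. D x = 0 \<longrightarrow> x = 0"
        using inj linear_injective_on_subspace_0[OF lin subspace_span] by blast
      have "\<exists>c>0. \<forall>x\<in>?V. norm (D x) \<ge> c * norm x"
        by (rule injective_imp_isometric[OF closed_span subspace_span _ D_zero])
          (use lin in \<open>simp add: linear_conv_bounded_linear\<close>)
      then obtain c where c: "0 < c" "\<forall>x\<in>?V. norm (D x) \<ge> c * norm x" by (elim exE conjE) (rule that)
      have "subspace (D ` ?V)" by (intro linear_subspace_image lin subspace_span)
      then have closed: "closed (D ` ?V)" by (rule closed_subspace)
      \<comment> \<open>A subspace is closed, so it suffices to approximate \<open>v\<close> by
        vectors of the image.\<close>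
      have "\<exists>y\<in>D ` ?V. dist y v < e" if e: "0 < e" for e
      proof -
        define e1 where "e1 = min 1 (e / 4)"
        \<comment> \<open>The first bound lets the remainder of \<phi> be absorbed by the lower
          bound \<open>c\<close> for the differential, giving (c/2) \<bar>u - x0\<bar> \<le> t
          (\<bar>v\<bar> + 1). With this, the second one makes the remainder at most (e/4)
          t.\<close>
        define \<eta> where "\<eta> = min (c / 2) (e * c / (8 * (norm v + 1)))"
        have nv: "0 < norm v + 1" by (rule add_nonneg_pos) auto
        have e1: "0 < e1" "e1 \<le> 1" "e1 \<le> e / 4" using e by (auto simp: e1_def)
        have \<eta>_pos: "0 < \<eta>" unfolding \<eta>_def using e c(1) nv by simp
        have \<eta>_le: "\<eta> \<le> c / 2" "\<eta> \<le> e * c / (8 * (norm v + 1))"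
          unfolding \<eta>_def by (rule min.cobounded1) (rule min.cobounded2)
        note \<eta> = \<eta>_pos \<eta>_le
        have "\<exists>d>0. \<forall>y. norm (y - x0) < d \<longrightarrow> norm (\<phi> y - \<phi> x0 - D (y - x0)) \<le> \<eta> * norm (y - x0)"
          by (rule conjunct2[OF iffD1[OF has_derivative_at_alt der], rule_format, OF \<eta>(1)])
        then obtain d1 where d1: "0 < d1"
          "\<forall>y. norm (y - x0) < d1 \<longrightarrow> norm (\<phi> y - \<phi> x0 - D (y - x0)) \<le> \<eta> * norm (y - x0)"
          by (elim exE conjE) (rule that)
        have "\<exists>d>0. \<forall>t. norm (t - 0) < d \<longrightarrow> norm (\<gamma> t - \<gamma> 0 - (t - 0) *\<^sub>R v) \<le> e1 * norm (t - 0)"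
          by (rule conjunct2[OF iffD1[OF has_derivative_at_alt \<gamma>(4)[unfolded has_vector_derivative_def]],
                rule_format, OF e1(1)])
        then obtain d2 where d2: "0 < d2"
          "\<forall>t. norm (t - 0) < d2 \<longrightarrow> norm (\<gamma> t - \<gamma> 0 - (t - 0) *\<^sub>R v) \<le> e1 * norm (t - 0)"
          by (elim exE conjE) (rule that)
        obtain G where G: "open G" "?W = S \<inter> G" using opW unfolding openin_open by (elim exE conjE) (rule that)
        have p: "\<phi> x0 \<in> ?W" using x0 by blast
        then obtain d3 where d3: "0 < d3" "ball (\<phi> x0) d3 \<subseteq> G" using G(1) unfolding G(2) by (metis IntE openE)
        have "continuous_on ?W \<psi>" using hom by (simp add: homeomorphism_def)
        then obtain d4 where d4: "0 < d4" "\<forall>q\<in>?W. dist q (\<phi> x0) < d4 \<longrightarrow> dist (\<psi> q) (\<psi> (\<phi> x0)) < d1"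
          using iffD1[OF continuous_on_iff, rule_format, OF _ p d1(1)] by (metis (no_types, lifting))
        \<comment> \<open>The time \<open>t\<close> must satisfy four bounds: the curve is defined,
          its expansion is accurate, its point lies in the image of \<phi>, and the lifted point is
          within \<open>d1\<close> of \<open>x0\<close>. The bounds \<open>a\<close> and
          \<open>b\<close> serve the last two.\<close>
        define a where "a = d3 / (norm v + 1)"
        define b where "b = d4 / (norm v + 1)"
        have ab: "0 < a" "0 < b" using d3(1) d4(1) nv by (simp_all add: a_def b_def)
        define m where "m = min (min \<epsilon> d2) (min a b)"
        have m: "0 < m" "m \<le> \<epsilon>" "m \<le> d2" "m \<le> a" "m \<le> b"
          using \<gamma>(1) d2(1) ab by (simp_all add: m_def)
        define t where "t = m / 2"
        have t: "0 < t" "t < \<epsilon>" "t < d2" "t < d3 / (norm v + 1)" "t < d4 / (norm v + 1)"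
          using m unfolding t_def a_def[symmetric] b_def[symmetric] by linarith+
        have tv: "norm (\<gamma> t - \<phi> x0 - t *\<^sub>R v) \<le> e1 * t"
          using d2(2)[rule_format, of t] t \<gamma>(3) by simp
        have "norm (\<gamma> t - \<phi> x0) \<le> norm (\<gamma> t - \<phi> x0 - t *\<^sub>R v) + norm (t *\<^sub>R v)"
          using norm_triangle_ineq[of "\<gamma> t - \<phi> x0 - t *\<^sub>R v" "t *\<^sub>R v"] by simp
        also have "\<dots> \<le> e1 * t + t * norm v" using tv t(1) by simp
        also have "\<dots> \<le> 1 * t + t * norm v" using e1(2) t(1) by (intro add_right_mono mult_right_mono) auto
        finally have \<gamma>t: "norm (\<gamma> t - \<phi> x0) \<le> t * (norm v + 1)" by (simp add: algebra_simps)
        have "t * (norm v + 1) < d3" "t * (norm v + 1) < d4"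
          using t(4,5) nv by (simp_all add: pos_less_divide_eq)
        then have near: "dist (\<gamma> t) (\<phi> x0) < d3" "dist (\<gamma> t) (\<phi> x0) < d4" using \<gamma>t by (auto simp: dist_norm)
        have "\<gamma> t \<in> S" using \<gamma>(2) t by simp
        moreover have "\<gamma> t \<in> G" using d3(2) near(1) by (auto simp: dist_commute)
        ultimately have W: "\<gamma> t \<in> ?W" unfolding G(2) by blast
        define u where "u = \<psi> (\<gamma> t)"
        have u: "u \<in> U \<inter> ?V" "\<phi> u = \<gamma> t"
          using W hom unfolding u_def homeomorphism_def by auto
        have "\<psi> (\<phi> x0) = x0" using hom x0 unfolding homeomorphism_def by auto
        then have "norm (u - x0) < d1" using d4(2)[rule_format, OF W near(2)] by (simp add: u_def dist_norm)
        then have r: "norm (\<gamma> t - \<phi> x0 - D (u - x0)) \<le> \<eta> * norm (u - x0)"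
          using d1(2)[rule_format, of u] u(2) by simp
        have h: "u - x0 \<in> ?V" using u(1) x0(2) by (intro span_diff) auto
        have "c * norm (u - x0) \<le> norm (D (u - x0))" using c(2) h by blast
        also have "\<dots> \<le> norm (\<gamma> t - \<phi> x0) + norm (\<gamma> t - \<phi> x0 - D (u - x0))"
          using norm_triangle_ineq4[of "\<gamma> t - \<phi> x0" "\<gamma> t - \<phi> x0 - D (u - x0)"] by simp
        also have "\<dots> \<le> norm (\<gamma> t - \<phi> x0) + c / 2 * norm (u - x0)"
          using r \<eta>(2) mult_right_mono[OF \<eta>(2) norm_ge_zero[of "u - x0"]] by linarith
        finally have hb: "c / 2 * norm (u - x0) \<le> t * (norm v + 1)" using \<gamma>t by linarith
        have "\<eta> * norm (u - x0) \<le> e * c / (8 * (norm v + 1)) * norm (u - x0)"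
          by (rule mult_right_mono[OF \<eta>(3)]) simp
        also have "\<dots> = e / (4 * (norm v + 1)) * (c / 2 * norm (u - x0))" by (simp add: field_simps)
        also have "\<dots> \<le> e / (4 * (norm v + 1)) * (t * (norm v + 1))"
          using e nv by (intro mult_left_mono[OF hb]) auto
        also have "\<dots> = e / 4 * t" using nv by (simp add: field_simps)
        finally have rb: "norm (\<gamma> t - \<phi> x0 - D (u - x0)) \<le> e / 4 * t" using r by linarith
        have "norm (D (u - x0) - t *\<^sub>R v) \<le> norm (\<gamma> t - \<phi> x0 - t *\<^sub>R v) + norm (\<gamma> t - \<phi> x0 - D (u - x0))"
          using norm_triangle_ineq4[of "\<gamma> t - \<phi> x0 - t *\<^sub>R v" "\<gamma> t - \<phi> x0 - D (u - x0)"] by simp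
        also have "\<dots> \<le> e1 * t + e / 4 * t" using tv rb by linarith
        also have "\<dots> \<le> e / 2 * t"
        proof -
          have "e1 * t \<le> e / 4 * t" by (rule mult_right_mono[OF e1(3)]) (use t(1) in simp)
          then show ?thesis by linarith
        qed
        finally have dt: "norm (D (u - x0) - t *\<^sub>R v) \<le> e / 2 * t" .
        define y where "y = D ((1 / t) *\<^sub>R (u - x0))"
        have "y \<in> D ` ?V" unfolding y_def by (intro imageI span_scale h)
        moreover have "dist y v < e"
        proof -
          have "y = (1 / t) *\<^sub>R D (u - x0)" unfolding y_def by (rule linear_scale[OF lin])
          then have "y - v = (1 / t) *\<^sub>R (D (u - x0) - t *\<^sub>R v)"
            using t(1) by (simp add: scaleR_diff_right)
          then have "dist y v = norm ((1 / t) *\<^sub>R (D (u - x0) - t *\<^sub>R v))" by (simp only: dist_norm)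
          also have "\<dots> = norm (D (u - x0) - t *\<^sub>R v) / t" using t(1) by (simp only: norm_scaleR) simp
          also have "\<dots> \<le> e / 2" using dt t(1) by (simp add: pos_divide_le_eq)
          finally show ?thesis using e by simp
        qed
        ultimately show ?thesis by blast
      qed
      then show "v \<in> D ` ?V" using closed_approachable[OF closed, of v] by simp
    qed
  qed
qed

lemma tangent_space_submanifold:
  assumes "C1_submanifold n S" "p \<in> S"
  shows "subspace (tangent_space S p)" and "dim (tangent_space S p) = n"
proof -
  have "\<exists>ls U \<phi>. local_parametrization n S ls U \<phi> \<and> p \<in> \<phi> ` (U \<inter> span (set ls))"
    using assms unfolding C1_submanifold_def by blast
  then obtain ls U \<phi> where lp: "local_parametrization n S ls U \<phi>" and "p \<in> \<phi> ` (U \<inter> span (set ls))"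
    by (elim exE conjE) (rule that)
  then obtain x0 where x0: "p = \<phi> x0" "x0 \<in> U" "x0 \<in> span (set ls)" by blast
  note T = tangent_space_parametrization[OF lp x0(2,3), folded x0(1)]
  show "subspace (tangent_space S p)"
    unfolding T(1) by (intro linear_subspace_image T(2) subspace_span)
  have "inj_on (frechet_derivative \<phi> (at x0)) (span (span (set ls)))" using T(3) by (simp add: span_span)
  then have "dim (tangent_space S p) = dim (span (set ls))"
    unfolding T(1) by (rule dim_image_eq[OF T(2)])
  also have "\<dots> = n"
    using lp orthonormal_list_dim[of ls] unfolding local_parametrization_def by simp
  finally show "dim (tangent_space S p) = n" .
qed

section \<open>Frames of the tangent space\<close>

text \<open>Gram-Schmidt for a scalar product other than the one of the type, as given by a
  Riemannian metric at a point.\<close>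

lemma orthonormal_frame_exists:
  fixes T :: "'a::euclidean_space set" and g :: "'a \<Rightarrow> 'a \<Rightarrow> real"
  assumes T: "subspace T" and bil: "bilinear g" and sym: "\<And>v w. g v w = g w v"
    and pos: "\<And>v. v \<noteq> 0 \<Longrightarrow> 0 < g v v"
  obtains ts where "distinct ts" "independent (set ts)" "span (set ts) = T"
    "\<And>i j. i < length ts \<Longrightarrow> j < length ts \<Longrightarrow> g (ts ! i) (ts ! j) = (if i = j then 1 else 0)"
proof -
  let ?on = "\<lambda>ts. \<forall>i<length ts. \<forall>j<length ts. g (ts ! i) (ts ! j) = (if i = j then 1 else 0)"
  have lin: "linear (\<lambda>v. g v w)" for w using bil by (simp add: bilinear_def)
  have ex: "\<exists>ts. length ts = k \<and> set ts \<subseteq> T \<and> ?on ts" if "k \<le> dim T" for k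
    using that
  proof (induction k)
    case 0 then show ?case by simp
  next
    case (Suc k)
    then obtain ts where ts: "length ts = k" "set ts \<subseteq> T" "?on ts" by auto
    have "dim (span (set ts)) \<le> k" using dim_le_card'[of "set ts"] card_length[of ts] ts(1) by simp
    then have "\<not> T \<subseteq> span (set ts)" using Suc.prems dim_subset[of T "span (set ts)"] by auto
    then obtain w where w: "w \<in> T" "w \<notin> span (set ts)" by blast
    define w' where "w' = w - (\<Sum>i<k. g w (ts ! i) *\<^sub>R (ts ! i))"
    have tsT: "ts ! i \<in> T" "ts ! i \<in> set ts" if "i < k" for i using that ts by auto
    have "(\<Sum>i<k. g w (ts ! i) *\<^sub>R (ts ! i)) \<in> span (set ts)"
      using tsT by (intro span_sum span_scale span_base) auto
    then have "w' \<noteq> 0" using w(2) by (auto simp: w'_def)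
    have "w' \<in> T" unfolding w'_def using tsT w(1) T by (intro subspace_diff subspace_sum subspace_scale) auto
    have orth: "g w' (ts ! j) = 0" if j: "j < k" for j
    proof -
      have "g w' (ts ! j) = g w (ts ! j) - (\<Sum>i<k. g w (ts ! i) * g (ts ! i) (ts ! j))"
        unfolding w'_def by (simp add: linear_diff[OF lin] linear_sum[OF lin] linear_scale[OF lin])
      also have "(\<Sum>i<k. g w (ts ! i) * g (ts ! i) (ts ! j)) = (\<Sum>i<k. if i = j then g w (ts ! j) else 0)"
        using ts(1,3) j by (intro sum.cong) auto
      finally show ?thesis using j by simp
    qed
    define u where "u = (1 / sqrt (g w' w')) *\<^sub>R w'"
    have gw: "0 < g w' w'" by (rule pos) fact
    have scale: "g (a *\<^sub>R x) y = a * g x y" "g x (a *\<^sub>R y) = a * g x y" for a x y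
      using linear_scale[OF lin, of a x y] linear_scale[OF lin, of a y x] sym by simp_all
    have uu: "g u u = 1"
      unfolding u_def scale using gw by simp
    have ut: "g u (ts ! j) = 0" "g (ts ! j) u = 0" if "j < k" for j
      using orth[OF that] sym[of "ts ! j" u] by (simp_all add: u_def scale)
    have "?on (ts @ [u])"
      using ts(1,3) uu ut by (auto simp: nth_append less_Suc_eq)
    moreover have "set (ts @ [u]) \<subseteq> T"
      using ts(2) \<open>w' \<in> T\<close> subspace_scale[OF T] by (auto simp: u_def)
    ultimately show ?case using ts(1) by (intro exI[of _ "ts @ [u]"]) simp
  qed
  obtain ts where ts: "length ts = dim T" "set ts \<subseteq> T" "?on ts" using ex[of "dim T"] by auto
  have dist: "distinct ts"
    unfolding distinct_conv_nth using ts(3) by (metis zero_neq_one)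
  have ind: "independent (set ts)"
  proof (rule independent_if_scalars_zero)
    fix f x assume sum0: "(\<Sum>v\<in>set ts. f v *\<^sub>R v) = 0" and x: "x \<in> set ts"
    have "0 = g (\<Sum>v\<in>set ts. f v *\<^sub>R v) x" unfolding sum0 by (simp add: linear_0[OF lin])
    also have "\<dots> = (\<Sum>v\<in>set ts. f v * g v x)" by (simp add: linear_sum[OF lin] linear_scale[OF lin])
    also have "\<dots> = (\<Sum>v\<in>set ts. if v = x then f x else 0)"
    proof (rule sum.cong)
      fix v assume "v \<in> set ts"
      then obtain i j where "i < length ts" "v = ts ! i" "j < length ts" "x = ts ! j"
        using x by (auto simp: in_set_conv_nth)
      then show "f v * g v x = (if v = x then f x else 0)"
        using ts(3) dist by (auto simp: nth_eq_iff_index_eq)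
    qed simp
    also have "\<dots> = f x" using x by simp
    finally show "f x = 0" by simp
  qed simp
  have "T \<subseteq> span (set ts)"
    using card_ge_dim_independent[OF ts(2) ind] ts(1) distinct_card[OF dist] by simp
  moreover have "span (set ts) \<subseteq> T" using ts(2) T by (rule span_minimal)
  ultimately have span: "span (set ts) = T" by simp
  show ?thesis
  proof (rule that[OF dist ind span])
    fix i j assume "i < length ts" "j < length ts"
    then show "g (ts ! i) (ts ! j) = (if i = j then 1 else 0)" using ts(3) by simp
  qed
qed

lemma tangent_frame_length:
  assumes "C1_submanifold n S" "p \<in> S" "tangent_frame S p ts"
  shows "length ts = n"
proof -
  have ts: "distinct ts" "independent (set ts)" "span (set ts) = tangent_space S p"
    using assms(3) unfolding tangent_frame_def by simp_all
  have "length ts = dim (set ts)"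
    using dim_eq_card_independent[OF ts(2)] distinct_card[OF ts(1)] by simp
  also have "\<dots> = dim (tangent_space S p)" unfolding ts(3)[symmetric] by simp
  also have "\<dots> = n" by (rule tangent_space_submanifold(2)[OF assms(1,2)])
  finally show ?thesis .
qed

text \<open>Ensures that the choice in \<open>unit_tangent_mv\<close> really picks a frame of the
  tangent space.\<close>

lemma unit_tangent_frame_exists:
  assumes S: "C1_submanifold n S" "p \<in> S" and gt: "riemannian_metric gt"
  shows "\<exists>ts. tangent_frame S p ts \<and> sqrt (gram_det (gt p) ts ts) = 1"
proof -
  have g: "bilinear (gt p)" "\<And>v w. gt p v w = gt p w v" "\<And>v. v \<noteq> 0 \<Longrightarrow> 0 < gt p v v"
    using gt unfolding riemannian_metric_def by blast+
  obtain ts where ts: "distinct ts" "independent (set ts)" "span (set ts) = tangent_space S p"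
    "\<And>i j. i < length ts \<Longrightarrow> j < length ts \<Longrightarrow> gt p (ts ! i) (ts ! j) = (if i = j then 1 else 0)"
  proof (rule orthonormal_frame_exists[OF tangent_space_submanifold(1)[OF S] g(1,2)])
    show "0 < gt p v v" if "v \<noteq> 0" for v using that by (rule g(3))
  qed (rule that)
  have "Matrix.mat (length ts) (length ts) (\<lambda>(i, j). gt p (ts ! i) (ts ! j)) = 1\<^sub>m (length ts)"
    using ts(4) by (intro eq_matI) auto
  then have "gram_det (gt p) ts ts = 1" by (simp add: gram_det_def)
  then show ?thesis using ts(1-3) unfolding tangent_frame_def by (intro exI[of _ ts]) simp
qed

section \<open>The intrinsic measure\<close>

text \<open>For arbitrary functions this half of additivity survives: simple functions below
  \<open>u\<close> and below \<open>w\<close> add up to one below the sum.\<close>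

lemma nn_integral_superadditive:
  fixes u w :: "'a \<Rightarrow> ennreal"
  shows "(\<integral>\<^sup>+x. u x \<partial>M) + (\<integral>\<^sup>+x. w x \<partial>M) \<le> (\<integral>\<^sup>+x. u x + w x \<partial>M)"
proof -
  let ?S = "\<lambda>f. {g. simple_function M g \<and> g \<le> f}"
  have ne: "?S f \<noteq> {}" for f :: "'a \<Rightarrow> ennreal" by (auto intro!: exI[of _ "\<lambda>_. 0"] simp: le_fun_def)
  have pair: "integral\<^sup>S M g + integral\<^sup>S M h \<le> (\<integral>\<^sup>+x. u x + w x \<partial>M)"
    if g: "simple_function M g" "g \<le> u" and h: "simple_function M h" "h \<le> w" for g h
  proof -
    have "integral\<^sup>S M g + integral\<^sup>S M h = integral\<^sup>S M (\<lambda>x. g x + h x)"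
      by (rule simple_integral_add[symmetric]) (use g h in auto)
    also have "\<dots> \<le> (\<integral>\<^sup>+x. u x + w x \<partial>M)"
      unfolding nn_integral_def
      using g h by (intro SUP_upper) (auto simp: le_fun_def intro: add_mono)
    finally show ?thesis .
  qed
  have "(\<integral>\<^sup>+x. u x \<partial>M) + (\<integral>\<^sup>+x. w x \<partial>M)
      = (SUP g\<in>?S u. integral\<^sup>S M g + (SUP h\<in>?S w. integral\<^sup>S M h))"
    unfolding nn_integral_def by (rule ennreal_SUP_add_left[OF ne, symmetric])
  also have "\<dots> = (SUP g\<in>?S u. SUP h\<in>?S w. integral\<^sup>S M g + integral\<^sup>S M h)"
    by (intro SUP_cong refl ennreal_SUP_add_right ne)
  also have "\<dots> \<le> (\<integral>\<^sup>+x. u x + w x \<partial>M)"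
    by (intro SUP_least pair) auto
  finally show ?thesis .
qed

text \<open>Integration of a possibly non-measurable function is a lower integral in Isabelle; as a
  function of the domain of integration it is still a measure.\<close>

lemma measure_space_lower_integral:
  fixes f :: "'a \<Rightarrow> ennreal"
  shows "measure_space (space M) (sets M) (\<lambda>A. \<integral>\<^sup>+x. f x * indicator A x \<partial>M)"
  unfolding measure_space_def
proof (intro conjI)
  show "sigma_algebra (space M) (sets M)" by (rule sets.sigma_algebra_axioms)
  show "positive (sets M) (\<lambda>A. \<integral>\<^sup>+x. f x * indicator A x \<partial>M)" by (simp add: positive_def)
  show "countably_additive (sets M) (\<lambda>A. \<integral>\<^sup>+x. f x * indicator A x \<partial>M)"
  proof (rule countably_additiveI)
    fix A :: "nat \<Rightarrow> 'a set"
    assume A: "range A \<subseteq> sets M" "disjoint_family A"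
    let ?I = "\<lambda>A. \<integral>\<^sup>+x. f x * indicator A x \<partial>M"
    have fin: "(\<Sum>i<n. ?I (A i)) \<le> ?I (\<Union>i<n. A i)" for n
    proof (induction n)
      case (Suc n)
      have "(\<Sum>i<Suc n. ?I (A i)) \<le> ?I (\<Union>i<n. A i) + ?I (A n)" using Suc by (simp add: add_right_mono)
      also have "\<dots> \<le> (\<integral>\<^sup>+x. f x * indicator (\<Union>i<n. A i) x + f x * indicator (A n) x \<partial>M)"
        by (rule nn_integral_superadditive)
      also have "\<dots> \<le> ?I (\<Union>i<Suc n. A i)"
      proof (intro nn_integral_mono)
        fix x
        have "A i \<inter> A n = {}" if i: "i < n" for i
          using A(2) i unfolding disjoint_family_on_def by simp
        then show "f x * indicator (\<Union>i<n. A i) x + f x * indicator (A n) x \<le> f x * indicator (\<Union>i<Suc n. A i) x"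
          by (auto simp: indicator_def lessThan_Suc)
      qed
      finally show ?case .
    qed simp
    show "(\<Sum>i. ?I (A i)) = ?I (\<Union>i. A i)"
    proof (rule antisym)
      have "(\<Sum>i<n. ?I (A i)) \<le> ?I (\<Union>i. A i)" for n
      proof -
        have "?I (\<Union>i<n. A i) \<le> ?I (\<Union>i. A i)"
          by (intro nn_integral_mono mult_left_mono) (auto simp: indicator_def)
        then show ?thesis using fin[of n] by (rule order_trans[rotated])
      qed
      then show "(\<Sum>i. ?I (A i)) \<le> ?I (\<Union>i. A i)" by (intro suminf_le_const) simp_all
      \<comment> \<open>A simple function below the integrand is measurable and vanishes off the
        union, so its own integral splits over the sets \<open>A i\<close>.\<close>
      show "?I (\<Union>i. A i) \<le> (\<Sum>i. ?I (A i))"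
        unfolding nn_integral_def[of M "\<lambda>x. f x * indicator (\<Union>i. A i) x"]
      proof (rule SUP_least)
        fix g assume "g \<in> {g. simple_function M g \<and> g \<le> (\<lambda>x. f x * indicator (\<Union>i. A i) x)}"
        then have g: "simple_function M g" "\<And>x. g x \<le> f x * indicator (\<Union>i. A i) x" by (auto simp: le_fun_def)
        have gm: "g \<in> borel_measurable M" using g(1) by (rule borel_measurable_simple_function)
        have "integral\<^sup>S M g = (\<integral>\<^sup>+x. g x \<partial>M)" by (rule nn_integral_eq_simple_integral[OF g(1), symmetric])
        also have "\<dots> = (\<integral>\<^sup>+x. (\<Sum>i. g x * indicator (A i) x) \<partial>M)"
        proof (rule nn_integral_cong)
          fix x
          have "(\<Sum>i. g x * indicator (A i) x) = g x * (\<Sum>i. indicator (A i) x)" by simp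
          also have "(\<Sum>i. indicator (A i) x :: ennreal) = indicator (\<Union>i. A i) x"
            by (rule suminf_indicator[OF A(2)])
          also have "g x * indicator (\<Union>i. A i) x = g x"
            using g(2)[of x] by (cases "x \<in> (\<Union>i. A i)") auto
          finally show "g x = (\<Sum>i. g x * indicator (A i) x)" ..
        qed
        also have "\<dots> = (\<Sum>i. \<integral>\<^sup>+x. g x * indicator (A i) x \<partial>M)"
          using A(1) gm by (intro nn_integral_suminf borel_measurable_times_ennreal borel_measurable_indicator) auto
        also have "\<dots> \<le> (\<Sum>i. ?I (A i))"
        proof (rule suminf_le)
          fix i
          show "(\<integral>\<^sup>+x. g x * indicator (A i) x \<partial>M) \<le> ?I (A i)"
          proof (rule nn_integral_mono)
            fix x
            have "g x \<le> f x" using g(2)[of x] by (cases "x \<in> (\<Union>i. A i)") auto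
            then show "g x * indicator (A i) x \<le> f x * indicator (A i) x" by (rule mult_right_mono) simp
          qed
        qed simp_all
        finally show "integral\<^sup>S M g \<le> (\<Sum>i. ?I (A i))" .
      qed
    qed
  qed
qed

lemma sets_surface_measure [simp]: "sets (surface_measure gt n S) = sets (borel :: 'a::euclidean_space measure)"
  using sets.sigma_sets_eq[of "borel :: 'a measure"] by (simp add: surface_measure_def)

lemma sets_intrinsic_measure [simp]:
  "sets (intrinsic_measure H mul es gt n N S) = sets (borel :: 'a::euclidean_space measure)"
  using sets.sigma_sets_eq[of "borel :: 'a measure"] by (simp add: intrinsic_measure_def)

text \<open>\<open>measure_of\<close> returns the prescribed values only for a measure; the lower
  integral is one, whether or not the intrinsic density is measurable.\<close>

lemma emeasure_intrinsic_measure: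
  fixes B :: "'a::euclidean_space set"
  assumes B: "B \<in> sets borel"
  shows "emeasure (intrinsic_measure H mul es gt n N S) B
    = (\<integral>\<^sup>+p\<in>B \<inter> S. ennreal (intrinsic_density H mul es gt n N S p) \<partial>surface_measure gt n S)"
proof -
  let ?\<mu> = "\<lambda>B. \<integral>\<^sup>+p\<in>B \<inter> S. ennreal (intrinsic_density H mul es gt n N S p) \<partial>surface_measure gt n S"
  let ?f = "\<lambda>p. ennreal (intrinsic_density H mul es gt n N S p) * indicator S p"
  have space: "space (surface_measure gt n S) = (UNIV :: 'a set)"
    using sets_eq_imp_space_eq[OF sets_surface_measure, of gt n S] by simp
  have "?\<mu> = (\<lambda>B. \<integral>\<^sup>+p. ?f p * indicator B p \<partial>surface_measure gt n S)"
    by (intro ext nn_integral_cong) (auto simp: indicator_def)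
  then have ms: "measure_space UNIV (sets borel) ?\<mu>"
    using measure_space_lower_integral[of "surface_measure gt n S" ?f] by (simp only: space sets_surface_measure)
  show ?thesis unfolding intrinsic_measure_def
    by (rule emeasure_measure_of_sigma)
      (use ms B in \<open>auto simp: measure_space_def\<close>)
qed

section \<open>Null sets of the spherical measure\<close>

context diameter_metric begin

text \<open>A Borel hull: the intersection over \<open>k\<close> of the unions of covers whose total
  gauge is below 1/(k+1). It permits almost-everywhere arguments for a set that is negligible only
  as a null set of the outer measure.\<close>

lemma spherical_null_borel:
  assumes "spherical_measure d N A = 0"
  obtains Z where "Z \<in> sets borel" "A \<subseteq> Z" "spherical_measure d N Z = 0"
proof -
  let ?c = "cover_content (closed_balls d) (dist_diameter d) (\<lambda>C. (dist_diameter d C / 2) ^ N)"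
  have "\<forall>k. \<exists>\<C>. countable \<C> \<and> \<C> \<subseteq> closed_balls d \<and> A \<subseteq> \<Union>\<C> \<and> (\<forall>C\<in>\<C>. dist_diameter d C \<le> 1 / real (Suc k)) \<and>
      (\<Sum>\<^sub>\<infinity>C\<in>\<C>. ennreal ((dist_diameter d C / 2) ^ N)) < ennreal (1 / real (Suc k))"
  proof
    fix k
    have "?c (1 / real (Suc k)) A \<le> spherical_measure d N A"
      unfolding spherical_measure_def by (rule cover_content_le_caratheodory) simp
    also have "\<dots> < ennreal (1 / real (Suc k))" using assms by (simp del: of_nat_Suc)
    finally have lt: "?c (1 / real (Suc k)) A < ennreal (1 / real (Suc k))" .
    show "\<exists>\<C>. countable \<C> \<and> \<C> \<subseteq> closed_balls d \<and> A \<subseteq> \<Union>\<C> \<and> (\<forall>C\<in>\<C>. dist_diameter d C \<le> 1 / real (Suc k)) \<and>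
      (\<Sum>\<^sub>\<infinity>C\<in>\<C>. ennreal ((dist_diameter d C / 2) ^ N)) < ennreal (1 / real (Suc k))"
      by (rule cover_content_lessE[OF lt]) (intro exI conjI ballI, assumption+)
  qed
  from choice[OF this] obtain \<C> where \<C>: "\<forall>k. countable (\<C> k) \<and> \<C> k \<subseteq> closed_balls d \<and> A \<subseteq> \<Union>(\<C> k)
      \<and> (\<forall>C\<in>\<C> k. dist_diameter d C \<le> 1 / real (Suc k))
      \<and> (\<Sum>\<^sub>\<infinity>C\<in>\<C> k. ennreal ((dist_diameter d C / 2) ^ N)) < ennreal (1 / real (Suc k))" ..
  define Z where "Z = (\<Inter>k. \<Union>(\<C> k))"
  have "\<Union>(\<C> k) \<in> sets borel" for k
  proof (rule sets.countable_Union)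
    show "countable (\<C> k)" using \<C> by simp
    have "\<C> k \<subseteq> closed_balls d" using \<C> by simp
    then show "\<C> k \<subseteq> sets borel" using closed_ball_borel by (auto dest: subsetD)
  qed
  then have Z: "Z \<in> sets borel" unfolding Z_def by (intro sets.countable_INT) auto
  have small: "?c (1 / real (Suc k)) Z \<le> ennreal (1 / real (Suc k))" for k
  proof -
    have "?c (1 / real (Suc k)) Z \<le> (\<Sum>\<^sub>\<infinity>C\<in>\<C> k. ennreal ((dist_diameter d C / 2) ^ N))"
      by (rule cover_content_leI) (use \<C> in \<open>auto simp: Z_def simp del: of_nat_Suc\<close>)
    then show ?thesis using \<C> by (meson less_imp_le order_trans)
  qed
  have "?c \<delta> Z \<le> 0" if \<delta>: "0 < \<delta>" for \<delta>
  proof (rule ennreal_le_epsilon)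
    fix e :: real assume e: "0 < e"
    obtain k where k: "1 / real (Suc k) < min \<delta> e" using nat_approx_posE[of "min \<delta> e"] \<delta> e by auto
    have "?c \<delta> Z \<le> ?c (1 / real (Suc k)) Z" using k by (intro cover_content_antimono) simp
    also have "\<dots> \<le> ennreal (1 / real (Suc k))" by (rule small)
    also have "\<dots> \<le> ennreal e" using k by (intro ennreal_leI) simp
    finally show "?c \<delta> Z \<le> 0 + ennreal e" by simp
  qed
  then have "spherical_measure d N Z \<le> 0"
    unfolding spherical_measure_def caratheodory_construction_eq by (intro SUP_least) simp
  moreover have "A \<subseteq> Z" using \<C> by (auto simp: Z_def)
  ultimately show ?thesis using Z by (intro that[of Z]) simp_all
qed

text \<open>Where the density is infinite, \<open>\<nu>\<close> is controlled by the hypothesis and not by its density.\<close>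

lemma null_of_spherical_null:
  assumes \<nu>: "sets \<nu> = sets borel" and Z: "Z \<in> sets borel" "spherical_measure d N Z = 0"
    and inf: "emeasure \<nu> (Z \<inter> {x. federer_density d N \<nu> x = \<infinity>}) = 0"
  shows "emeasure \<nu> Z = 0"
proof -
  let ?\<theta> = "federer_density d N \<nu>"
  have \<theta>: "?\<theta> \<in> borel_measurable borel" by (rule federer_density_measurable[OF \<nu>])
  define Y where "Y k = Z \<inter> {x \<in> space borel. ?\<theta> x < ennreal (real (Suc k))}" for k
  have Y: "Y k \<in> sets borel" for k
    unfolding Y_def by (intro sets.Int Z(1) borel_measurable_less \<theta> borel_measurable_const)
  have null: "emeasure \<nu> (Y k) = 0" for k
  proof -
    have "emeasure \<nu> (Y k) \<le> ennreal (real (Suc k)) * emeasure (spherical_borel d N) (Y k)"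
      by (rule emeasure_le_of_density_less[OF \<nu> Y]) (auto simp: Y_def)
    also have "emeasure (spherical_borel d N) (Y k) \<le> emeasure (spherical_borel d N) Z"
      using Z(1) by (intro emeasure_mono) (auto simp: Y_def)
    also have "emeasure (spherical_borel d N) Z = 0" using Z by (simp add: emeasure_spherical_borel)
    finally show ?thesis by (simp add: mult_left_mono)
  qed
  have "{x \<in> space borel. ?\<theta> x = \<infinity>} \<in> sets borel"
    by (intro borel_measurable_eq \<theta> borel_measurable_const)
  then have inf_sets: "Z \<inter> {x. ?\<theta> x = \<infinity>} \<in> sets \<nu>" using Z(1) \<nu> by auto
  have "Z \<subseteq> (\<Union>k. Y k) \<union> (Z \<inter> {x. ?\<theta> x = \<infinity>})"
  proof
    fix x assume x: "x \<in> Z"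
    show "x \<in> (\<Union>k. Y k) \<union> (Z \<inter> {x. ?\<theta> x = \<infinity>})"
    proof (cases "?\<theta> x")
      case (real t)
      obtain k where "t < real k" using reals_Archimedean2 by blast
      then have "ennreal t < ennreal (real (Suc k))" using real(1) by (intro ennreal_lessI) simp_all
      then have "x \<in> Y k" using x real(2) by (simp add: Y_def del: of_nat_Suc)
      then show ?thesis by blast
    next
      case top then show ?thesis using x by simp
    qed
  qed
  then have "emeasure \<nu> Z \<le> emeasure \<nu> ((\<Union>k. Y k) \<union> (Z \<inter> {x. ?\<theta> x = \<infinity>}))"
    using Y \<nu> inf_sets by (intro emeasure_mono) auto
  also have "\<dots> \<le> emeasure \<nu> (\<Union>k. Y k) + emeasure \<nu> (Z \<inter> {x. ?\<theta> x = \<infinity>})"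
    using Y \<nu> inf_sets by (intro emeasure_subadditive) auto
  also have "emeasure \<nu> (\<Union>k. Y k) = 0"
    using Y \<nu> null by (intro emeasure_UN_eq_0) auto
  finally show ?thesis using inf by simp
qed

end

section \<open>Degree and intrinsic density at a point\<close>

context graded_basis begin

text \<open>The degree, the homogeneous tangent space and the intrinsic density at a point are read off the
  graded parts of a tangent frame translated to \<open>0\<close>.\<close>

lemma tangent_frame_translated:
  assumes S: "C1_submanifold n S" "p \<in> S" and gt: "riemannian_metric gt"
  obtains ts where "length ts = n" "distinct ts" "independent (set ts)"
    "\<And>M. degree_proj H mul es n p M (tangent_mv S p) = (\<lambda>_. 0) \<longleftrightarrow> graded_part n ts M = (\<lambda>_. 0)"
    "\<And>N. homogeneous_tangent_space H mul es n N S p = {v. wedge v (graded_part n ts N) = (\<lambda>_. 0)}"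
    "\<And>N. graded_part n ts N = (\<lambda>_. 0) \<Longrightarrow> intrinsic_density H mul es gt n N S p = 0"
proof -
  let ?ts = "SOME ts. tangent_frame S p ts"
  let ?us = "SOME ts. tangent_frame S p ts \<and> sqrt (gram_det (gt p) ts ts) = 1"
  have us: "tangent_frame S p ?us"
    using someI_ex[OF unit_tangent_frame_exists[OF S gt]] by blast
  then have ts: "tangent_frame S p ?ts" by (rule someI)
  note len = tangent_frame_length[OF S ts] tangent_frame_length[OF S us]
  note frame = tangent_frame_def[THEN iffD1, OF ts]
  \<comment> \<open>The two choices may give different frames, but their n-vectors are proportional,
    so a graded part that vanishes for one vanishes for the other.\<close>
  have "length ?us = length ?ts" using len by simp
  moreover have "set ?us \<subseteq> span (set ?ts)"
    using ts us span_superset unfolding tangent_frame_def by blast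
  ultimately obtain c where c: "\<And>ws. wedge_list ?us ws = c * wedge_list ?ts ws"
    by (rule wedge_list_eq_multiple) (rule that)
  let ?t0 = "map (to_0 p) ?ts"
  have density: "intrinsic_density H mul es gt n N S p = 0" if "graded_part n ?t0 N = (\<lambda>_. 0)" for N
  proof -
    have "wedge_list (map (to_0 p) ?us) ws = c * wedge_list ?t0 ws" for ws
      unfolding mv_map_wedge_list[OF linear_to_0, symmetric] mv_map_def by (rule c)
    then have "graded_part n (map (to_0 p) ?us) N = (\<lambda>_. 0)"
      using that unfolding graded_part_eq_0_iff by simp
    then show ?thesis
      unfolding intrinsic_density_def left_invariant_norm_def unit_tangent_mv_def
        left_translate_degree_proj[OF len(2)] by (simp add: mv_norm_def)
  qed
  show ?thesis
  proof (rule that[of ?t0])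
    show "length ?t0 = n" using len by simp
    show "distinct ?t0" using frame inj_to_0[of p] by (auto simp: distinct_map intro: inj_on_subset)
    have "independent (to_0 p ` set ?ts)"
      by (rule linear_independent_injective_image[OF linear_to_0])
        (use frame inj_to_0[of p] in \<open>auto intro: inj_on_subset\<close>)
    then show "independent (set ?t0)" by simp
    show "degree_proj H mul es n p M (tangent_mv S p) = (\<lambda>_. 0) \<longleftrightarrow> graded_part n ?t0 M = (\<lambda>_. 0)" for M
      unfolding tangent_mv_def by (rule degree_proj_eq_0_iff[OF len(1)])
    show "homogeneous_tangent_space H mul es n N S p = {v. wedge v (graded_part n ?t0 N) = (\<lambda>_. 0)}" for N
      unfolding homogeneous_tangent_space_def tangent_mv_def left_translate_degree_proj[OF len(1)] ..
    show "graded_part n ?t0 N = (\<lambda>_. 0) \<Longrightarrow> intrinsic_density H mul es gt n N S p = 0" for N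
      by (rule density)
  qed
qed

text \<open>Makes the maximum in \<open>point_degree\<close> meaningful: only degrees of
  multi-indices occur, and a nonzero n-vector has some nonzero graded part.\<close>

lemma graded_part_degrees:
  assumes ts: "length ts = n" "distinct ts" "independent (set ts)"
  defines "D \<equiv> {M. graded_part n ts M \<noteq> (\<lambda>_. 0)}"
  shows "D \<subseteq> index_degree H es ` multi_indices es n" and "finite D" and "D \<noteq> {}"
proof -
  show sub: "D \<subseteq> index_degree H es ` multi_indices es n"
    unfolding D_def graded_part_eq_0_iff by blast
  show "finite D" by (rule finite_subset[OF sub]) (simp add: finite_multi_indices)
  obtain ws where "wedge_list ts ws \<noteq> 0" using wedge_list_nonzero[OF ts(2,3)] by blast
  then have "\<exists>I\<in>multi_indices es n. wedge_list ts (sub_list dual_es I) \<noteq> 0"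
    unfolding es_wedge_expansion[OF ts(1), of ws] by (metis (no_types, lifting) mult_zero_left sum.neutral)
  then show "D \<noteq> {}" unfolding D_def graded_part_eq_0_iff by blast
qed

text \<open>The degrees of all points lie in the finite set of degrees of multi-indices, so the
  maximum over \<open>S\<close> in \<open>submanifold_degree\<close> is a genuine upper
  bound.\<close>

lemma point_degree_facts:
  assumes S: "C1_submanifold n S" "p \<in> S" and gt: "riemannian_metric gt"
    and N: "submanifold_degree H mul es n S = N"
  shows "point_degree H mul es n S p \<le> N"
    and "point_degree H mul es n S p = N \<Longrightarrow> subspace (homogeneous_tangent_space H mul es n N S p)"
    and "point_degree H mul es n S p = N \<Longrightarrow> dim (homogeneous_tangent_space H mul es n N S p) = n"
    and "point_degree H mul es n S p < N \<Longrightarrow> intrinsic_density H mul es gt n N S p = 0"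
proof -
  have degree: "\<exists>ts. length ts = n \<and> distinct ts \<and> independent (set ts) \<and>
      point_degree H mul es n S q = Max {M. graded_part n ts M \<noteq> (\<lambda>_. 0)}" if "q \<in> S" for q
    by (rule tangent_frame_translated[OF S(1) that gt]) (auto simp: point_degree_def)
  have "point_degree H mul es n S ` S \<subseteq> index_degree H es ` multi_indices es n"
  proof
    fix M assume "M \<in> point_degree H mul es n S ` S"
    then obtain q where "q \<in> S" "M = point_degree H mul es n S q" by blast
    then obtain ts where ts: "length ts = n" "distinct ts" "independent (set ts)"
      "M = Max {M. graded_part n ts M \<noteq> (\<lambda>_. 0)}" using degree by blast
    note D = graded_part_degrees[OF ts(1-3)]
    show "M \<in> index_degree H es ` multi_indices es n" unfolding ts(4) using Max_in[OF D(2,3)] D(1) by blast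
  qed
  then have "finite (point_degree H mul es n S ` S)"
    by (rule finite_subset) (simp add: finite_multi_indices)
  then show "point_degree H mul es n S p \<le> N"
    unfolding N[symmetric] submanifold_degree_def using S(2) by (intro Max_ge) auto
  obtain ts where ts: "length ts = n" "distinct ts" "independent (set ts)"
    and proj: "\<And>M. degree_proj H mul es n p M (tangent_mv S p) = (\<lambda>_. 0) \<longleftrightarrow> graded_part n ts M = (\<lambda>_. 0)"
    and A: "\<And>N. homogeneous_tangent_space H mul es n N S p = {v. wedge v (graded_part n ts N) = (\<lambda>_. 0)}"
    and dens: "\<And>N. graded_part n ts N = (\<lambda>_. 0) \<Longrightarrow> intrinsic_density H mul es gt n N S p = 0"
    by (rule tangent_frame_translated[OF S gt]) (rule that)
  let ?D = "{M. graded_part n ts M \<noteq> (\<lambda>_. 0)}"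
  note D = graded_part_degrees[OF ts]
  have pd: "point_degree H mul es n S p = Max ?D" unfolding point_degree_def proj ..
  show "subspace (homogeneous_tangent_space H mul es n N S p)" unfolding A by (rule subspace_annihilator)
  show "dim (homogeneous_tangent_space H mul es n N S p) = n" if eq: "point_degree H mul es n S p = N"
    unfolding A
  proof (rule dim_annihilator_graded_part_eq[OF ts])
    show "graded_part n ts N \<noteq> (\<lambda>_. 0)" using Max_in[OF D(2,3)] eq pd by simp
    fix I assume I: "I \<in> multi_indices es n" "N < index_degree H es I"
    have "index_degree H es I \<notin> ?D"
    proof
      assume "index_degree H es I \<in> ?D"
      then have "index_degree H es I \<le> Max ?D" by (rule Max_ge[OF D(2)])
      then show False using eq pd I(2) by simp
    qed
    then show "wedge_list ts (sub_list dual_es I) = 0"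
      using I(1) unfolding mem_Collect_eq graded_part_eq_0_iff by blast
  qed
  show "intrinsic_density H mul es gt n N S p = 0" if "point_degree H mul es n S p < N"
  proof (rule dens)
    show "graded_part n ts N = (\<lambda>_. 0)"
      using Max_ge[OF D(2), of N] that pd by auto
  qed
qed

end

theorem theorem1p2:
  fixes H :: "nat \<Rightarrow> 'a::euclidean_space set" and \<iota> :: nat
    and br mul :: "'a \<Rightarrow> 'a \<Rightarrow> 'a"
    and d :: "'a \<Rightarrow> 'a \<Rightarrow> real"
    and es :: "'a list"
    and gt :: "'a \<Rightarrow> 'a \<Rightarrow> 'a \<Rightarrow> real"
    and S B :: "'a set" and n N :: nat
  assumes group: "homogeneous_group H \<iota> br mul"
    and dist: "homogeneous_distance H mul d"
    and basis: "adapted_basis H \<iota> es"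
    and metric: "riemannian_metric gt"
    and submanifold: "C1_submanifold n S"
    and degree: "submanifold_degree H mul es n S = N"
    and density: "\<forall>x\<in>S. point_degree H mul es n S x = N \<longrightarrow>
        federer_density d N (intrinsic_measure H mul es gt n N S) x
        = spherical_factor d n (homogeneous_tangent_space H mul es n N S x)"
    and negligible: "spherical_measure d N {x\<in>S. point_degree H mul es n S x < N} = 0"
    and borel: "B \<in> sets borel" "B \<subseteq> S"
  shows "(\<integral>\<^sup>+x\<in>B. spherical_factor d n (homogeneous_tangent_space H mul es n N S x)
            \<partial>spherical_borel d N)
       = (\<integral>\<^sup>+x\<in>B. ennreal (intrinsic_density H mul es gt n N S x) \<partial>surface_measure gt n S)"
proof -
  interpret graded_metric H \<iota> br mul es d
    using group basis dist by (simp add: graded_metric_def graded_metric_axioms_def graded_basis_def graded_basis_axioms_def)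
  let ?\<nu> = "intrinsic_measure H mul es gt n N S"
  let ?\<theta> = "federer_density d N ?\<nu>"
  let ?\<beta> = "\<lambda>x. spherical_factor d n (homogeneous_tangent_space H mul es n N S x)"
  let ?deg = "point_degree H mul es n S"
  have \<nu>: "sets ?\<nu> = sets borel" by simp
  obtain Z where Z: "Z \<in> sets borel" "{x\<in>S. ?deg x < N} \<subseteq> Z" "spherical_measure d N Z = 0"
    by (rule spherical_null_borel[OF negligible]) (rule that)
  have max_degree: "?\<theta> x = ?\<beta> x \<and> 0 < ?\<beta> x \<and> ?\<beta> x < \<infinity>" if x: "x \<in> S" "?deg x = N" for x
  proof -
    note A = point_degree_facts(2,3)[OF submanifold x(1) metric degree x(2)]
    show ?thesis
      using density x spherical_factor_pos[OF A] spherical_factor_finite[OF A(1)] A(2) by simp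
  qed
  have deg_cases: "?deg x = N \<or> ?deg x < N" if "x \<in> S" for x
    using point_degree_facts(1)[OF submanifold that metric degree] by auto
  have "emeasure ?\<nu> Z = 0"
  proof (rule null_of_spherical_null[OF \<nu> Z(1,3)])
    have "{x \<in> space borel. ?\<theta> x = \<infinity>} \<in> sets borel"
      by (intro borel_measurable_eq federer_density_measurable[OF \<nu>] borel_measurable_const)
    then have "Z \<inter> {x. ?\<theta> x = \<infinity>} \<in> sets borel" using Z(1) by auto
    then have "emeasure ?\<nu> (Z \<inter> {x. ?\<theta> x = \<infinity>})
        = (\<integral>\<^sup>+x\<in>Z \<inter> {x. ?\<theta> x = \<infinity>} \<inter> S. ennreal (intrinsic_density H mul es gt n N S x) \<partial>surface_measure gt n S)"
      by (rule emeasure_intrinsic_measure)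
    also have "\<dots> = (\<integral>\<^sup>+x. 0 \<partial>surface_measure gt n S)"
    proof (rule nn_integral_cong)
      fix x
      have "intrinsic_density H mul es gt n N S x = 0" if x: "x \<in> S" "?\<theta> x = \<infinity>"
        using deg_cases[OF x(1)] max_degree[OF x(1)] x(2)
          point_degree_facts(4)[OF submanifold x(1) metric degree] by auto
      then show "ennreal (intrinsic_density H mul es gt n N S x) * indicator (Z \<inter> {x. ?\<theta> x = \<infinity>} \<inter> S) x = 0"
        by (auto simp: indicator_def)
    qed
    finally show "emeasure ?\<nu> (Z \<inter> {x. ?\<theta> x = \<infinity>}) = 0" by simp
  qed
  then have Z_null: "Z \<in> null_sets ?\<nu>" using Z(1) \<nu> by auto
  have good: "?\<theta> x = ?\<beta> x \<and> 0 < ?\<beta> x \<and> ?\<beta> x < \<infinity>" if "x \<in> B - Z" for x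
    using that borel(2) Z(2) deg_cases[of x] by (intro max_degree) auto
  have "(\<integral>\<^sup>+x\<in>B. ?\<beta> x \<partial>spherical_borel d N) = (\<integral>\<^sup>+x\<in>B - Z. ?\<theta> x \<partial>spherical_borel d N)"
  \<comment> \<open>The left-hand integrand is not known to be measurable; off \<open>Z\<close> it
    coincides with the measurable density, and \<open>Z\<close> is a null set.\<close>
  proof (rule nn_integral_cong_AE)
    have "Z \<in> null_sets (spherical_borel d N)"
      using Z by (auto simp: emeasure_spherical_borel)
    then have "AE x in spherical_borel d N. x \<notin> Z" by (rule AE_not_in)
    then show "AE x in spherical_borel d N. ?\<beta> x * indicator B x = ?\<theta> x * indicator (B - Z) x"
      by eventually_elim (use good in \<open>auto simp: indicator_def\<close>)
  qed
  also have "\<dots> = emeasure ?\<nu> (B - Z)"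
    by (rule emeasure_eq_integral_density[OF \<nu>, symmetric]) (use borel(1) Z(1) good in auto)
  also have "\<dots> = emeasure ?\<nu> B"
    using Z_null borel(1) \<nu> by (intro emeasure_Diff_null_set) auto
  also have "\<dots> = (\<integral>\<^sup>+x\<in>B. ennreal (intrinsic_density H mul es gt n N S x) \<partial>surface_measure gt n S)"
    using emeasure_intrinsic_measure[OF borel(1)] borel(2) by (simp add: Int_absorb2)
  finally show ?thesis .
qed

end
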